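(* Let $G$ be a finite group and let $(K_n)_n$ be a sequence of finite simplicial $G$-complexes with vertex degree bounded by $D$. Assume that for some subgroup $H\le G$ the sequence of random rooted simplicial $H$-complexes $(\mu^H_{K_n})_n$ converges weakly to a random rooted simplicial $H$-complex $\mu_\infty$. Then $(\mu^G_{K_n})_n$ converges weakly to $\mathrm{ind}_H^G(\mu_\infty)$ on $\mathcal{SC}_*^D(G)$ if and only if \[ \lim_{n\to\infty}\frac{|E(K_n,g,C)|}{|K_n^{(0)}|}=0\] for all $C>0$ and all $g\in G\setminus H$, where $E(K,g,C)=\{x\in K^{(0)}\mid d(x,gx)\le C\}$ and $d$ denotes the path distance on vertices.
   Context: In what follows $G$ is an arbitrary finite group (the definitions are also applied to subgroups $H$) and $D>0$ a fixed constant. Simplicial complexes are nonempty; $K^{(0)}$ is the vertex set of $K$; the degree of a vertex is the number of $1$-simplices containing it, and the vertex degree of $K$ is the supremum of the degrees. The path distance between vertices in different components is infinite. A simplicial $G$-complex is a simplicial complex with an action of $G$ by simplicial automorphisms. For $\emptyset\neq V\subseteq K^{(0)}$ and $r>0$, $B_r(K,V)$ is the full subcomplex of $K$ on all vertices of path distance at most $r$ from some vertex of $V$. A rooted simplicial $G$-complex is a pair $(K,o)$ of a simplicial $G$-complex $K$ and a $G$-orbit $o\subseteq K^{(0)}$ meeting every connected component of $K$. An isomorphism $(K,o)\cong_G(L,o')$ is a $G$-equivariant simplicial isomorphism $K\to L$ mapping $o$ onto $o'$. $\mathcal{SC}_*^D(G)$ is the set of isomorphism classes $[K,o]$ with vertex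 degree at most $D$, with the (possibly infinite-valued) metric $d([K,o],[L,o'])=\inf\{2^{-r} : (B_r(K,o),o)\cong_G (B_r(L,o'),o')\}$; it is compact and totally disconnected. Similarly, $\mathcal{SC}_{**}^D(G)$ is the space of isomorphism classes $[K,o,o']$ of simplicial $G$-complexes of vertex degree at most $D$ with two vertex orbits each meeting every connected component (isomorphisms preserve both orbits; the topology is defined in the same way using balls $B_r(K,o\cup o')$). A random rooted simplicial $G$-complex is a Borel probability measure $\mu$ on $\mathcal{SC}_*^D(G)$ that is unimodular: for all Borel $f\colon\mathcal{SC}_{**}^D(G)\to\mathbb{R}_{\ge0}$, \[\int\sum_{x\in K^{(0)}}f([K,o,Gx])\,d\mu([K,o])=\int\sum_{x\in K^{(0)}}f([K,Gx,o])\,d\mu([K,o]).\] For a finite simplicial $G$-complex $K$ of vertex degree at most $D$, $\mu_K^G=\frac{1}{|K^{(0)}|}\sum_{x\in K^{(0)}}\delta_{[K,Gx]}$, where $[K,Gx]$ denotes the class of the union of those connected components of $K$ that meet $Gx$, rooted at $Gx$. For a subgroup $H\le G$, a simplicial $G$-complex $K$ is also a simplicial $H$-complex by restriction, and $\mu_K^H$ is defined accordingly. For a subgroup $H\le G$ and an $H$-set $Y$, $G\times_H Y$ is the quotient of $G\times Y$ by $(g,y)\sim(gh,h^{-1}y)$, $h\in H$; the class of $(g,y)$ is $\lfloor g,y\rfloor$ and $g_2\lfloor g_1,y\rfloor=\lfloor g_2g_1,y\rfloor$. For a simplicial $H$-complex $K$, $G\times_HK$ is the simplicial $G$-complex with vertex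 set $G\times_HK^{(0)}$ and simplices $\{\lfloor g,x\rfloor: x\in\sigma\}$ for $g\in G$ and $\sigma$ a simplex of $K$. The map $\mathrm{ind}_H^G\colon\mathcal{SC}_*^D(H)\to\mathcal{SC}_*^D(G)$, $[K,o]\mapsto[G\times_HK,G\lfloor1,o\rfloor]$ is continuous, and for a random rooted simplicial $H$-complex $\mu$, $\mathrm{ind}_H^G(\mu)$ denotes the push-forward measure. *)

theory Defs
  imports "HOL-Algebra.Group_Action" "HOL-Probability.Probability"
begin

section \<open>Simplicial complexes\<close>

text \<open>
  An abstract simplicial complex is given by its set of simplices, each simplex being its
  (finite, nonempty) set of vertices; the vertex set of \<open>K\<close> is \<open>\<Union>K\<close>.
\<close>

definition simplicial_complex :: "'v set set \<Rightarrow> bool" where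
  "simplicial_complex K \<longleftrightarrow>
     K \<noteq> {} \<and> (\<forall>\<sigma>\<in>K. finite \<sigma> \<and> \<sigma> \<noteq> {} \<and> (\<forall>\<tau>. \<tau> \<noteq> {} \<and> \<tau> \<subseteq> \<sigma> \<longrightarrow> \<tau> \<in> K))"

abbreviation verts :: "'v set set \<Rightarrow> 'v set" where
  "verts K \<equiv> \<Union>K"

definition vertex_edges :: "'v set set \<Rightarrow> 'v \<Rightarrow> 'v set set" where
  "vertex_edges K x = {\<sigma> \<in> K. card \<sigma> = 2 \<and> x \<in> \<sigma>}"

definition degree_at :: "'v set set \<Rightarrow> 'v \<Rightarrow> enat" where
  "degree_at K x = (if finite (vertex_edges K x) then enat (card (vertex_edges K x)) else \<infinity>)"

definition vertex_degree :: "'v set set \<Rightarrow> enat" where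
  "vertex_degree K = (SUP x\<in>verts K. degree_at K x)"

definition edge_rel :: "'v set set \<Rightarrow> ('v \<times> 'v) set" where
  "edge_rel K = {(x, y). x \<noteq> y \<and> {x, y} \<in> K}"

text \<open>The infimum of the empty set of \<open>enat\<close> is \<open>\<infinity>\<close>: that is the distance of vertices in
  different components.\<close>

definition path_dist :: "'v set set \<Rightarrow> 'v \<Rightarrow> 'v \<Rightarrow> enat" where
  "path_dist K x y = (INF n\<in>{n. (x, y) \<in> edge_rel K ^^ n}. enat n)"

definition complex_components :: "'v set set \<Rightarrow> 'v set set" where
  "complex_components K = verts K // (edge_rel K)\<^sup>*"


section \<open>Rooted complexes with a group action\<close>

text \<open>
  The group acts on the vertex set. Since \<open>g\<close> and its inverse both map simplices to simplices,
  each \<open>g\<close> is a simplicial automorphism. As usual in the library, \<open>\<phi> g\<close> is extensional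
  outside the vertex set.
\<close>

definition simplicial_G_complex ::
  "('g, 'b) monoid_scheme \<Rightarrow> 'v set set \<Rightarrow> ('g \<Rightarrow> 'v \<Rightarrow> 'v) \<Rightarrow> bool" where
  "simplicial_G_complex G K \<phi> \<longleftrightarrow>
     simplicial_complex K \<and> group_action G (verts K) \<phi> \<and>
     (\<forall>g\<in>carrier G. \<forall>\<sigma>\<in>K. \<phi> g ` \<sigma> \<in> K)"

text \<open>
  A complex \<open>K\<close>, an action \<open>\<phi>\<close>, and a list of vertex orbits (the roots). Lists of length one
  give the rooted complexes \<open>(K, o)\<close>, lists of length two the doubly rooted complexes
  \<open>(K, o, o')\<close>.
\<close>

type_synonym ('g, 'v) rcomplex = "'v set set \<times> ('g \<Rightarrow> 'v \<Rightarrow> 'v) \<times> 'v set list"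

fun rooted_G_complex :: "('g, 'b) monoid_scheme \<Rightarrow> ('g, 'v) rcomplex \<Rightarrow> bool" where
  "rooted_G_complex G (K, \<phi>, os) \<longleftrightarrow>
     simplicial_G_complex G K \<phi> \<and>
     (\<forall>R\<in>set os. R \<in> orbits G (verts K) \<phi> \<and> (\<forall>C\<in>complex_components K. R \<inter> C \<noteq> {}))"

fun rooted_iso ::
  "('g, 'b) monoid_scheme \<Rightarrow> ('g, 'v) rcomplex \<Rightarrow> ('g, 'w) rcomplex \<Rightarrow> bool" where
  "rooted_iso G (K, \<phi>, os) (L, \<psi>, os') \<longleftrightarrow>
     (\<exists>f. bij_betw f (verts K) (verts L) \<and>
          (`) f ` K = L \<and>
          (\<forall>g\<in>carrier G. \<forall>x\<in>verts K. f (\<phi> g x) = \<psi> g (f x)) \<and>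
          map ((`) f) os = os')"

text \<open>The full subcomplex on an invariant set \<open>W\<close> of vertices.\<close>

fun full_sub :: "'v set \<Rightarrow> ('g, 'v) rcomplex \<Rightarrow> ('g, 'v) rcomplex" where
  "full_sub W (K, \<phi>, os) = ({\<sigma>\<in>K. \<sigma> \<subseteq> W}, \<lambda>g. restrict (\<phi> g) W, os)"

fun root_ball :: "real \<Rightarrow> ('g, 'v) rcomplex \<Rightarrow> ('g, 'v) rcomplex" where
  "root_ball r (K, \<phi>, os) =
     full_sub {x\<in>verts K. \<exists>v\<in>\<Union>(set os). ereal_of_enat (path_dist K v x) \<le> ereal r} (K, \<phi>, os)"

fun root_components :: "('g, 'v) rcomplex \<Rightarrow> ('g, 'v) rcomplex" where
  "root_components (K, \<phi>, os) =
     full_sub (\<Union>{C \<in> complex_components K. C \<inter> \<Union>(set os) \<noteq> {}}) (K, \<phi>, os)"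


section \<open>The spaces of isomorphism classes\<close>

text \<open>
  A complex of finite vertex degree in which some finite orbit meets every component has
  countably many vertices. Hence, for finite \<open>G\<close>, every isomorphism class of the complexes in
  question has representatives with vertices in \<open>nat\<close>; the class of a complex, over whatever
  vertex type, is taken to be the set of all of these.
\<close>

definition iso_class ::
  "('g, 'b) monoid_scheme \<Rightarrow> ('g, 'v) rcomplex \<Rightarrow> ('g, nat) rcomplex set" where
  "iso_class G X = {Y. rooted_G_complex G Y \<and> rooted_iso G X Y}"

definition class_rep :: "('g, nat) rcomplex set \<Rightarrow> ('g, nat) rcomplex" where
  "class_rep p = (SOME X. X \<in> p)"

text \<open>\<open>k = 1\<close> and \<open>k = 2\<close> give the spaces of singly and of doubly rooted complexes.\<close>

definition SC :: "('g, 'b) monoid_scheme \<Rightarrow> real \<Rightarrow> nat \<Rightarrow> ('g, nat) rcomplex set set" where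
  "SC G D k =
     {iso_class G (K, \<phi>, os) | (K :: nat set set) \<phi> os.
        rooted_G_complex G (K, \<phi>, os) \<and> ereal_of_enat (vertex_degree K) \<le> ereal D \<and>
        length os = k}"

definition SC_dist ::
  "('g, 'b) monoid_scheme \<Rightarrow> ('g, nat) rcomplex set \<Rightarrow> ('g, nat) rcomplex set \<Rightarrow> ennreal" where
  "SC_dist G p q =
     (INF r\<in>{r. r > 0 \<and> (\<exists>X\<in>p. \<exists>Y\<in>q. rooted_iso G (root_ball r X) (root_ball r Y))}.
        ennreal (2 powr - r))"

definition SC_open ::
  "('g, 'b) monoid_scheme \<Rightarrow> real \<Rightarrow> nat \<Rightarrow> ('g, nat) rcomplex set set \<Rightarrow> bool" where
  "SC_open G D k U \<longleftrightarrow>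
     U \<subseteq> SC G D k \<and> (\<forall>p\<in>U. \<exists>e>0. \<forall>q\<in>SC G D k. SC_dist G p q < e \<longrightarrow> q \<in> U)"

definition SC_top ::
  "('g, 'b) monoid_scheme \<Rightarrow> real \<Rightarrow> nat \<Rightarrow> ('g, nat) rcomplex set topology" where
  "SC_top G D k = topology (SC_open G D k)"

lemma istopology_SC_open: "istopology (SC_open G D k)"
proof -
  have "SC_open G D k (S \<inter> T)" if S: "SC_open G D k S" and T: "SC_open G D k T" for S T
    unfolding SC_open_def
  proof (intro conjI ballI)
    show "S \<inter> T \<subseteq> SC G D k"
      using S by (auto simp: SC_open_def)
    fix p assume p: "p \<in> S \<inter> T"
    obtain e1 where e1: "e1 > 0" "\<forall>q\<in>SC G D k. SC_dist G p q < e1 \<longrightarrow> q \<in> S"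
      using S p unfolding SC_open_def by blast
    obtain e2 where e2: "e2 > 0" "\<forall>q\<in>SC G D k. SC_dist G p q < e2 \<longrightarrow> q \<in> T"
      using T p unfolding SC_open_def by blast
    show "\<exists>e>0. \<forall>q\<in>SC G D k. SC_dist G p q < e \<longrightarrow> q \<in> S \<inter> T"
      using e1 e2 by (intro exI[of _ "min e1 e2"]) auto
  qed
  moreover have "SC_open G D k (\<Union>\<K>)" if \<K>: "\<forall>S\<in>\<K>. SC_open G D k S" for \<K>
    unfolding SC_open_def
  proof (intro conjI ballI)
    show "\<Union>\<K> \<subseteq> SC G D k"
      using \<K> by (auto simp: SC_open_def)
    fix p assume "p \<in> \<Union>\<K>"
    then obtain S where S: "S \<in> \<K>" "p \<in> S" by blast
    then obtain e where "e > 0" "\<forall>q\<in>SC G D k. SC_dist G p q < e \<longrightarrow> q \<in> S"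
      using \<K> unfolding SC_open_def by blast
    then show "\<exists>e>0. \<forall>q\<in>SC G D k. SC_dist G p q < e \<longrightarrow> q \<in> \<Union>\<K>"
      using S by blast
  qed
  ultimately show ?thesis
    unfolding istopology_def by blast
qed

lemma openin_SC_top: "openin (SC_top G D k) = SC_open G D k"
  unfolding SC_top_def by (rule topology_inverse'[OF istopology_SC_open])

lemma topspace_SC_top: "topspace (SC_top G D k) = SC G D k"
proof (rule antisym)
  show "topspace (SC_top G D k) \<subseteq> SC G D k"
    by (auto simp: topspace_def openin_SC_top SC_open_def)
  have "SC_open G D k (SC G D k)"
    unfolding SC_open_def using zero_less_one by blast
  then show "SC G D k \<subseteq> topspace (SC_top G D k)"
    by (auto simp: topspace_def openin_SC_top)
qed

definition SC_borel ::
  "('g, 'b) monoid_scheme \<Rightarrow> real \<Rightarrow> nat \<Rightarrow> ('g, nat) rcomplex set measure" where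
  "SC_borel G D k = sigma (SC G D k) {U. openin (SC_top G D k) U}"


section \<open>Random rooted complexes\<close>

text \<open>
  In the mass transport equation the integrands do not depend on the chosen representative; a
  representative of a point of \<open>SC G D 1\<close> carries a root list of the form \<open>[R]\<close>, and every
  orbit of its vertices meets all components because \<open>R\<close> does.
\<close>

definition random_rooted_complex ::
  "('g, 'b) monoid_scheme \<Rightarrow> real \<Rightarrow> ('g, nat) rcomplex set measure \<Rightarrow> bool" where
  "random_rooted_complex G D \<mu> \<longleftrightarrow>
     prob_space \<mu> \<and> sets \<mu> = sets (SC_borel G D 1) \<and>
     (\<forall>f \<in> borel_measurable (SC_borel G D 2). (\<forall>q\<in>SC G D 2. (0::real) \<le> f q) \<longrightarrow>
        (\<integral>\<^sup>+p. (case class_rep p of (K, \<phi>, os) \<Rightarrow>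
            (\<integral>\<^sup>+x. ennreal (f (iso_class G (K, \<phi>, os @ [orbit G \<phi> x]))) \<partial>count_space (verts K)))
          \<partial>\<mu>) =
        (\<integral>\<^sup>+p. (case class_rep p of (K, \<phi>, os) \<Rightarrow>
            (\<integral>\<^sup>+x. ennreal (f (iso_class G (K, \<phi>, orbit G \<phi> x # os))) \<partial>count_space (verts K)))
          \<partial>\<mu>))"

text \<open>
  The average of the point masses at \<open>[K, Gx]\<close> over all vertices \<open>x\<close> of the finite complex
  \<open>K\<close>, written as the law of \<open>[K, Gx]\<close> for a uniformly random \<open>x\<close>.
\<close>

definition vertex_law ::
  "('g, 'b) monoid_scheme \<Rightarrow> real \<Rightarrow> 'v set set \<Rightarrow> ('g \<Rightarrow> 'v \<Rightarrow> 'v) \<Rightarrow> ('g, nat) rcomplex set measure"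
  where
  "vertex_law G D K \<phi> =
     distr (uniform_count_measure (verts K)) (SC_borel G D 1)
       (\<lambda>x. iso_class G (root_components (K, \<phi>, [orbit G \<phi> x])))"

definition weakly_converges ::
  "'p topology \<Rightarrow> (nat \<Rightarrow> 'p measure) \<Rightarrow> 'p measure \<Rightarrow> bool" where
  "weakly_converges T M N \<longleftrightarrow>
     (\<forall>f. continuous_map T euclideanreal f \<and> bounded (f ` topspace T) \<longrightarrow>
        (\<lambda>n. integral\<^sup>L (M n) f) \<longlonglongrightarrow> integral\<^sup>L N f)"


section \<open>Induction\<close>

definition ind_rel ::
  "('g, 'b) monoid_scheme \<Rightarrow> 'g set \<Rightarrow> ('g \<Rightarrow> 'v \<Rightarrow> 'v) \<Rightarrow> 'v set \<Rightarrow> (('g \<times> 'v) \<times> ('g \<times> 'v)) set" where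
  "ind_rel G H \<phi> Y =
     {((g, y), (g \<otimes>\<^bsub>G\<^esub> h, \<phi> (inv\<^bsub>G\<^esub> h) y)) | g h y. g \<in> carrier G \<and> h \<in> H \<and> y \<in> Y}"

definition ind_point ::
  "('g, 'b) monoid_scheme \<Rightarrow> 'g set \<Rightarrow> ('g \<Rightarrow> 'v \<Rightarrow> 'v) \<Rightarrow> 'v set \<Rightarrow> 'g \<Rightarrow> 'v \<Rightarrow> ('g \<times> 'v) set" where
  "ind_point G H \<phi> Y g y = ind_rel G H \<phi> Y `` {(g, y)}"

definition ind_set ::
  "('g, 'b) monoid_scheme \<Rightarrow> 'g set \<Rightarrow> ('g \<Rightarrow> 'v \<Rightarrow> 'v) \<Rightarrow> 'v set \<Rightarrow> ('g \<times> 'v) set set" where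
  "ind_set G H \<phi> Y = (carrier G \<times> Y) // ind_rel G H \<phi> Y"

definition ind_action ::
  "('g, 'b) monoid_scheme \<Rightarrow> 'g set \<Rightarrow> ('g \<Rightarrow> 'v \<Rightarrow> 'v) \<Rightarrow> 'v set
     \<Rightarrow> 'g \<Rightarrow> ('g \<times> 'v) set \<Rightarrow> ('g \<times> 'v) set" where
  "ind_action G H \<phi> Y g = (\<lambda>c\<in>ind_set G H \<phi> Y. (\<lambda>(g', y). (g \<otimes>\<^bsub>G\<^esub> g', y)) ` c)"

lemma ind_action_ind_point:
  assumes "group G" "subgroup H G" "g1 \<in> carrier G" "g2 \<in> carrier G" "y \<in> Y"
  shows "ind_action G H \<phi> Y g2 (ind_point G H \<phi> Y g1 y) = ind_point G H \<phi> Y (g2 \<otimes>\<^bsub>G\<^esub> g1) y"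
proof -
  interpret group G by fact
  have H: "h \<in> carrier G" if "h \<in> H" for h
    using that subgroup.subset[OF assms(2)] by blast
  have pt: "ind_point G H \<phi> Y g y = (\<lambda>h. (g \<otimes>\<^bsub>G\<^esub> h, \<phi> (inv\<^bsub>G\<^esub> h) y)) ` H"
    if "g \<in> carrier G" for g
    using that assms(5) by (auto simp: ind_point_def ind_rel_def)
  have "ind_point G H \<phi> Y g1 y \<in> ind_set G H \<phi> Y"
    using assms unfolding ind_point_def ind_set_def by (intro quotientI) auto
  then show ?thesis
    using assms H by (auto simp: ind_action_def pt image_image m_assoc intro!: image_cong)
qed

definition ind_complex ::
  "('g, 'b) monoid_scheme \<Rightarrow> 'g set \<Rightarrow> 'v set set \<Rightarrow> ('g \<Rightarrow> 'v \<Rightarrow> 'v) \<Rightarrow> ('g \<times> 'v) set set set" where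
  "ind_complex G H K \<phi> = {ind_point G H \<phi> (verts K) g ` \<sigma> | g \<sigma>. g \<in> carrier G \<and> \<sigma> \<in> K}"

text \<open>For an \<open>H\<close>-orbit \<open>R\<close> the sets \<open>G\<lfloor>1, x\<rfloor>\<close> with \<open>x \<in> R\<close> all coincide, so the union below is the
  single orbit \<open>G\<lfloor>1, R\<rfloor>\<close>.\<close>

fun ind_rooted ::
  "('g, 'b) monoid_scheme \<Rightarrow> 'g set \<Rightarrow> ('g, 'v) rcomplex \<Rightarrow> ('g, ('g \<times> 'v) set) rcomplex" where
  "ind_rooted G H (K, \<phi>, os) =
     (ind_complex G H K \<phi>,
      ind_action G H \<phi> (verts K),
      map (\<lambda>R. \<Union>x\<in>R. orbit G (ind_action G H \<phi> (verts K)) (ind_point G H \<phi> (verts K) \<one>\<^bsub>G\<^esub> x)) os)"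

definition ind_class ::
  "('g, 'b) monoid_scheme \<Rightarrow> 'g set \<Rightarrow> ('g, nat) rcomplex set \<Rightarrow> ('g, nat) rcomplex set" where
  "ind_class G H p = iso_class G (ind_rooted G H (class_rep p))"

definition ind_measure ::
  "('g, 'b) monoid_scheme \<Rightarrow> 'g set \<Rightarrow> real
     \<Rightarrow> ('g, nat) rcomplex set measure \<Rightarrow> ('g, nat) rcomplex set measure" where
  "ind_measure G H D \<mu> = distr \<mu> (SC_borel G D 1) (ind_class G H)"


section \<open>Vertices moved by a bounded distance\<close>

definition displaced :: "'v set set \<Rightarrow> ('g \<Rightarrow> 'v \<Rightarrow> 'v) \<Rightarrow> 'g \<Rightarrow> real \<Rightarrow> 'v set" where
  "displaced K \<phi> g C = {x \<in> verts K. ereal_of_enat (path_dist K x (\<phi> g x)) \<le> ereal C}"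

end

(*
  Both directions compare the G-complexes (K_n, Gx) with the complexes induced from the H-complexes
  (K_n, Hx).

  If few vertices are moved by a bounded distance by elements of G - H, then for most x the r-ball
  around Gx is the disjoint union of the translates of the r-ball around Hx, which is the r-ball of
  the induced complex. So the laws of the r-balls have the same limit, and this suffices for weak
  convergence: the isomorphism types of r-balls are countable in number and form a clopen basis.

  Conversely, count the g in G with d(x, gx) <= C for x in the root orbit. This number is a locally
  constant function of [K, Gx]. In an induced complex it equals the number of such g in H, because
  the other elements of G move the point [1, x] to a different component. Comparing the limits of the
  averages over G and over H shows that the average over x of the number of g in G - H with
  d(x, gx) <= C tends to 0.
*)
theory Submission
  imports Defs
begin

text \<open>An observable must depend on the orbit Gx only. For a single g the condition d(x, gx)
  \<le> C does not: passing from x to kx conjugates g by k. Counting over all of G removes this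
  dependence, but G - H is in general not stable under conjugation by G, so the count over G - H is
  no function of [K, Gx]. It is reached only as a difference of two counts, one over G read on the
  space for G and one over H read on the space for H; both become averages over the same vertices of
  K_n. In the other direction the test functions are indicators of cells, that is, of sets of
  classes with a given ball. Composed with induction such an indicator is again locally constant, so
  the assumed convergence over H applies to it. Balls are compared across different vertex types
  (the given complexes, induced complexes, representatives on the naturals) by the relation
  \<open>ball_sim\<close>. It does not ask the root orbit to meet every component, so K_n rooted at
  Gx can be used as it stands.\<close>

section \<open>Weak convergence from convergence on cells\<close>

text \<open>\<open>f\<close> is compared with the step function that equals \<open>v c\<close> on
  the cell \<open>c\<close> and 0 elsewhere. The error is at most \<open>e\<close> on the cells and
  at most \<open>B\<close> on the remaining set, whose mass is the last factor.\<close>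

lemma integral_approx_by_cells:
  fixes f :: "'p \<Rightarrow> real"
  assumes "prob_space M" and f: "f \<in> borel_measurable M" and B: "\<And>x. x \<in> space M \<Longrightarrow> \<bar>f x\<bar> \<le> B"
    and F: "finite F" "disjoint F" "F \<subseteq> sets M"
    and rep: "\<And>c x. c \<in> F \<Longrightarrow> x \<in> c \<Longrightarrow> \<bar>f x - v c\<bar> \<le> e"
    and "0 \<le> e"
  shows "\<bar>integral\<^sup>L M f - (\<Sum>c\<in>F. v c * measure M c)\<bar> \<le> e + B * (1 - measure M (\<Union>F))"
proof -
  interpret prob_space M by fact
  define g where "g x = (\<Sum>c\<in>F. v c * indicator c x)" for x
  have U: "\<Union>F \<in> sets M" using F by (intro sets.finite_Union)
  have int_f: "integrable M f"
    using f B by (intro integrable_const_bound[of _ B]) auto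
  have ind: "integrable M (\<lambda>x. v c * indicator c x)" if "c \<in> F" for c
    using that F by (intro integrable_mult_right integrable_real_indicator) (auto simp: less_top[symmetric])
  have int_g: "integrable M g"
    unfolding g_def using ind by (rule Bochner_Integration.integrable_sum)
  have "integral\<^sup>L M g = (\<Sum>c\<in>F. integral\<^sup>L M (\<lambda>x. v c * indicator c x))"
    unfolding g_def using ind by (rule Bochner_Integration.integral_sum)
  also have "\<dots> = (\<Sum>c\<in>F. v c * measure M c)"
    using F(3) sets.sets_into_space by (intro sum.cong) (auto simp: Int_absorb2)
  finally have g: "integral\<^sup>L M g = (\<Sum>c\<in>F. v c * measure M c)" .
  have bound: "\<bar>f x - g x\<bar> \<le> e + B * (1 - indicator (\<Union>F) x)" if x: "x \<in> space M" for x
  proof (cases "x \<in> \<Union>F")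
    case True
    then obtain c where c: "c \<in> F" "x \<in> c" by blast
    have "indicator c' x = (if c' = c then 1 else 0 :: real)" if "c' \<in> F" for c'
      using F(2) c that by (auto simp: disjoint_def indicator_def)
    then have "g x = (\<Sum>c'\<in>F. if c' = c then v c else 0)"
      unfolding g_def by (intro sum.cong) auto
    also have "\<dots> = v c" using F(1) c(1) by simp
    finally show ?thesis using rep[OF c] True by simp
  next
    case False
    then have "g x = 0" unfolding g_def by (intro sum.neutral) auto
    then show ?thesis using B[OF x] False \<open>0 \<le> e\<close> by simp
  qed
  have "\<bar>integral\<^sup>L M f - integral\<^sup>L M g\<bar> = \<bar>\<integral>x. f x - g x \<partial>M\<bar>"
    using int_f int_g by simp
  also have "\<dots> \<le> (\<integral>x. \<bar>f x - g x\<bar> \<partial>M)"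
    by (rule integral_abs_bound)
  also have "\<dots> \<le> (\<integral>x. e + B * (1 - indicator (\<Union>F) x) \<partial>M)"
  proof (rule integral_mono)
    show "integrable M (\<lambda>x. \<bar>f x - g x\<bar>)"
      using int_f int_g by simp
    show "integrable M (\<lambda>x. e + B * (1 - indicator (\<Union>F) x))"
      using U by (intro Bochner_Integration.integrable_add integrable_const integrable_mult_right
        Bochner_Integration.integrable_diff integrable_real_indicator) (auto simp: less_top[symmetric])
  qed (use bound in auto)
  also have "\<dots> = e + B * (1 - measure M (\<Union>F))"
  proof -
    have i: "integrable M (indicator (\<Union>F) :: 'p \<Rightarrow> real)"
      using U by (intro integrable_real_indicator) (auto simp: less_top[symmetric])
    have "(\<integral>x. e + B * (1 - indicator (\<Union>F) x) \<partial>M) = (\<integral>x. (e + B) - B * indicator (\<Union>F) x \<partial>M)"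
      by (simp add: algebra_simps)
    also have "\<dots> = (e + B) - B * measure M (\<Union>F)"
      using i U sets.sets_into_space[OF U] by (simp add: prob_space Int_absorb2)
    finally show ?thesis by (simp add: algebra_simps)
  qed
  finally show ?thesis unfolding g .
qed

lemma continuous_map_borel_measurable:
  fixes f :: "'p \<Rightarrow> real"
  assumes "continuous_map T euclideanreal f"
  shows "f \<in> borel_measurable (sigma (topspace T) {U. openin T U})"
proof (rule borel_measurableI)
  fix S :: "real set" assume "open S"
  then have "openin T {x \<in> topspace T. f x \<in> S}"
    using openin_continuous_map_preimage[OF assms] by auto
  moreover have "f -` S \<inter> topspace T = {x \<in> topspace T. f x \<in> S}" by auto
  moreover have "{U. openin T U} \<subseteq> Pow (topspace T)" using openin_subset by auto
  ultimately show "f -` S \<inter> space (sigma (topspace T) {U. openin T U}) \<in> sets (sigma (topspace T) {U. openin T U})"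
    by simp
qed

text \<open>The cells of a point shrink to it, and two cells are nested or disjoint. So the cells of minimal
  level on which \<open>f\<close> oscillates by less than \<open>e\<close> partition the space into countably many pieces, and
  finitely many of these carry almost all the mass of the limit measure. No compactness is needed.\<close>

lemma weakly_converges_of_cells:
  fixes T :: "'p topology" and E :: "nat \<Rightarrow> 'p \<Rightarrow> 'p \<Rightarrow> bool"
  defines "cell \<equiv> \<lambda>n p. {q \<in> topspace T. E n p q}"
  assumes refl: "\<And>n p. p \<in> topspace T \<Longrightarrow> E n p p"
    and sym: "\<And>n p q. p \<in> topspace T \<Longrightarrow> q \<in> topspace T \<Longrightarrow> E n p q \<Longrightarrow> E n q p"
    and trans: "\<And>n p q r. p \<in> topspace T \<Longrightarrow> q \<in> topspace T \<Longrightarrow> r \<in> topspace T \<Longrightarrow>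
      E n p q \<Longrightarrow> E n q r \<Longrightarrow> E n p r"
    and mono: "\<And>m n p q. p \<in> topspace T \<Longrightarrow> q \<in> topspace T \<Longrightarrow> E n p q \<Longrightarrow> m \<le> n \<Longrightarrow> E m p q"
    and openin: "\<And>U. openin T U \<longleftrightarrow> U \<subseteq> topspace T \<and> (\<forall>p\<in>U. \<exists>n. cell n p \<subseteq> U)"
    and count: "\<And>n. countable (cell n ` topspace T)"
    and M: "\<And>k. prob_space (M k)" "\<And>k. sets (M k) = sets (sigma (topspace T) {U. openin T U})"
    and N: "prob_space N" "sets N = sets (sigma (topspace T) {U. openin T U})"
    and conv: "\<And>n p. p \<in> topspace T \<Longrightarrow> (\<lambda>k. measure (M k) (cell n p)) \<longlonglongrightarrow> measure N (cell n p)"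
  shows "weakly_converges T M N"
  unfolding weakly_converges_def
proof (intro allI impI)
  fix f :: "'p \<Rightarrow> real"
  assume f: "continuous_map T euclideanreal f \<and> bounded (f ` topspace T)"
  define S where "S = topspace T"
  have Pow: "{U. openin T U} \<subseteq> Pow (topspace T)" using openin_subset by auto
  have spM: "space (M k) = S" for k using sets_eq_imp_space_eq[OF M(2)] Pow by (simp add: S_def space_measure_of)
  have spN: "space N = S" using sets_eq_imp_space_eq[OF N(2)] Pow by (simp add: S_def space_measure_of)
  have fM: "f \<in> borel_measurable (M k)" for k
    using continuous_map_borel_measurable f measurable_cong_sets[OF M(2) HOL.refl] by blast
  have fN: "f \<in> borel_measurable N"
    using continuous_map_borel_measurable f measurable_cong_sets[OF N(2) HOL.refl] by blast
  have cell_eq: "cell n p = cell n q" if "p \<in> S" "q \<in> cell n p" for n p q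
    using that refl sym trans unfolding cell_def S_def by blast
  have cell_open: "openin T (cell n p)" if "p \<in> S" for n p
    unfolding openin using cell_eq[OF that] by (auto simp: cell_def)
  have cell_self: "p \<in> cell n p" if "p \<in> S" for n p
    using that refl by (simp add: cell_def S_def)
  have cell_sub: "cell n p \<subseteq> S" for n p by (auto simp: cell_def S_def)
  have sets_open: "U \<in> sets (sigma (topspace T) {U. openin T U})" if "openin T U" for U
    using that Pow by simp
  obtain B where B: "0 < B" "\<And>x. x \<in> S \<Longrightarrow> \<bar>f x\<bar> \<le> B"
    using f unfolding bounded_pos by (auto simp: S_def)
  show "(\<lambda>k. integral\<^sup>L (M k) f) \<longlonglongrightarrow> integral\<^sup>L N f"
  proof (rule LIMSEQ_I)
    fix r :: real assume "0 < r"
    \<comment> \<open>The budget is 3e + 2Be = r: each of the two integrals differs from its cell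
      sum by less than e + Be, and the two cell sums differ by less than e.\<close>
    define e where "e = r / (3 + 2 * B)"
    have e: "0 < e" "(3 + 2 * B) * e = r" using \<open>0 < r\<close> B(1) by (simp_all add: e_def)
    define P where "P n p \<longleftrightarrow> (\<forall>q\<in>cell n p. \<forall>q'\<in>cell n p. \<bar>f q - f q'\<bar> \<le> e)" for n p
    have P_ex: "\<exists>n. P n p" if p: "p \<in> S" for p
    proof -
      have "openin T {q \<in> topspace T. f q \<in> ball (f p) (e / 2)}"
        using f by (intro openin_continuous_map_preimage[where Y = euclideanreal]) auto
      then obtain n where n: "cell n p \<subseteq> {q \<in> topspace T. f q \<in> ball (f p) (e / 2)}"
        using openin p e(1) by (auto simp: S_def)
      have "\<bar>f q - f q'\<bar> \<le> e" if "q \<in> cell n p" "q' \<in> cell n p" for q q'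
      proof -
        have "\<bar>f p - f q\<bar> < e / 2" "\<bar>f p - f q'\<bar> < e / 2"
          using n that by (auto simp: dist_real_def)
        then show ?thesis by linarith
      qed
      then show ?thesis unfolding P_def by blast
    qed
    define \<rho> where "\<rho> p = (LEAST n. P n p)" for p
    have P_\<rho>: "P (\<rho> p) p" if "p \<in> S" for p
      unfolding \<rho>_def using P_ex[OF that] by (rule LeastI_ex)
    have \<rho>_le: "\<rho> p \<le> n" if "P n p" for n p
      unfolding \<rho>_def using that by (rule Least_le)
    define c where "c p = cell (\<rho> p) p" for p
    \<comment> \<open>The minimal level is constant on a piece: \<open>q\<close> shares the cell of
      \<open>p\<close> at level \<open>\<rho> p\<close>, so \<open>\<rho> q \<le> \<rho> p\<close>;
      then both lie in one cell at level \<open>\<rho> q\<close> as well, which gives the converse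
      inequality. So the pieces partition the space.\<close>
    have c_eq: "c p = c q" if p: "p \<in> S" and q: "q \<in> c p" for p q
    proof -
      have qS: "q \<in> S" using q cell_sub by (auto simp: c_def)
      have eq: "cell (\<rho> p) p = cell (\<rho> p) q"
        using cell_eq p q by (simp add: c_def)
      then have "\<rho> q \<le> \<rho> p" using P_\<rho>[OF p] by (intro \<rho>_le) (simp add: P_def)
      then have "q \<in> cell (\<rho> q) p"
        using q mono[of p q "\<rho> p" "\<rho> q"] p qS by (auto simp: c_def cell_def S_def)
      then have "cell (\<rho> q) p = cell (\<rho> q) q" using cell_eq p by blast
      then have "\<rho> p \<le> \<rho> q" using P_\<rho>[OF qS] by (intro \<rho>_le) (simp add: P_def)
      then show ?thesis using \<open>\<rho> q \<le> \<rho> p\<close> eq by (simp add: c_def)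
    qed
    have "c ` S \<subseteq> (\<Union>n. cell n ` topspace T)" by (auto simp: c_def S_def)
    then have countable_c: "countable (c ` S)" by (rule countable_subset) (intro countable_UN count; simp)
    have S_ne: "S \<noteq> {}" using prob_space.not_empty[OF N(1)] spN by simp
    \<comment> \<open>The enumeration may repeat pieces if there are only finitely many.
      \<open>F k\<close> is formed as an image, so repetitions disappear.\<close>
    define a where "a = from_nat_into (c ` S)"
    have a: "range a = c ` S"
      unfolding a_def using S_ne countable_c by (intro range_from_nat_into) auto
    define F where "F k = a ` {..<k}" for k
    have F_sub: "F k \<subseteq> c ` S" for k using a by (auto simp: F_def)
    have F_open: "openin T A" if "A \<in> F k" for A k
      using that F_sub cell_open by (auto simp: c_def)
    have F_disj: "disjoint (F k)" for k
    proof (rule disjointI)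
      fix A A' assume "A \<in> F k" "A' \<in> F k" and ne: "A \<noteq> A'"
      then obtain p p' where "p \<in> S" "A = c p" "p' \<in> S" "A' = c p'" using F_sub[of k] by blast
      then show "A \<inter> A' = {}" using c_eq ne by blast
    qed
    have Union_c: "(\<Union>k. \<Union>(F k)) = S"
    proof -
      have "(\<Union>k. \<Union>(F k)) = (\<Union>i. a i)" unfolding F_def by blast
      also have "\<dots> = \<Union>(c ` S)" by (simp only: a)
      also have "\<dots> = S" using cell_self cell_sub unfolding c_def by blast
      finally show ?thesis .
    qed
    have U_sets: "\<Union>(F k) \<in> sets (sigma (topspace T) {U. openin T U})" for k
      using F_open by (intro sets_open openin_Union) auto
    have "incseq (\<lambda>k. \<Union>(F k))"
      unfolding F_def by (intro incseq_SucI Union_mono image_mono) simp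
    then have "(\<lambda>k. measure N (\<Union>(F k))) \<longlonglongrightarrow> measure N (\<Union>k. \<Union>(F k))"
      using N U_sets by (intro finite_measure.finite_Lim_measure_incseq) (auto simp: prob_space_def)
    also have "measure N (\<Union>k. \<Union>(F k)) = 1"
      unfolding Union_c using prob_space.prob_space[OF N(1)] spN by simp
    finally obtain k0 where k0: "1 - e < measure N (\<Union>(F k0))"
      using order_tendstoD(1)[of _ 1 sequentially "1 - e"] e(1)
      by (auto simp: eventually_sequentially)
    define v where "v A = f (SOME p. p \<in> A)" for A
    have v: "\<bar>f x - v A\<bar> \<le> e" if A: "A \<in> F k0" and x: "x \<in> A" for A x
    proof -
      obtain p where p: "p \<in> S" "A = c p" using A F_sub by blast
      have "(SOME p. p \<in> A) \<in> A" using x by (rule someI)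
      then show ?thesis using P_\<rho>[OF p(1)] x unfolding P_def v_def p(2) c_def by blast
    qed
    have finF: "finite (F k0)" by (simp add: F_def)
    have approx: "\<bar>integral\<^sup>L Q f - (\<Sum>A\<in>F k0. v A * measure Q A)\<bar> \<le> e + B * (1 - measure Q (\<Union>(F k0)))"
      if "prob_space Q" "sets Q = sets (sigma (topspace T) {U. openin T U})" "f \<in> borel_measurable Q" for Q
      using that(1,3)
    proof (rule integral_approx_by_cells)
      show "F k0 \<subseteq> sets Q" unfolding that(2) using F_open sets_open by blast
      show "\<bar>f x\<bar> \<le> B" if "x \<in> space Q" for x
        using that sets_eq_imp_space_eq[OF \<open>sets Q = _\<close>] B(2) Pow by (simp add: S_def space_measure_of)
    qed (use finF F_disj v e(1) in auto)
    have conv_F: "(\<lambda>k. measure (M k) A) \<longlonglongrightarrow> measure N A" if "A \<in> F k0" for A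
      using that F_sub[of k0] conv by (auto simp: c_def S_def)
    have meas_U: "measure Q (\<Union>(F k0)) = (\<Sum>A\<in>F k0. measure Q A)"
      if "prob_space Q" "sets Q = sets (sigma (topspace T) {U. openin T U})" for Q
    proof -
      have "disjoint_family_on (\<lambda>A. A) (F k0)" using F_disj by (auto simp: disjoint_family_on_def disjoint_def)
      then show ?thesis
        using finite_measure.finite_measure_finite_Union[of Q "F k0" "\<lambda>A. A"] that finF F_open sets_open
        by (auto simp: prob_space_def)
    qed
    \<comment> \<open>Mass cannot escape: finitely many pieces carry more than 1 - e of the limit
      measure, and their total mass under \<open>M k\<close> converges.\<close>
    have "(\<lambda>k. measure (M k) (\<Union>(F k0))) \<longlonglongrightarrow> measure N (\<Union>(F k0))"
      unfolding meas_U[OF M] meas_U[OF N] using conv_F by (rule tendsto_sum)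
    then have ev1: "\<forall>\<^sub>F k in sequentially. 1 - e < measure (M k) (\<Union>(F k0))"
      using k0 by (rule order_tendstoD(1))
    have "(\<lambda>k. \<Sum>A\<in>F k0. v A * measure (M k) A) \<longlonglongrightarrow> (\<Sum>A\<in>F k0. v A * measure N A)"
      using conv_F by (intro tendsto_sum tendsto_mult_left)
    then have ev2: "\<forall>\<^sub>F k in sequentially.
        dist (\<Sum>A\<in>F k0. v A * measure (M k) A) (\<Sum>A\<in>F k0. v A * measure N A) < e"
      using e(1) by (rule tendstoD)
    have "\<forall>\<^sub>F k in sequentially. norm (integral\<^sup>L (M k) f - integral\<^sup>L N f) < r"
      using ev1 ev2
    proof eventually_elim
      case (elim k)
      have "B * (1 - measure (M k) (\<Union>(F k0))) < B * e" "B * (1 - measure N (\<Union>(F k0))) < B * e"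
        using elim(1) k0 B(1) by (simp_all only: mult_less_cancel_left_pos)
      moreover have "3 * e + 2 * (B * e) = r" using e(2) by (simp add: algebra_simps)
      ultimately show ?case
        using approx[OF M fM, of k] approx[OF N fN] elim(2) unfolding dist_real_def real_norm_def
        by linarith
    qed
    then show "\<exists>k1. \<forall>k\<ge>k1. norm (integral\<^sup>L (M k) f - integral\<^sup>L N f) < r"
      by (simp add: eventually_sequentially)
  qed
qed


text \<open>Membership in \<open>verts K\<close> is to stay opaque to the automation.\<close>

declare Union_iff [simp del] UN_ball_bex_simps [simp del] UnionE [rule del] UnionI [rule del]

section \<open>Neighbourhoods in a complex\<close>

text \<open>The ball of radius \<open>n\<close> about \<open>R\<close>, grown edge by edge. This
  form suits inductions along partial isomorphisms; path distances enter only through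
  \<open>path_dist_le_iff\<close>.\<close>

primrec nbhd :: "'v set set \<Rightarrow> 'v set \<Rightarrow> nat \<Rightarrow> 'v set" where
  "nbhd K R 0 = R"
| "nbhd K R (Suc n) = nbhd K R n \<union> edge_rel K `` nbhd K R n"

lemma mem_nbhd_iff: "x \<in> nbhd K R n \<longleftrightarrow> (\<exists>v\<in>R. \<exists>m\<le>n. (v, x) \<in> edge_rel K ^^ m)"
proof (induction n arbitrary: x)
  case 0
  then show ?case by auto
next
  case (Suc n)
  have "x \<in> nbhd K R (Suc n) \<longleftrightarrow> (\<exists>v\<in>R. \<exists>m\<le>n. (v, x) \<in> edge_rel K ^^ m) \<or>
      (\<exists>y. (\<exists>v\<in>R. \<exists>m\<le>n. (v, y) \<in> edge_rel K ^^ m) \<and> (y, x) \<in> edge_rel K)"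
    unfolding nbhd.simps Un_iff Image_iff Bex_def Suc.IH by blast
  also have "\<dots> \<longleftrightarrow> (\<exists>v\<in>R. \<exists>m\<le>n. (v, x) \<in> edge_rel K ^^ m) \<or>
      (\<exists>v\<in>R. \<exists>m\<le>n. (v, x) \<in> edge_rel K ^^ Suc m)"
    unfolding relpow.simps relcomp_unfold by blast
  also have "\<dots> \<longleftrightarrow> (\<exists>v\<in>R. \<exists>m\<le>Suc n. (v, x) \<in> edge_rel K ^^ m)"
  proof
    assume "\<exists>v\<in>R. \<exists>m\<le>Suc n. (v, x) \<in> edge_rel K ^^ m"
    then obtain v m where v: "v \<in> R" and m: "m \<le> Suc n" "(v, x) \<in> edge_rel K ^^ m" by blast
    show "(\<exists>v\<in>R. \<exists>m\<le>n. (v, x) \<in> edge_rel K ^^ m) \<or> (\<exists>v\<in>R. \<exists>m\<le>n. (v, x) \<in> edge_rel K ^^ Suc m)"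
    proof (cases "m \<le> n")
      case True
      then show ?thesis using v m(2) by blast
    next
      case False
      then have "m = Suc n" using m(1) by simp
      then show ?thesis using v m(2) by blast
    qed
  next
    assume "(\<exists>v\<in>R. \<exists>m\<le>n. (v, x) \<in> edge_rel K ^^ m) \<or> (\<exists>v\<in>R. \<exists>m\<le>n. (v, x) \<in> edge_rel K ^^ Suc m)"
    then show "\<exists>v\<in>R. \<exists>m\<le>Suc n. (v, x) \<in> edge_rel K ^^ m"
      using le_SucI Suc_le_mono by blast
  qed
  finally show ?case .
qed

lemma nbhd_mono: "m \<le> n \<Longrightarrow> nbhd K R m \<subseteq> nbhd K R n"
  by (auto simp: mem_nbhd_iff) (meson le_trans)

lemma nbhd_superset: "R \<subseteq> nbhd K R n"
  using nbhd_mono[of 0 n K R] by simp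

lemma nbhd_mono_set: "R \<subseteq> S \<Longrightarrow> nbhd K R n \<subseteq> nbhd K S n"
  unfolding subset_iff mem_nbhd_iff by blast

lemma edge_relD: "(x, y) \<in> edge_rel K \<Longrightarrow> x \<in> verts K \<and> y \<in> verts K"
  unfolding edge_rel_def by (blast intro: UnionI)

lemma edge_rel_sym: "(x, y) \<in> edge_rel K \<Longrightarrow> (y, x) \<in> edge_rel K"
  by (auto simp: edge_rel_def insert_commute)

lemma nbhd_subset_verts: "R \<subseteq> verts K \<Longrightarrow> nbhd K R n \<subseteq> verts K"
  by (induction n) (auto dest: edge_relD)

lemma nbhd_sym:
  assumes "y \<in> nbhd K {x} n"
  shows "x \<in> nbhd K {y} n"
proof -
  have "(b, a) \<in> edge_rel K ^^ m" if "(a, b) \<in> edge_rel K ^^ m" for a b m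
    using that
  proof (induction m arbitrary: b)
    case (Suc m)
    then obtain c where "(a, c) \<in> edge_rel K ^^ m" "(c, b) \<in> edge_rel K" by auto
    then show ?case using Suc.IH by (blast intro: relpow_Suc_I2 edge_rel_sym)
  qed simp
  note sym = this
  show ?thesis
    using assms unfolding mem_nbhd_iff by (blast dest: sym)
qed

lemma nbhd_trans:
  assumes "y \<in> nbhd K {x} m" "z \<in> nbhd K {y} n"
  shows "z \<in> nbhd K {x} (m + n)"
proof -
  obtain i j where "i \<le> m" "(x, y) \<in> edge_rel K ^^ i" "j \<le> n" "(y, z) \<in> edge_rel K ^^ j"
    using assms by (auto simp: mem_nbhd_iff)
  then have "(x, z) \<in> edge_rel K ^^ (i + j)"
    by (auto simp: relpow_add)
  then show ?thesis
    using \<open>i \<le> m\<close> \<open>j \<le> n\<close> by (auto simp: mem_nbhd_iff intro!: exI[of _ "i + j"])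
qed

lemma nbhd_UN: "nbhd K R n = (\<Union>x\<in>R. nbhd K {x} n)"
  unfolding set_eq_iff UN_iff mem_nbhd_iff by blast

text \<open>Finite distances are natural numbers, so a real bound acts through its floor. The
  condition \<open>0 \<le> r\<close> is stated separately because \<open>nat\<close> sends negative
  floors to 0, and the ball of radius 0 is not empty.\<close>

lemma path_dist_le_iff:
  "ereal_of_enat (path_dist K x y) \<le> ereal r \<longleftrightarrow> 0 \<le> r \<and> y \<in> nbhd K {x} (nat \<lfloor>r\<rfloor>)"
proof (cases "\<exists>n. (x, y) \<in> edge_rel K ^^ n")
  case True
  define m where "m = (LEAST n. (x, y) \<in> edge_rel K ^^ n)"
  have m: "(x, y) \<in> edge_rel K ^^ m"
    unfolding m_def using True by (rule LeastI_ex)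
  have le: "m \<le> n" if "(x, y) \<in> edge_rel K ^^ n" for n
    unfolding m_def using that by (rule Least_le)
  have "path_dist K x y = enat m"
    unfolding path_dist_def
    by (rule antisym) (auto intro!: INF_lower2[of m] INF_greatest simp: m le)
  moreover have "y \<in> nbhd K {x} k \<longleftrightarrow> m \<le> k" for k
    using m le by (auto simp: mem_nbhd_iff intro: le_trans)
  ultimately show ?thesis
    by (simp add: le_nat_iff le_floor_iff) linarith
next
  case False
  then show ?thesis
    by (auto simp: path_dist_def mem_nbhd_iff top_enat_def)
qed

lemma edge_rtrancl_sym:
  assumes "(x, y) \<in> (edge_rel K)\<^sup>*"
  shows "(y, x) \<in> (edge_rel K)\<^sup>*"
proof -
  have "sym ((edge_rel K)\<^sup>*)"
    by (rule sym_rtrancl) (auto simp: sym_def edge_rel_sym)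
  then show ?thesis using assms by (rule symD)
qed

lemma mem_UN_nbhd_iff: "x \<in> (\<Union>n. nbhd K R n) \<longleftrightarrow> (\<exists>v\<in>R. (v, x) \<in> (edge_rel K)\<^sup>*)"
  unfolding UN_iff mem_nbhd_iff rtrancl_power by blast

section \<open>Simplices, and finiteness of balls under a degree bound\<close>

lemma simplicial_complexD:
  assumes "simplicial_complex K" "\<sigma> \<in> K"
  shows "finite \<sigma>" "\<sigma> \<noteq> {}" "\<And>\<tau>. \<tau> \<noteq> {} \<Longrightarrow> \<tau> \<subseteq> \<sigma> \<Longrightarrow> \<tau> \<in> K"
  using assms unfolding simplicial_complex_def by blast+

lemma singleton_simplex:
  assumes "simplicial_complex K" "x \<in> verts K"
  shows "{x} \<in> K"
proof -
  obtain \<sigma> where "\<sigma> \<in> K" "x \<in> \<sigma>" using assms(2) by (rule UnionE)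
  then show ?thesis using simplicial_complexD(3)[OF assms(1), of \<sigma> "{x}"] by simp
qed

lemma finite_verts: "simplicial_complex K \<Longrightarrow> finite K \<Longrightarrow> finite (verts K)"
  by (rule finite_Union) (auto simp: simplicial_complex_def)

lemma verts_nonempty: "simplicial_complex K \<Longrightarrow> verts K \<noteq> {}"
  unfolding simplicial_complex_def by fastforce

lemma verts_full_sub:
  assumes "simplicial_complex K" "A \<subseteq> verts K"
  shows "\<Union>{\<sigma>\<in>K. \<sigma> \<subseteq> A} = A"
proof (intro equalityI subsetI)
  fix x assume "x \<in> A"
  then have "{x} \<in> {\<sigma>\<in>K. \<sigma> \<subseteq> A}"
    using singleton_simplex[OF assms(1), of x] assms(2) by (simp add: subset_iff)
  then show "x \<in> \<Union>{\<sigma>\<in>K. \<sigma> \<subseteq> A}" by (rule UnionI) simp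
next
  fix x assume "x \<in> \<Union>{\<sigma>\<in>K. \<sigma> \<subseteq> A}"
  then obtain \<sigma> where "x \<in> \<sigma>" "\<sigma> \<subseteq> A" by (rule UnionE) simp
  then show "x \<in> A" by (rule rev_subsetD)
qed

text \<open>The bound \<open>D\<close> is real, so degrees are not \<infinity>. Each neighbour of
  \<open>x\<close> lies in one of the finitely many edges at \<open>x\<close>, and these are finite
  sets.\<close>

lemma finite_edge_image:
  assumes "simplicial_complex K" "ereal_of_enat (vertex_degree K) \<le> ereal D"
  shows "finite (edge_rel K `` {x})"
proof (cases "x \<in> verts K")
  case True
  have "degree_at K x \<le> vertex_degree K"
    unfolding vertex_degree_def using True by (rule SUP_upper)
  then have "degree_at K x \<noteq> \<infinity>"
    using assms(2) by (cases "degree_at K x"; cases "vertex_degree K") auto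
  then have "finite (vertex_edges K x)"
    by (auto simp: degree_at_def split: if_splits)
  moreover have "edge_rel K `` {x} \<subseteq> \<Union>(vertex_edges K x)"
    by (auto simp: edge_rel_def vertex_edges_def Union_iff) (metis card_2_iff insertI1 insertI2)
  moreover have "finite (\<Union>(vertex_edges K x))"
    using calculation(1) assms(1) by (auto simp: vertex_edges_def simplicial_complex_def)
  ultimately show ?thesis
    by (blast intro: finite_subset)
next
  case False
  then have "edge_rel K `` {x} = {}"
    by (auto dest: edge_relD)
  then show ?thesis by simp
qed

lemma finite_nbhd:
  assumes "simplicial_complex K" "ereal_of_enat (vertex_degree K) \<le> ereal D" "finite R"
  shows "finite (nbhd K R n)"
proof (induction n)
  case (Suc n)
  have "edge_rel K `` nbhd K R n = (\<Union>x\<in>nbhd K R n. edge_rel K `` {x})"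
    by blast
  then show ?case
    using Suc finite_edge_image[OF assms(1,2)] by simp
qed (use assms in simp)


section \<open>Actions on complexes\<close>

text \<open>The element \<open>inv g\<close> supplies the inverse map, hence bijectivity;
  extensionality turns the pointwise multiplication law into an equation in
  \<open>BijGroup E\<close>.\<close>

lemma group_actionI:
  fixes G (structure)
  assumes "group G"
    and ext: "\<And>g. g \<in> carrier G \<Longrightarrow> \<phi> g \<in> extensional E"
    and closed: "\<And>g x. g \<in> carrier G \<Longrightarrow> x \<in> E \<Longrightarrow> \<phi> g x \<in> E"
    and mult: "\<And>g h x. g \<in> carrier G \<Longrightarrow> h \<in> carrier G \<Longrightarrow> x \<in> E \<Longrightarrow> \<phi> (g \<otimes> h) x = \<phi> g (\<phi> h x)"
    and one: "\<And>x. x \<in> E \<Longrightarrow> \<phi> \<one> x = x"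
  shows "group_action G E \<phi>"
proof -
  interpret group G by fact
  have inv: "\<phi> (inv g) (\<phi> g x) = x" "\<phi> g (\<phi> (inv g) x) = x" if "g \<in> carrier G" "x \<in> E" for g x
    using mult[of "inv g" g x] mult[of g "inv g" x] one that by simp_all
  have Bij: "\<phi> g \<in> Bij E" if g: "g \<in> carrier G" for g
  proof -
    have "bij_betw (\<phi> g) E E"
      by (rule bij_betwI[where g = "\<phi> (inv g)"]) (use g closed inv in auto)
    then show ?thesis using ext[OF g] by (simp add: Bij_def)
  qed
  have "\<phi> (g \<otimes> h) = compose E (\<phi> g) (\<phi> h)" if "g \<in> carrier G" "h \<in> carrier G" for g h
  proof (rule extensionalityI)
    show "\<phi> (g \<otimes> h) \<in> extensional E" using that by (simp add: ext)
    show "compose E (\<phi> g) (\<phi> h) \<in> extensional E" by simp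
  qed (use that mult in \<open>simp add: compose_eq\<close>)
  then have "\<phi> \<in> hom G (BijGroup E)"
    using Bij by (auto simp: hom_def BijGroup_def)
  then show ?thesis
    by (simp add: group_action_def group_hom_def group_hom_axioms_def group_BijGroup assms(1))
qed

locale gcomplex =
  fixes G (structure) and K :: "'v set set" and \<phi>
  assumes simplicial_G: "simplicial_G_complex G K \<phi>"
begin

lemma complex: "simplicial_complex K" and action: "group_action G (verts K) \<phi>"
  and simplex_image: "g \<in> carrier G \<Longrightarrow> \<sigma> \<in> K \<Longrightarrow> \<phi> g ` \<sigma> \<in> K"
  using simplicial_G by (auto simp: simplicial_G_complex_def)

lemma is_group: "group G"
  using action by (auto simp: group_action_def group_hom_def)

sublocale group G by (rule is_group)

sublocale act: group_action G "verts K" \<phi> by (rule action)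

lemma act_closed: "g \<in> carrier G \<Longrightarrow> x \<in> verts K \<Longrightarrow> \<phi> g x \<in> verts K"
  using act.element_image by blast

lemma act_mult:
  "g \<in> carrier G \<Longrightarrow> h \<in> carrier G \<Longrightarrow> x \<in> verts K \<Longrightarrow> \<phi> (g \<otimes> h) x = \<phi> g (\<phi> h x)"
  using act.composition_rule by blast

lemma act_one: "x \<in> verts K \<Longrightarrow> \<phi> \<one> x = x"
  using act.id_eq_one by (metis restrict_apply')

lemma act_inv:
  "g \<in> carrier G \<Longrightarrow> x \<in> verts K \<Longrightarrow> \<phi> (inv g) (\<phi> g x) = x"
  "g \<in> carrier G \<Longrightarrow> x \<in> verts K \<Longrightarrow> \<phi> g (\<phi> (inv g) x) = x"
  using act.orbit_sym_aux[of g x "\<phi> g x"] act.orbit_sym_aux[of "inv g" x "\<phi> (inv g) x"] by auto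

lemma act_ext: "g \<in> carrier G \<Longrightarrow> \<phi> g \<in> extensional (verts K)"
  using act.bij_prop0 by (auto simp: Bij_def)

lemma act_inj: "g \<in> carrier G \<Longrightarrow> x \<in> verts K \<Longrightarrow> y \<in> verts K \<Longrightarrow> \<phi> g x = \<phi> g y \<longleftrightarrow> x = y"
  by (metis act_inv(1))

text \<open>The forward direction holds because \<open>inv g\<close> preserves simplices
  too.\<close>

lemma simplex_image_iff:
  assumes "g \<in> carrier G" "\<sigma> \<subseteq> verts K"
  shows "\<phi> g ` \<sigma> \<in> K \<longleftrightarrow> \<sigma> \<in> K"
proof
  assume "\<phi> g ` \<sigma> \<in> K"
  then have "\<phi> (inv g) ` \<phi> g ` \<sigma> \<in> K"
    using assms simplex_image[of "inv g"] by simp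
  moreover have "\<phi> (inv g) ` \<phi> g ` \<sigma> = \<sigma>"
    using assms act_inv(1) by (force simp: image_image)
  ultimately show "\<sigma> \<in> K" by simp
qed (use assms simplex_image in auto)

lemma edge_act:
  assumes "g \<in> carrier G" "x \<in> verts K" "y \<in> verts K"
  shows "(\<phi> g x, \<phi> g y) \<in> edge_rel K \<longleftrightarrow> (x, y) \<in> edge_rel K"
  using simplex_image_iff[of g "{x, y}"] assms act_inj by (auto simp: edge_rel_def)

lemma nbhd_act:
  assumes "g \<in> carrier G" "R \<subseteq> verts K"
  shows "nbhd K (\<phi> g ` R) n = \<phi> g ` nbhd K R n"
proof (induction n)
  case (Suc n)
  have N: "nbhd K R n \<subseteq> verts K" using assms(2) by (rule nbhd_subset_verts)
  have "edge_rel K `` (\<phi> g ` nbhd K R n) = \<phi> g ` (edge_rel K `` nbhd K R n)"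
  proof (intro equalityI subsetI)
    fix y assume "y \<in> edge_rel K `` (\<phi> g ` nbhd K R n)"
    then obtain x where x: "x \<in> nbhd K R n" "(\<phi> g x, y) \<in> edge_rel K" by auto
    have y: "y \<in> verts K" using x edge_relD by fast
    then have "(x, \<phi> (inv g) y) \<in> edge_rel K"
      using x edge_act[of g x "\<phi> (inv g) y"] assms N act_closed act_inv by auto
    then show "y \<in> \<phi> g ` (edge_rel K `` nbhd K R n)"
      using x y assms(1) by (intro image_eqI[of _ _ "\<phi> (inv g) y"]) (auto simp: act_inv)
  next
    fix y assume "y \<in> \<phi> g ` (edge_rel K `` nbhd K R n)"
    then obtain x z where "x \<in> nbhd K R n" "(x, z) \<in> edge_rel K" "y = \<phi> g z" by auto
    then show "y \<in> edge_rel K `` (\<phi> g ` nbhd K R n)"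
      using edge_act[of g x z] assms(1) by (auto dest: edge_relD)
  qed
  then show ?case by (simp add: Suc image_Un)
qed simp

lemma nbhd_act_iff:
  assumes "g \<in> carrier G" "x \<in> verts K" "y \<in> verts K"
  shows "\<phi> g y \<in> nbhd K {\<phi> g x} n \<longleftrightarrow> y \<in> nbhd K {x} n"
proof -
  have "nbhd K {\<phi> g x} n = \<phi> g ` nbhd K {x} n"
    using nbhd_act[of g "{x}"] assms by simp
  then show ?thesis
    using nbhd_subset_verts[of "{x}" K n] assms act_inj by (auto simp: subset_iff)
qed

lemma orbit_subset: "x \<in> verts K \<Longrightarrow> orbit G \<phi> x \<subseteq> verts K"
  using act_closed by (auto simp: orbit_def)

lemma orbit_self: "x \<in> verts K \<Longrightarrow> x \<in> orbit G \<phi> x"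
  by (rule act.orbit_refl)

lemma orbitsD: "R \<in> orbits G (verts K) \<phi> \<Longrightarrow> \<exists>x\<in>verts K. R = orbit G \<phi> x"
  by (auto simp: orbits_def)

lemma orbits_subset: "R \<in> orbits G (verts K) \<phi> \<Longrightarrow> R \<subseteq> verts K"
  using orbit_subset by (auto simp: orbits_def)

lemma orbits_inv:
  assumes "R \<in> orbits G (verts K) \<phi>" "g \<in> carrier G" "x \<in> R"
  shows "\<phi> g x \<in> R"
proof -
  obtain z where z: "z \<in> verts K" "R = orbit G \<phi> z" using orbitsD[OF assms(1)] by blast
  then obtain h where h: "h \<in> carrier G" "x = \<phi> h z" using assms(3) by (auto simp: orbit_def)
  then have "\<phi> g x = \<phi> (g \<otimes> h) z" using z assms(2) by (simp add: act_mult)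
  then show ?thesis using z(2) h(1) assms(2) unfolding orbit_def by blast
qed

lemma orbits_transitive:
  "R \<in> orbits G (verts K) \<phi> \<Longrightarrow> x \<in> R \<Longrightarrow> y \<in> R \<Longrightarrow> \<exists>g\<in>carrier G. y = \<phi> g x"
proof -
  assume "R \<in> orbits G (verts K) \<phi>" "x \<in> R" "y \<in> R"
  then obtain z g h where z: "z \<in> verts K" and gh: "g \<in> carrier G" "h \<in> carrier G"
    and xy: "x = \<phi> g z" "y = \<phi> h z"
    by (auto simp: orbits_def orbit_def)
  then have "y = \<phi> (h \<otimes> inv g) x"
    using z gh by (simp add: act_mult act_closed act_inv)
  then show ?thesis using gh by blast
qed

lemma orbits_nonempty: "R \<in> orbits G (verts K) \<phi> \<Longrightarrow> R \<noteq> {}"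
  using orbit_self by (auto simp: orbits_def)

lemma orbits_eq_orbit: "R \<in> orbits G (verts K) \<phi> \<Longrightarrow> x \<in> R \<Longrightarrow> R = orbit G \<phi> x"
  using orbits_transitive[of R x] orbits_inv[of R _ x] unfolding orbit_def by blast

lemma finite_orbits: "finite (carrier G) \<Longrightarrow> R \<in> orbits G (verts K) \<phi> \<Longrightarrow> finite R"
  by (auto simp: orbits_def orbit_def Setcompr_eq_image)

lemma nbhd_inv:
  assumes "g \<in> carrier G" "R \<subseteq> verts K" "\<And>x. x \<in> R \<Longrightarrow> \<phi> g x \<in> R" "x \<in> nbhd K R n"
  shows "\<phi> g x \<in> nbhd K R n"
proof -
  have "\<phi> g x \<in> nbhd K (\<phi> g ` R) n"
    using assms by (simp add: nbhd_act)
  also have "\<dots> \<subseteq> nbhd K R n"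
    by (rule nbhd_mono_set) (use assms in auto)
  finally show ?thesis .
qed

lemma subgroup_gcomplex: "subgroup H G \<Longrightarrow> gcomplex (G\<lparr>carrier := H\<rparr>) K \<phi>"
proof -
  assume H: "subgroup H G"
  then have sub: "h \<in> carrier G" if "h \<in> H" for h
    using that subgroup.subset by blast
  have "group_action (G\<lparr>carrier := H\<rparr>) (verts K) \<phi>"
    using subgroup.subgroup_is_group[OF H is_group] sub
    by (intro group_actionI) (auto simp: act_mult act_one act_closed act_ext)
  then show ?thesis
    using sub complex simplex_image by unfold_locales (auto simp: simplicial_G_complex_def)
qed

end


section \<open>Isomorphisms between invariant full subcomplexes\<close>

text \<open>An isomorphism of the full subcomplexes spanned by \<open>A\<close> and
  \<open>B\<close>, phrased inside the ambient complexes and actions. Shrinking \<open>A\<close>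
  then changes neither of these, and balls remain balls of \<open>K\<close> and
  \<open>L\<close>.\<close>

definition local_iso ::
  "('g, 'b) monoid_scheme \<Rightarrow> 'v set \<Rightarrow> 'v set set \<Rightarrow> ('g \<Rightarrow> 'v \<Rightarrow> 'v) \<Rightarrow> 'w set \<Rightarrow> 'w set set
     \<Rightarrow> ('g \<Rightarrow> 'w \<Rightarrow> 'w) \<Rightarrow> ('v \<Rightarrow> 'w) \<Rightarrow> bool" where
  "local_iso G A K \<phi> B L \<psi> f \<longleftrightarrow>
     bij_betw f A B \<and> (\<forall>\<sigma>. \<sigma> \<subseteq> A \<longrightarrow> (f ` \<sigma> \<in> L \<longleftrightarrow> \<sigma> \<in> K)) \<and>
     (\<forall>g\<in>carrier G. \<forall>x\<in>A. f (\<phi> g x) = \<psi> g (f x))"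

lemma local_isoD:
  assumes "local_iso G A K \<phi> B L \<psi> f"
  shows "bij_betw f A B" "inj_on f A" "f ` A = B"
    and "\<And>\<sigma>. \<sigma> \<subseteq> A \<Longrightarrow> f ` \<sigma> \<in> L \<longleftrightarrow> \<sigma> \<in> K"
    and "\<And>g x. g \<in> carrier G \<Longrightarrow> x \<in> A \<Longrightarrow> f (\<phi> g x) = \<psi> g (f x)"
  using assms by (simp_all add: local_iso_def bij_betw_def)

lemma local_isoI:
  assumes "bij_betw f A B" "\<And>\<sigma>. \<sigma> \<subseteq> A \<Longrightarrow> f ` \<sigma> \<in> L \<longleftrightarrow> \<sigma> \<in> K"
    and "\<And>g x. g \<in> carrier G \<Longrightarrow> x \<in> A \<Longrightarrow> f (\<phi> g x) = \<psi> g (f x)"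
  shows "local_iso G A K \<phi> B L \<psi> f"
  using assms by (simp add: local_iso_def)

text \<open>Invariance of \<open>A\<close> puts \<open>\<phi> g x\<close> into the domain on which
  \<open>f\<close> is inverted; this makes the inverse equivariant.\<close>

lemma local_iso_sym:
  assumes f: "local_iso G A K \<phi> B L \<psi> f"
    and inv: "\<And>g x. g \<in> carrier G \<Longrightarrow> x \<in> A \<Longrightarrow> \<phi> g x \<in> A"
  shows "local_iso G B L \<psi> A K \<phi> (inv_into A f)"
proof (rule local_isoI)
  note D = local_isoD[OF f]
  show "bij_betw (inv_into A f) B A" using D(1) by (rule bij_betw_inv_into)
  show "inv_into A f ` \<sigma> \<in> K \<longleftrightarrow> \<sigma> \<in> L" if "\<sigma> \<subseteq> B" for \<sigma>
  proof -
    have "inv_into A f ` \<sigma> \<subseteq> A"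
      using that D(3) inv_into_into[of _ f A] by blast
    moreover have "f ` inv_into A f ` \<sigma> = \<sigma>"
      using that D(3) by (simp add: image_inv_into_cancel)
    ultimately show ?thesis using D(4)[of "inv_into A f ` \<sigma>"] by simp
  qed
  show "inv_into A f (\<psi> g y) = \<phi> g (inv_into A f y)" if y: "g \<in> carrier G" "y \<in> B" for g y
  proof -
    obtain x where x: "x \<in> A" "y = f x" using D(3) y(2) by blast
    then have "inv_into A f (f (\<phi> g x)) = \<phi> g x"
      using inv y(1) D(2) by (simp add: inv_into_f_f)
    then show ?thesis
      using x D(2) D(5)[of g x] y by (simp add: inv_into_f_f)
  qed
qed

lemma local_iso_trans:
  assumes f: "local_iso G A K \<phi> B L \<psi> f" and h: "local_iso G B L \<psi> C M \<omega> h"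
  shows "local_iso G A K \<phi> C M \<omega> (h \<circ> f)"
proof (rule local_isoI)
  note F = local_isoD[OF f] and H = local_isoD[OF h]
  show "bij_betw (h \<circ> f) A C" using F(1) H(1) by (rule bij_betw_trans)
  show "(h \<circ> f) ` \<sigma> \<in> M \<longleftrightarrow> \<sigma> \<in> K" if "\<sigma> \<subseteq> A" for \<sigma>
  proof -
    have "f ` \<sigma> \<subseteq> B" using that F(3) by blast
    then show ?thesis using F(4)[OF that] H(4)[of "f ` \<sigma>"] by (simp add: image_comp)
  qed
  show "(h \<circ> f) (\<phi> g x) = \<omega> g ((h \<circ> f) x)" if "g \<in> carrier G" "x \<in> A" for g x
    using F(5)[OF that] H(5)[of g "f x"] that F(3) by auto
qed

lemma local_iso_subset:
  assumes f: "local_iso G A K \<phi> B L \<psi> f" and "A' \<subseteq> A"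
  shows "local_iso G A' K \<phi> (f ` A') L \<psi> f"
proof (rule local_isoI)
  note F = local_isoD[OF f]
  show "bij_betw f A' (f ` A')" using F(2) assms(2) by (simp add: bij_betw_def inj_on_subset)
qed (use local_isoD(4,5)[OF f] assms(2) in \<open>auto simp: subset_iff\<close>)

lemma local_iso_edge:
  assumes f: "local_iso G A K \<phi> B L \<psi> f" and "x \<in> A" "y \<in> A"
  shows "(f x, f y) \<in> edge_rel L \<longleftrightarrow> (x, y) \<in> edge_rel K"
proof -
  have "f ` {x, y} \<in> L \<longleftrightarrow> {x, y} \<in> K"
    using assms(2,3) by (intro local_isoD(4)[OF f]) simp
  moreover have "f x = f y \<longleftrightarrow> x = y"
    using assms(2,3) local_isoD(2)[OF f] by (simp add: inj_on_eq_iff)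
  ultimately show ?thesis by (simp add: edge_rel_def)
qed

text \<open>Induction on the radius. The inclusion in \<open>B\<close> allows the next neighbour of
  an image point to be pulled back through \<open>f\<close>; without it an edge of \<open>L\<close>
  could leave the image.\<close>

lemma local_iso_nbhd:
  assumes f: "local_iso G A K \<phi> B L \<psi> f"
    and sub: "nbhd K R n \<subseteq> A" "nbhd L (f ` R) n \<subseteq> B"
  shows "f ` nbhd K R n = nbhd L (f ` R) n"
  using sub
proof (induction n)
  case (Suc n)
  then have IH: "f ` nbhd K R n = nbhd L (f ` R) n" by simp
  have "f ` (edge_rel K `` nbhd K R n) = edge_rel L `` nbhd L (f ` R) n"
  proof (intro equalityI subsetI)
    fix y assume "y \<in> f ` (edge_rel K `` nbhd K R n)"
    then obtain x z where "z \<in> nbhd K R n" "(z, x) \<in> edge_rel K" "y = f x" by auto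
    moreover from this have "z \<in> A" "x \<in> A" using Suc.prems by auto
    ultimately have "(f z, y) \<in> edge_rel L" "f z \<in> nbhd L (f ` R) n"
      using local_iso_edge[OF f, of z x] IH by auto
    then show "y \<in> edge_rel L `` nbhd L (f ` R) n" by (rule ImageI)
  next
    fix y assume y: "y \<in> edge_rel L `` nbhd L (f ` R) n"
    then have "y \<in> B" using Suc.prems by auto
    then obtain x where x: "x \<in> A" "y = f x"
      using local_isoD(3)[OF f] by blast
    obtain z where "z \<in> nbhd K R n" "(f z, y) \<in> edge_rel L"
      using y IH[symmetric] by auto
    then have "(z, x) \<in> edge_rel K"
      using local_iso_edge[OF f, of z x] Suc.prems x by auto
    then show "y \<in> f ` (edge_rel K `` nbhd K R n)"
      using x \<open>z \<in> nbhd K R n\<close> by auto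
  qed
  then show ?case by (simp add: image_Un IH)
qed simp


section \<open>Rooted complexes up to isomorphism of balls\<close>

text \<open>In contrast to \<open>rooted_G_complex\<close>, the orbit may miss components. So a
  finite complex rooted at any orbit qualifies, before components are discarded.\<close>

fun orbit_rooted :: "('g, 'b) monoid_scheme \<Rightarrow> ('g, 'v) rcomplex \<Rightarrow> bool" where
  "orbit_rooted G (K, \<phi>, os) \<longleftrightarrow>
     simplicial_G_complex G K \<phi> \<and> (\<exists>R\<in>orbits G (verts K) \<phi>. os = [R])"

text \<open>The two vertex types may differ, so that given complexes, induced complexes and
  representatives on \<open>nat\<close> can be chained.\<close>

fun ball_sim ::
  "('g, 'b) monoid_scheme \<Rightarrow> nat \<Rightarrow> ('g, 'v) rcomplex \<Rightarrow> ('g, 'w) rcomplex \<Rightarrow> bool" where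
  "ball_sim G n (K, \<phi>, os) (L, \<psi>, os') \<longleftrightarrow>
     (\<exists>f. local_iso G (nbhd K (\<Union>(set os)) n) K \<phi> (nbhd L (\<Union>(set os')) n) L \<psi> f \<and>
          map ((`) f) os = os')"

lemma orbit_rootedE:
  assumes "orbit_rooted G X"
  obtains K \<phi> R where "X = (K, \<phi>, [R])" "gcomplex G K \<phi>" "R \<in> orbits G (verts K) \<phi>" "R \<subseteq> verts K"
proof -
  obtain K \<phi> os where X: "X = (K, \<phi>, os)" by (cases X)
  then obtain R where R: "R \<in> orbits G (verts K) \<phi>" "os = [R]" and "gcomplex G K \<phi>"
    using assms by (auto simp: gcomplex_def)
  then show thesis
    using that[of K \<phi> R] X gcomplex.orbits_subset by blast
qed

lemma orbit_rooted_simp: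
  "orbit_rooted G (K, \<phi>, [R]) \<longleftrightarrow> gcomplex G K \<phi> \<and> R \<in> orbits G (verts K) \<phi>"
  by (simp add: gcomplex_def)

lemma ball_sim_simp:
  "ball_sim G n (K, \<phi>, [R]) (L, \<psi>, [S]) \<longleftrightarrow>
     (\<exists>f. local_iso G (nbhd K R n) K \<phi> (nbhd L S n) L \<psi> f \<and> f ` R = S)"
  by simp

declare orbit_rooted.simps [simp del] ball_sim.simps [simp del]

text \<open>Injectivity of \<open>f\<close> on \<open>A\<close> recovers a simplex from its image,
  so equality of the two sets of simplices becomes a condition on single vertex sets.\<close>

lemma image_simplices_iff:
  assumes "bij_betw f A B"
  shows "(`) f ` {\<sigma>\<in>K. \<sigma> \<subseteq> A} = {\<tau>\<in>L. \<tau> \<subseteq> B} \<longleftrightarrow> (\<forall>\<sigma>. \<sigma> \<subseteq> A \<longrightarrow> (f ` \<sigma> \<in> L \<longleftrightarrow> \<sigma> \<in> K))"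
    (is "?l \<longleftrightarrow> ?r")
proof
  have inj: "inj_on f A" and B: "f ` A = B" using assms by (auto simp: bij_betw_def)
  assume l: ?l
  show ?r
  proof (intro allI impI iffI)
    fix \<sigma> assume \<sigma>: "\<sigma> \<subseteq> A"
    show "f ` \<sigma> \<in> L" if "\<sigma> \<in> K"
      using l that \<sigma> by blast
    show "\<sigma> \<in> K" if "f ` \<sigma> \<in> L"
    proof -
      have "f ` \<sigma> \<in> {\<tau>\<in>L. \<tau> \<subseteq> B}" using that \<sigma> B by blast
      then obtain \<rho> where "\<rho> \<in> K" "\<rho> \<subseteq> A" "f ` \<sigma> = f ` \<rho>"
        unfolding l[symmetric] by blast
      then show ?thesis using \<sigma> inj by (simp add: inj_on_image_eq_iff)
    qed
  qed
next
  have B: "f ` A = B" using assms by (auto simp: bij_betw_def)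
  assume r: ?r
  show ?l
  proof (intro equalityI subsetI)
    fix \<tau> assume "\<tau> \<in> (`) f ` {\<sigma>\<in>K. \<sigma> \<subseteq> A}"
    then show "\<tau> \<in> {\<tau>\<in>L. \<tau> \<subseteq> B}" using r B by blast
  next
    fix \<tau> assume \<tau>: "\<tau> \<in> {\<tau>\<in>L. \<tau> \<subseteq> B}"
    then obtain \<sigma> where "\<sigma> \<subseteq> A" "\<tau> = f ` \<sigma>" using B by (auto simp: subset_image_iff)
    then show "\<tau> \<in> (`) f ` {\<sigma>\<in>K. \<sigma> \<subseteq> A}" using r \<tau> by blast
  qed
qed

text \<open>\<open>full_sub\<close> restricts the actions, but \<open>f\<close> maps
  \<open>A\<close> into \<open>B\<close>, so the restrictions are invisible in the equivariance
  condition.\<close>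

lemma rooted_iso_full_sub:
  assumes "simplicial_complex K" "simplicial_complex L" "A \<subseteq> verts K" "B \<subseteq> verts L"
  shows "rooted_iso G (full_sub A (K, \<phi>, [R])) (full_sub B (L, \<psi>, [S])) \<longleftrightarrow>
    (\<exists>f. local_iso G A K \<phi> B L \<psi> f \<and> f ` R = S)"
proof -
  have "bij_betw f A B \<and> (`) f ` {\<sigma>\<in>K. \<sigma> \<subseteq> A} = {\<tau>\<in>L. \<tau> \<subseteq> B} \<and>
      (\<forall>g\<in>carrier G. \<forall>x\<in>A. f (restrict (\<phi> g) A x) = restrict (\<psi> g) B (f x)) \<and> f ` R = S \<longleftrightarrow>
      local_iso G A K \<phi> B L \<psi> f \<and> f ` R = S" for f
  proof (cases "bij_betw f A B")
    case True
    then have "f x \<in> B" if "x \<in> A" for x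
      using that by (auto simp: bij_betw_def)
    then show ?thesis
      using image_simplices_iff[OF True, of K L] True by (simp add: local_iso_def)
  qed (simp add: local_iso_def)
  then show ?thesis
    using assms by (simp add: verts_full_sub)
qed

lemma rooted_iso_iff:
  "rooted_iso G (K, \<phi>, [R]) (L, \<psi>, [S]) \<longleftrightarrow>
    (\<exists>f. local_iso G (verts K) K \<phi> (verts L) L \<psi> f \<and> f ` R = S)"
proof -
  have all: "{\<sigma>\<in>K. \<sigma> \<subseteq> verts K} = K" for K :: "'x set set"
    by (blast intro: UnionI)
  have "bij_betw f (verts K) (verts L) \<and> (`) f ` K = L \<and> E \<longleftrightarrow>
      bij_betw f (verts K) (verts L) \<and> (\<forall>\<sigma>. \<sigma> \<subseteq> verts K \<longrightarrow> (f ` \<sigma> \<in> L \<longleftrightarrow> \<sigma> \<in> K)) \<and> E" for f E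
    using image_simplices_iff[of f "verts K" "verts L" K L] unfolding all by blast
  then show ?thesis
    by (simp add: local_iso_def)
qed

lemma root_ball_eq:
  assumes "0 \<le> r" "R \<subseteq> verts K"
  shows "root_ball r (K, \<phi>, [R]) = full_sub (nbhd K R (nat \<lfloor>r\<rfloor>)) (K, \<phi>, [R])"
proof -
  have "{x\<in>verts K. \<exists>v\<in>R. ereal_of_enat (path_dist K v x) \<le> ereal r} = nbhd K R (nat \<lfloor>r\<rfloor>)"
    using assms(1) nbhd_subset_verts[OF assms(2), of "nat \<lfloor>r\<rfloor>"]
    unfolding path_dist_le_iff nbhd_UN[of K R] by blast
  then show ?thesis by simp
qed

text \<open>The passage from the real radii of the metric to natural levels.\<close>

lemma rooted_iso_root_ball_iff:
  assumes "orbit_rooted G X" "orbit_rooted G Y" "0 \<le> r"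
  shows "rooted_iso G (root_ball r X) (root_ball r Y) \<longleftrightarrow> ball_sim G (nat \<lfloor>r\<rfloor>) X Y"
proof -
  obtain K \<phi> R where X: "X = (K, \<phi>, [R])" "gcomplex G K \<phi>" "R \<subseteq> verts K"
    using assms(1) by (rule orbit_rootedE)
  obtain L \<psi> S where Y: "Y = (L, \<psi>, [S])" "gcomplex G L \<psi>" "S \<subseteq> verts L"
    using assms(2) by (rule orbit_rootedE)
  show ?thesis
    unfolding X(1) Y(1) root_ball_eq[OF assms(3) X(3)] root_ball_eq[OF assms(3) Y(3)] ball_sim_simp
    by (rule rooted_iso_full_sub)
      (use X Y nbhd_subset_verts gcomplex.complex in \<open>blast+\<close>)
qed

lemma ball_sim_refl: "orbit_rooted G X \<Longrightarrow> ball_sim G n X X"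
  by (erule orbit_rootedE) (auto simp: ball_sim_simp local_iso_def intro!: exI[of _ id])

lemma ball_sim_sym:
  assumes "orbit_rooted G X" "orbit_rooted G Y" "ball_sim G n X Y"
  shows "ball_sim G n Y X"
proof -
  obtain K \<phi> R where X: "X = (K, \<phi>, [R])" "gcomplex G K \<phi>" "R \<in> orbits G (verts K) \<phi>" "R \<subseteq> verts K"
    using assms(1) by (rule orbit_rootedE)
  obtain L \<psi> S where Y: "Y = (L, \<psi>, [S])"
    using assms(2) by (rule orbit_rootedE)
  obtain f where f: "local_iso G (nbhd K R n) K \<phi> (nbhd L S n) L \<psi> f" "f ` R = S"
    using assms(3) unfolding X(1) Y ball_sim_simp by blast
  have "\<phi> g x \<in> nbhd K R n" if "g \<in> carrier G" "x \<in> nbhd K R n" for g x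
    using gcomplex.nbhd_inv[OF X(2) that(1) X(4) _ that(2)] gcomplex.orbits_inv[OF X(2,3) that(1)]
    by blast
  then have "local_iso G (nbhd L S n) L \<psi> (nbhd K R n) K \<phi> (inv_into (nbhd K R n) f)"
    by (rule local_iso_sym[OF f(1)])
  moreover have "inv_into (nbhd K R n) f ` S = R"
    unfolding f(2)[symmetric] using local_isoD(2)[OF f(1)] nbhd_superset
    by (rule inv_into_image_cancel)
  ultimately show ?thesis
    unfolding X(1) Y ball_sim_simp by blast
qed

lemma ball_sim_trans:
  assumes "orbit_rooted G X" "orbit_rooted G Y" "orbit_rooted G Z"
    and "ball_sim G n X Y" "ball_sim G n Y Z"
  shows "ball_sim G n X Z"
proof -
  obtain K \<phi> R where X: "X = (K, \<phi>, [R])"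
    using assms(1) by (rule orbit_rootedE)
  obtain L \<psi> S where Y: "Y = (L, \<psi>, [S])"
    using assms(2) by (rule orbit_rootedE)
  obtain M \<omega> T where Z: "Z = (M, \<omega>, [T])"
    using assms(3) by (rule orbit_rootedE)
  obtain f h where
    f: "local_iso G (nbhd K R n) K \<phi> (nbhd L S n) L \<psi> f" "f ` R = S" and
    h: "local_iso G (nbhd L S n) L \<psi> (nbhd M T n) M \<omega> h" "h ` S = T"
    using assms(4,5) unfolding X Y Z ball_sim_simp by blast
  have "(h \<circ> f) ` R = T" using f(2) h(2) by (simp only: image_comp[symmetric])
  then show ?thesis
    unfolding X Z ball_sim_simp using local_iso_trans[OF f(1) h(1)] by blast
qed

text \<open>A vertex within distance m \<le> n of the roots is reached by a path that stays in the
  n-ball. So a root-preserving isomorphism of n-balls carries the m-ball onto the m-ball.\<close>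

lemma ball_sim_mono:
  assumes "orbit_rooted G X" "orbit_rooted G Y" "ball_sim G n X Y" "m \<le> n"
  shows "ball_sim G m X Y"
proof -
  obtain K \<phi> R where X: "X = (K, \<phi>, [R])"
    using assms(1) by (rule orbit_rootedE)
  obtain L \<psi> S where Y: "Y = (L, \<psi>, [S])"
    using assms(2) by (rule orbit_rootedE)
  obtain f where f: "local_iso G (nbhd K R n) K \<phi> (nbhd L S n) L \<psi> f" "f ` R = S"
    using assms(3) unfolding X Y ball_sim_simp by blast
  have sub: "nbhd K R m \<subseteq> nbhd K R n" "nbhd L (f ` R) m \<subseteq> nbhd L S n"
    using assms(4) unfolding f(2) by (simp_all add: nbhd_mono)
  show ?thesis
    unfolding X Y ball_sim_simp
    using local_iso_subset[OF f(1) sub(1)] f(2) unfolding local_iso_nbhd[OF f(1) sub] by blast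
qed

lemma rooted_iso_imp_ball_sim:
  assumes "orbit_rooted G X" "orbit_rooted G Y" "rooted_iso G X Y"
  shows "ball_sim G n X Y"
proof -
  obtain K \<phi> R where X: "X = (K, \<phi>, [R])" "R \<subseteq> verts K"
    using assms(1) by (rule orbit_rootedE)
  obtain L \<psi> S where Y: "Y = (L, \<psi>, [S])" "S \<subseteq> verts L"
    using assms(2) by (rule orbit_rootedE)
  obtain f where f: "local_iso G (verts K) K \<phi> (verts L) L \<psi> f" "f ` R = S"
    using assms(3) unfolding X(1) Y(1) rooted_iso_iff by blast
  have sub: "nbhd K R n \<subseteq> verts K" "nbhd L (f ` R) n \<subseteq> verts L"
    using X(2) Y(2) unfolding f(2) by (simp_all add: nbhd_subset_verts)
  show ?thesis
    unfolding X(1) Y(1) ball_sim_simp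
    using local_iso_subset[OF f(1) sub(1)] f(2) unfolding local_iso_nbhd[OF f(1) sub] by blast
qed

section \<open>Isomorphism of rooted complexes as an equivalence; roots meeting all
  components\<close>

lemma rooted_iso_refl: "orbit_rooted G X \<Longrightarrow> rooted_iso G X X"
  by (erule orbit_rootedE) (auto simp: rooted_iso_iff local_iso_def simp del: rooted_iso.simps intro!: exI[of _ id])

lemma rooted_iso_sym:
  assumes "orbit_rooted G X" "orbit_rooted G Y" "rooted_iso G X Y"
  shows "rooted_iso G Y X"
proof -
  obtain K \<phi> R where X: "X = (K, \<phi>, [R])" "gcomplex G K \<phi>" "R \<subseteq> verts K"
    using assms(1) by (rule orbit_rootedE)
  obtain L \<psi> S where Y: "Y = (L, \<psi>, [S])"
    using assms(2) by (rule orbit_rootedE)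
  obtain f where f: "local_iso G (verts K) K \<phi> (verts L) L \<psi> f" "f ` R = S"
    using assms(3) unfolding X(1) Y rooted_iso_iff by blast
  have "local_iso G (verts L) L \<psi> (verts K) K \<phi> (inv_into (verts K) f)"
    using local_iso_sym[OF f(1)] gcomplex.act_closed[OF X(2)] by blast
  moreover have "inv_into (verts K) f ` S = R"
    unfolding f(2)[symmetric] using local_isoD(2)[OF f(1)] X(3)
    by (rule inv_into_image_cancel)
  ultimately show ?thesis
    unfolding X(1) Y rooted_iso_iff by blast
qed

lemma rooted_iso_trans:
  assumes "orbit_rooted G X" "orbit_rooted G Y" "orbit_rooted G Z"
    and "rooted_iso G X Y" "rooted_iso G Y Z"
  shows "rooted_iso G X Z"
proof -
  obtain K \<phi> R where X: "X = (K, \<phi>, [R])"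
    using assms(1) by (rule orbit_rootedE)
  obtain L \<psi> S where Y: "Y = (L, \<psi>, [S])"
    using assms(2) by (rule orbit_rootedE)
  obtain M \<omega> T where Z: "Z = (M, \<omega>, [T])"
    using assms(3) by (rule orbit_rootedE)
  obtain f h where
    f: "local_iso G (verts K) K \<phi> (verts L) L \<psi> f" "f ` R = S" and
    h: "local_iso G (verts L) L \<psi> (verts M) M \<omega> h" "h ` S = T"
    using assms(4,5) unfolding X Y Z rooted_iso_iff by blast
  have "(h \<circ> f) ` R = T" using f(2) h(2) by (simp only: image_comp[symmetric])
  then show ?thesis
    unfolding X Z rooted_iso_iff using local_iso_trans[OF f(1) h(1)] by blast
qed

text \<open>Components are reachability classes and reachability is symmetric, so meeting all of
  them means that the balls about \<open>R\<close> exhaust the vertices.\<close>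

lemma meets_components_iff:
  assumes "R \<subseteq> verts K"
  shows "(\<forall>C\<in>complex_components K. R \<inter> C \<noteq> {}) \<longleftrightarrow> verts K \<subseteq> (\<Union>n. nbhd K R n)"
proof -
  have reach: "x \<in> (\<Union>n. nbhd K R n) \<longleftrightarrow> (\<exists>v\<in>R. (x, v) \<in> (edge_rel K)\<^sup>*)" for x
    unfolding mem_UN_nbhd_iff by (blast intro: edge_rtrancl_sym)
  have "(\<forall>C\<in>complex_components K. R \<inter> C \<noteq> {}) \<longleftrightarrow>
      (\<forall>x\<in>verts K. R \<inter> ((edge_rel K)\<^sup>* `` {x}) \<noteq> {})"
    unfolding complex_components_def quotient_def UNION_singleton_eq_range by simp
  also have "\<dots> \<longleftrightarrow> (\<forall>x\<in>verts K. \<exists>v\<in>R. (x, v) \<in> (edge_rel K)\<^sup>*)"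
    by (intro ball_cong refl) blast
  also have "\<dots> \<longleftrightarrow> verts K \<subseteq> (\<Union>n. nbhd K R n)"
    unfolding subset_iff reach by blast
  finally show ?thesis .
qed

lemma rooted_G_complex_iff:
  "rooted_G_complex G (K, \<phi>, [R]) \<longleftrightarrow>
     gcomplex G K \<phi> \<and> R \<in> orbits G (verts K) \<phi> \<and> verts K \<subseteq> (\<Union>n. nbhd K R n)"
proof (cases "gcomplex G K \<phi> \<and> R \<in> orbits G (verts K) \<phi>")
  case True
  then have "R \<subseteq> verts K" using gcomplex.orbits_subset by blast
  then show ?thesis using True meets_components_iff[of R K] by (simp add: gcomplex_def)
qed (auto simp: gcomplex_def)

lemma rooted_imp_orbit_rooted: "rooted_G_complex G (K, \<phi>, [R]) \<Longrightarrow> orbit_rooted G (K, \<phi>, [R])"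
  by (simp add: rooted_G_complex_iff orbit_rooted_simp del: rooted_G_complex.simps)


section \<open>Images of complexes and the vertex degree\<close>

text \<open>Transport of structure along an injection. It is applied with a numbering of the
  vertices, to obtain a copy on \<open>nat\<close>, and with the identity, to cut a complex down to
  an invariant set of vertices.\<close>

lemma image_gcomplex:
  assumes "gcomplex G K \<phi>" and A: "A \<subseteq> verts K" "A \<noteq> {}"
    and inv: "\<And>g x. g \<in> carrier G \<Longrightarrow> x \<in> A \<Longrightarrow> \<phi> g x \<in> A"
    and inj: "inj_on f A" and L: "L = (`) f ` {\<sigma>\<in>K. \<sigma> \<subseteq> A}"
    and ext: "\<And>g. g \<in> carrier G \<Longrightarrow> \<psi> g \<in> extensional (f ` A)"
    and eqv: "\<And>g x. g \<in> carrier G \<Longrightarrow> x \<in> A \<Longrightarrow> \<psi> g (f x) = f (\<phi> g x)"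
  shows "verts L = f ` A" "gcomplex G L \<psi>" "local_iso G A K \<phi> (verts L) L \<psi> f"
proof -
  interpret gcomplex G K \<phi> by fact
  have V: "verts L = f ` A"
    unfolding L image_Union[symmetric] verts_full_sub[OF complex A(1)] ..
  show "verts L = f ` A" by (rule V)
  have bij: "bij_betw f A (f ` A)" using inj by (simp add: bij_betw_def)
  have "(`) f ` {\<sigma>\<in>K. \<sigma> \<subseteq> A} = {\<tau>\<in>L. \<tau> \<subseteq> f ` A}" unfolding L by blast
  then have simp_iff: "f ` \<sigma> \<in> L \<longleftrightarrow> \<sigma> \<in> K" if "\<sigma> \<subseteq> A" for \<sigma>
    using that by (simp only: image_simplices_iff[OF bij])
  show "local_iso G A K \<phi> (verts L) L \<psi> f"
    unfolding V using bij simp_iff eqv by (simp add: local_iso_def)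
  have "simplicial_complex L"
    unfolding simplicial_complex_def
  proof (intro conjI ballI allI impI)
    obtain x where "x \<in> A" using A(2) by blast
    then have "f ` {x} \<in> L" using A(1) singleton_simplex[OF complex] by (subst simp_iff) auto
    then show "L \<noteq> {}" by blast
  next
    fix \<tau> assume "\<tau> \<in> L"
    then obtain \<sigma> where \<sigma>: "\<sigma> \<in> K" "\<sigma> \<subseteq> A" "\<tau> = f ` \<sigma>" using L by blast
    then show "finite \<tau>" "\<tau> \<noteq> {}" using simplicial_complexD(1,2)[OF complex] by auto
    fix \<rho> assume "\<rho> \<noteq> {} \<and> \<rho> \<subseteq> \<tau>"
    then obtain \<sigma>' where "\<sigma>' \<subseteq> \<sigma>" "\<rho> = f ` \<sigma>'" "\<sigma>' \<noteq> {}"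
      using \<sigma>(3) by (auto simp: subset_image_iff)
    then show "\<rho> \<in> L"
      using simplicial_complexD(3)[OF complex \<sigma>(1)] \<sigma>(2) simp_iff[of \<sigma>'] by auto
  qed
  moreover have "group_action G (verts L) \<psi>"
    unfolding V
  proof (rule group_actionI)
    show "group G" by (rule is_group)
  next
    fix g h y assume gh: "g \<in> carrier G" "h \<in> carrier G" and "y \<in> f ` A"
    then obtain x where "x \<in> A" "y = f x" by blast
    then show "\<psi> (g \<otimes>\<^bsub>G\<^esub> h) y = \<psi> g (\<psi> h y)"
      using gh A(1) eqv inv act_mult by (simp add: subset_iff)
  next
    fix y assume "y \<in> f ` A"
    then obtain x where "x \<in> A" "y = f x" by blast
    then show "\<psi> \<one>\<^bsub>G\<^esub> y = y"
      using A(1) eqv act_one by (simp add: subset_iff)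
  qed (use ext eqv inv in auto)
  moreover have "\<psi> g ` \<tau> \<in> L" if g: "g \<in> carrier G" and "\<tau> \<in> L" for g \<tau>
  proof -
    obtain \<sigma> where \<sigma>: "\<sigma> \<in> K" "\<sigma> \<subseteq> A" "\<tau> = f ` \<sigma>" using L \<open>\<tau> \<in> L\<close> by blast
    then have "\<phi> g ` \<sigma> \<subseteq> A" using inv[OF g] by blast
    then have "f ` \<phi> g ` \<sigma> \<in> L" using simp_iff simplex_image[OF g \<sigma>(1)] by simp
    moreover have "f ` \<phi> g ` \<sigma> = \<psi> g ` \<tau>"
      unfolding \<sigma>(3) image_image using eqv[OF g] \<sigma>(2) by (intro image_cong) auto
    ultimately show ?thesis by simp
  qed
  ultimately show "gcomplex G L \<psi>"
    by unfold_locales (simp add: simplicial_G_complex_def)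
qed

lemma local_iso_orbits:
  assumes "gcomplex G K \<phi>" "gcomplex G L \<psi>" "local_iso G A K \<phi> (verts L) L \<psi> f"
    and R: "R \<in> orbits G (verts K) \<phi>" "R \<subseteq> A"
  shows "f ` R \<in> orbits G (verts L) \<psi>"
proof -
  obtain x where x: "x \<in> verts K" "R = orbit G \<phi> x"
    using gcomplex.orbitsD[OF assms(1) R(1)] by blast
  then have "x \<in> A" using gcomplex.orbit_self[OF assms(1) x(1)] R(2) by blast
  have "f ` R = orbit G \<psi> (f x)"
    unfolding x(2) orbit_def Setcompr_eq_image image_image
    using local_isoD(5)[OF assms(3) _ \<open>x \<in> A\<close>] by (rule image_cong[OF refl])
  moreover have "f x \<in> verts L" using local_isoD(3)[OF assms(3)] \<open>x \<in> A\<close> by blast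
  ultimately show ?thesis unfolding orbits_def by blast
qed

text \<open>Neighbours replace edges through the bijection
  \<open>y \<mapsto> {x, y}\<close>.\<close>

lemma degree_le_iff:
  assumes "simplicial_complex K"
  shows "ereal_of_enat (vertex_degree K) \<le> ereal D \<longleftrightarrow>
    (\<forall>x\<in>verts K. finite (edge_rel K `` {x}) \<and> real (card (edge_rel K `` {x})) \<le> D)"
proof -
  have card_eq: "card (vertex_edges K x) = card (edge_rel K `` {x})"
    and fin_eq: "finite (vertex_edges K x) \<longleftrightarrow> finite (edge_rel K `` {x})" for x
  proof -
    have "vertex_edges K x = (\<lambda>y. {x, y}) ` (edge_rel K `` {x})"
    proof (intro equalityI subsetI)
      fix \<sigma> assume "\<sigma> \<in> vertex_edges K x"
      then have \<sigma>: "\<sigma> \<in> K" "card \<sigma> = 2" "x \<in> \<sigma>" by (auto simp: vertex_edges_def)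
      then obtain y where "\<sigma> = {x, y}" "x \<noteq> y" by (auto simp: card_2_iff doubleton_eq_iff)
      then show "\<sigma> \<in> (\<lambda>y. {x, y}) ` (edge_rel K `` {x})" using \<sigma> by (auto simp: edge_rel_def)
    qed (auto simp: vertex_edges_def edge_rel_def)
    moreover have "inj_on (\<lambda>y. {x, y}) (edge_rel K `` {x})"
      by (auto simp: inj_on_def doubleton_eq_iff)
    ultimately show "card (vertex_edges K x) = card (edge_rel K `` {x})"
      "finite (vertex_edges K x) \<longleftrightarrow> finite (edge_rel K `` {x})"
      by (simp_all add: card_image finite_image_iff)
  qed
  have deg: "ereal_of_enat (degree_at K x) \<le> ereal D \<longleftrightarrow>
      finite (edge_rel K `` {x}) \<and> real (card (edge_rel K `` {x})) \<le> D" for x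
    by (simp add: degree_at_def card_eq fin_eq)
  obtain \<sigma> x where "\<sigma> \<in> K" "x \<in> \<sigma>"
    using assms unfolding simplicial_complex_def by blast
  then have x: "x \<in> verts K" by (rule UnionI)
  show ?thesis
  proof
    assume D: "ereal_of_enat (vertex_degree K) \<le> ereal D"
    show "\<forall>x\<in>verts K. finite (edge_rel K `` {x}) \<and> real (card (edge_rel K `` {x})) \<le> D"
    proof
      fix y assume "y \<in> verts K"
      then have "degree_at K y \<le> vertex_degree K"
        unfolding vertex_degree_def by (rule SUP_upper)
      then have "ereal_of_enat (degree_at K y) \<le> ereal D"
        using D by (metis ereal_of_enat_le_iff order_trans)
      then show "finite (edge_rel K `` {y}) \<and> real (card (edge_rel K `` {y})) \<le> D"
        using deg by blast
    qed
  next
    assume r: "\<forall>x\<in>verts K. finite (edge_rel K `` {x}) \<and> real (card (edge_rel K `` {x})) \<le> D"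
    then have "0 \<le> D" using x by fastforce
    \<comment> \<open>The supremum is taken in \<open>enat\<close>, so its upper bound must lie
      there too: integer degrees at most \<open>D\<close> are at most the floor of \<open>D\<close>,
      and since \<open>0 \<le> D\<close> this floor, taken in \<open>nat\<close>, is again at most
      \<open>D\<close>.\<close>
    have "degree_at K y \<le> enat (nat \<lfloor>D\<rfloor>)" if "y \<in> verts K" for y
    proof -
      have "finite (edge_rel K `` {y})" "real (card (edge_rel K `` {y})) \<le> D" using r that by auto
      then show ?thesis by (simp add: degree_at_def card_eq fin_eq le_nat_floor)
    qed
    then have "vertex_degree K \<le> enat (nat \<lfloor>D\<rfloor>)"
      unfolding vertex_degree_def by (rule SUP_least)
    then have "ereal_of_enat (vertex_degree K) \<le> ereal_of_enat (enat (nat \<lfloor>D\<rfloor>))"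
      by (simp only: ereal_of_enat_le_iff)
    also have "\<dots> \<le> ereal D" using \<open>0 \<le> D\<close> by simp
    finally show "ereal_of_enat (vertex_degree K) \<le> ereal D" .
  qed
qed

text \<open>The map \<open>f\<close> only has to cover the neighbours and may depend on
  \<open>y\<close>. This suits isomorphic copies, where one map serves all vertices, and induced
  complexes, where each sheet has its own.\<close>

lemma degree_transfer:
  assumes "simplicial_complex K" "simplicial_complex L" "ereal_of_enat (vertex_degree K) \<le> ereal D"
    and dom: "\<And>y. y \<in> verts L \<Longrightarrow> \<exists>x\<in>verts K. \<exists>f. edge_rel L `` {y} \<subseteq> f ` (edge_rel K `` {x})"
  shows "ereal_of_enat (vertex_degree L) \<le> ereal D"
  unfolding degree_le_iff[OF assms(2)]
proof
  fix y assume "y \<in> verts L"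
  then obtain x f where xf: "x \<in> verts K" "edge_rel L `` {y} \<subseteq> f ` (edge_rel K `` {x})"
    using dom by blast
  then have K: "finite (edge_rel K `` {x})" "real (card (edge_rel K `` {x})) \<le> D"
    using assms(3) unfolding degree_le_iff[OF assms(1)] by auto
  have "finite (edge_rel L `` {y})" using xf(2) K(1) by (rule finite_surj[rotated])
  moreover have "card (edge_rel L `` {y}) \<le> card (edge_rel K `` {x})"
    using K(1) xf(2) by (rule surj_card_le)
  ultimately show "finite (edge_rel L `` {y}) \<and> real (card (edge_rel L `` {y})) \<le> D"
    using K(2) by linarith
qed

lemma local_iso_degree:
  assumes "simplicial_complex K" "simplicial_complex L" "ereal_of_enat (vertex_degree K) \<le> ereal D"
    and f: "local_iso G A K \<phi> (verts L) L \<psi> f" and "A \<subseteq> verts K"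
  shows "ereal_of_enat (vertex_degree L) \<le> ereal D"
proof (rule degree_transfer[OF assms(1,2,3)])
  fix y assume "y \<in> verts L"
  then obtain x where x: "x \<in> A" "y = f x" using local_isoD(3)[OF f] by blast
  have "edge_rel L `` {y} \<subseteq> f ` (edge_rel K `` {x})"
  proof
    fix z assume "z \<in> edge_rel L `` {y}"
    then have z: "(y, z) \<in> edge_rel L" by simp
    then have "z \<in> f ` A" using edge_relD[OF z] local_isoD(3)[OF f] by simp
    then obtain w where w: "w \<in> A" "z = f w" by blast
    then have "(x, w) \<in> edge_rel K"
      using local_iso_edge[OF f, of x w] x z by simp
    then show "z \<in> f ` (edge_rel K `` {x})" using w(2) by blast
  qed
  then show "\<exists>x\<in>verts K. \<exists>f. edge_rel L `` {y} \<subseteq> f ` (edge_rel K `` {x})"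
    using x(1) assms(5) by blast
qed


section \<open>Points of the space of isomorphism classes\<close>

lemma iso_class_memD:
  assumes "orbit_rooted G X" "Y \<in> iso_class G X"
  shows "orbit_rooted G Y" "rooted_G_complex G Y" "rooted_iso G X Y"
proof -
  obtain K \<phi> R where X: "X = (K, \<phi>, [R])" using assms(1) by (rule orbit_rootedE)
  obtain L \<psi> os where Y: "Y = (L, \<psi>, os)" by (cases Y)
  show *: "rooted_G_complex G Y" "rooted_iso G X Y"
    using assms(2) by (auto simp: iso_class_def simp del: rooted_iso.simps rooted_G_complex.simps)
  have "\<exists>S. os = [S]" using *(2) unfolding X Y by auto
  then show "orbit_rooted G Y" using *(1) rooted_imp_orbit_rooted unfolding Y by blast
qed

lemma iso_class_eqI:
  assumes "orbit_rooted G X" "orbit_rooted G Y" "rooted_iso G X Y"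
  shows "iso_class G X = iso_class G Y"
proof (intro equalityI subsetI)
  fix Z assume Z: "Z \<in> iso_class G X"
  then have "rooted_iso G Y Z"
    using iso_class_memD[OF assms(1) Z] rooted_iso_sym[OF assms] rooted_iso_trans assms by blast
  then show "Z \<in> iso_class G Y"
    using iso_class_memD(2)[OF assms(1) Z] by (simp add: iso_class_def)
next
  fix Z assume Z: "Z \<in> iso_class G Y"
  then have "rooted_iso G X Z"
    using iso_class_memD[OF assms(2) Z] rooted_iso_trans assms by blast
  then show "Z \<in> iso_class G X"
    using iso_class_memD(2)[OF assms(2) Z] by (simp add: iso_class_def)
qed

lemma SC_E:
  assumes "p \<in> SC G D 1"
  obtains K :: "nat set set" and \<phi> R where "p = iso_class G (K, \<phi>, [R])" "rooted_G_complex G (K, \<phi>, [R])"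
    "ereal_of_enat (vertex_degree K) \<le> ereal D"
proof -
  obtain K :: "nat set set" and \<phi> os where p: "p = iso_class G (K, \<phi>, os)" "rooted_G_complex G (K, \<phi>, os)"
    "ereal_of_enat (vertex_degree K) \<le> ereal D" "length os = 1"
    using assms unfolding SC_def by blast
  then obtain R where "os = [R]" by (auto simp: length_Suc_conv)
  then show thesis using that p by blast
qed

text \<open>Membership in \<open>SC\<close> bounds the degree of one representative; an isomorphism
  carries the bound to every other member of the class.\<close>

lemma SC_member:
  assumes "p \<in> SC G D 1" "X \<in> p"
  shows "orbit_rooted G X" "rooted_G_complex G X" "p = iso_class G X"
    "ereal_of_enat (vertex_degree (fst X)) \<le> ereal D"
proof -
  obtain K :: "nat set set" and \<phi> R where p: "p = iso_class G (K, \<phi>, [R])" "rooted_G_complex G (K, \<phi>, [R])"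
    "ereal_of_enat (vertex_degree K) \<le> ereal D"
    using assms(1) by (rule SC_E)
  note o = rooted_imp_orbit_rooted[OF p(2)]
  note X = iso_class_memD[OF o assms(2)[unfolded p(1)]]
  show "orbit_rooted G X" "rooted_G_complex G X" by fact+
  show "p = iso_class G X" unfolding p(1) by (rule iso_class_eqI[OF o X(1,3)])
  obtain L \<psi> S where L: "X = (L, \<psi>, [S])" "gcomplex G L \<psi>" using X(1) by (rule orbit_rootedE)
  obtain f where f: "local_iso G (verts K) K \<phi> (verts L) L \<psi> f"
    using X(3) unfolding L(1) rooted_iso_iff by blast
  have "gcomplex G K \<phi>" using o by (simp add: orbit_rooted_simp)
  then show "ereal_of_enat (vertex_degree (fst X)) \<le> ereal D"
    using local_iso_degree[OF _ _ p(3) f] L gcomplex.complex by fastforce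
qed

lemma class_rep_mem:
  assumes "p \<in> SC G D 1"
  shows "class_rep p \<in> p"
proof -
  obtain K :: "nat set set" and \<phi> R where p: "p = iso_class G (K, \<phi>, [R])" "rooted_G_complex G (K, \<phi>, [R])"
    using assms by (rule SC_E)
  then have "(K, \<phi>, [R]) \<in> p"
    using rooted_iso_refl[OF rooted_imp_orbit_rooted[OF p(2)]] by (simp add: iso_class_def)
  then show ?thesis unfolding class_rep_def by (rule someI)
qed

lemma class_rep_SC:
  assumes "p \<in> SC G D 1"
  shows "orbit_rooted G (class_rep p)" "rooted_G_complex G (class_rep p)"
    "p = iso_class G (class_rep p)" "ereal_of_enat (vertex_degree (fst (class_rep p))) \<le> ereal D"
  using SC_member[OF assms class_rep_mem[OF assms]] by blast+

text \<open>\<open>SC\<close> is defined by complexes on \<open>nat\<close>, so the countably many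
  vertices are numbered, and complex, action and root orbit are moved along the numbering.\<close>

lemma iso_class_in_SC:
  fixes K :: "'v set set"
  assumes K: "rooted_G_complex G (K, \<phi>, [R])" "countable (verts K)"
    "ereal_of_enat (vertex_degree K) \<le> ereal D"
  shows "iso_class G (K, \<phi>, [R]) \<in> SC G D 1"
proof -
  have G: "gcomplex G K \<phi>" and R: "R \<in> orbits G (verts K) \<phi>" and conn: "verts K \<subseteq> (\<Union>n. nbhd K R n)"
    using iffD1[OF rooted_G_complex_iff K(1)] by simp_all
  interpret gcomplex G K \<phi> by (rule G)
  define f where "f = to_nat_on (verts K)"
  define L where "L = (`) f ` {\<sigma>\<in>K. \<sigma> \<subseteq> verts K}"
  define \<psi> where "\<psi> = (\<lambda>g. \<lambda>y\<in>f ` verts K. f (\<phi> g (inv_into (verts K) f y)))"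
  have inj: "inj_on f (verts K)" unfolding f_def using K(2) by (rule inj_on_to_nat_on)
  have ne: "verts K \<noteq> {}" using orbitsD[OF R] by blast
  have ext: "\<psi> g \<in> extensional (f ` verts K)" for g
    by (simp add: \<psi>_def)
  have eqv: "\<psi> g (f x) = f (\<phi> g x)" if "g \<in> carrier G" "x \<in> verts K" for g x
    using that inj by (simp add: \<psi>_def inv_into_f_f)
  have I: "verts L = f ` verts K" "gcomplex G L \<psi>" "local_iso G (verts K) K \<phi> (verts L) L \<psi> f"
    by (rule image_gcomplex[where f = f and \<psi> = \<psi>, OF G subset_refl ne _ inj L_def ext];
      (erule (1) act_closed eqv)?)+
  have "f ` R \<in> orbits G (verts L) \<psi>"
    using local_iso_orbits[OF G I(2,3) R orbits_subset[OF R]] .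
  moreover have "verts L \<subseteq> (\<Union>n. nbhd L (f ` R) n)"
  proof -
    have "f ` R \<subseteq> verts L" using I(1) orbits_subset[OF R] by blast
    then have "f ` nbhd K R n = nbhd L (f ` R) n" for n
      by (intro local_iso_nbhd[OF I(3)] nbhd_subset_verts orbits_subset[OF R])
    then have "(\<Union>n. nbhd L (f ` R) n) = f ` (\<Union>n. nbhd K R n)" by (simp add: image_UN)
    then show ?thesis using image_mono[OF conn, of f] I(1) by simp
  qed
  ultimately have L: "rooted_G_complex G (L, \<psi>, [f ` R])"
    using I(2) by (simp add: rooted_G_complex_iff del: rooted_G_complex.simps)
  have iso: "rooted_iso G (K, \<phi>, [R]) (L, \<psi>, [f ` R])"
    unfolding rooted_iso_iff using I(3) by blast
  have "iso_class G (K, \<phi>, [R]) = iso_class G (L, \<psi>, [f ` R])"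
    using rooted_imp_orbit_rooted[OF K(1)] rooted_imp_orbit_rooted[OF L] iso by (rule iso_class_eqI)
  moreover have "ereal_of_enat (vertex_degree L) \<le> ereal D"
    using local_iso_degree[OF complex gcomplex.complex[OF I(2)] K(3) I(3)] by simp
  ultimately show ?thesis
    unfolding SC_def mem_Collect_eq using L
    by (intro exI[of _ L] exI[of _ \<psi>] exI[of _ "[f ` R]"] conjI) simp_all
qed

section \<open>Cells of the space and the topology they generate\<close>

text \<open>The choice made by \<open>class_rep\<close> is immaterial: \<open>class_sim_iff\<close>
  gives the same relation for arbitrary members of the classes.\<close>

definition class_sim ::
  "('g, 'b) monoid_scheme \<Rightarrow> nat \<Rightarrow> ('g, nat) rcomplex set \<Rightarrow> ('g, nat) rcomplex set \<Rightarrow> bool" where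
  "class_sim G n p q \<longleftrightarrow> ball_sim G n (class_rep p) (class_rep q)"

lemma class_sim_refl: "p \<in> SC G D 1 \<Longrightarrow> class_sim G n p p"
  unfolding class_sim_def by (rule ball_sim_refl, rule class_rep_SC(1))

lemma class_sim_sym: "p \<in> SC G D 1 \<Longrightarrow> q \<in> SC G D 1 \<Longrightarrow> class_sim G n p q \<Longrightarrow> class_sim G n q p"
  unfolding class_sim_def by (blast intro: ball_sim_sym class_rep_SC(1))

lemma class_sim_trans:
  "p \<in> SC G D 1 \<Longrightarrow> q \<in> SC G D 1 \<Longrightarrow> r \<in> SC G D 1 \<Longrightarrow>
    class_sim G n p q \<Longrightarrow> class_sim G n q r \<Longrightarrow> class_sim G n p r"
  unfolding class_sim_def by (blast intro: ball_sim_trans class_rep_SC(1))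

lemma class_sim_mono:
  "p \<in> SC G D 1 \<Longrightarrow> q \<in> SC G D 1 \<Longrightarrow> class_sim G n p q \<Longrightarrow> m \<le> n \<Longrightarrow> class_sim G m p q"
  unfolding class_sim_def by (blast intro: ball_sim_mono class_rep_SC(1))

lemma class_sim_iff:
  assumes "p \<in> SC G D 1" "q \<in> SC G D 1" "X \<in> p" "Y \<in> q"
  shows "class_sim G n p q \<longleftrightarrow> ball_sim G n X Y"
proof -
  have "ball_sim G n X (class_rep p)" if "p \<in> SC G D 1" "X \<in> p" for p X
  proof -
    have X: "orbit_rooted G X" "p = iso_class G X" using SC_member[OF that] by auto
    then show ?thesis
      using iso_class_memD[OF X(1)] class_rep_mem[OF that(1)] rooted_iso_imp_ball_sim by blast
  qed
  note rep = this[OF assms(1,3)] this[OF assms(2,4)]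
  note o = SC_member(1)[OF assms(1,3)] SC_member(1)[OF assms(2,4)]
    class_rep_SC(1)[OF assms(1)] class_rep_SC(1)[OF assms(2)]
  show ?thesis
    unfolding class_sim_def
  proof
    assume "ball_sim G n (class_rep p) (class_rep q)"
    then have "ball_sim G n X (class_rep q)"
      by (rule ball_sim_trans[OF o(1) o(3) o(4) rep(1)])
    then show "ball_sim G n X Y"
      using ball_sim_sym[OF o(2) o(4) rep(2)] by (rule ball_sim_trans[OF o(1) o(4) o(2)])
  next
    assume "ball_sim G n X Y"
    then have "ball_sim G n (class_rep p) Y"
      by (rule ball_sim_trans[OF o(3) o(1) o(2) ball_sim_sym[OF o(1) o(3) rep(1)]])
    then show "ball_sim G n (class_rep p) (class_rep q)"
      using rep(2) by (rule ball_sim_trans[OF o(3) o(2) o(4)])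
  qed
qed

lemma ball_sim_class_rep:
  assumes "orbit_rooted G X" "iso_class G X \<in> SC G D 1"
  shows "ball_sim G n X (class_rep (iso_class G X))"
  using rooted_iso_imp_ball_sim[OF assms(1)] iso_class_memD[OF assms(1)] class_rep_mem[OF assms(2)]
  by blast

text \<open>\<open>0 < n\<close> enters because the infimum in \<open>SC_dist\<close> runs over
  positive radii.\<close>

lemma SC_dist_le:
  assumes "p \<in> SC G D 1" "q \<in> SC G D 1" "class_sim G n p q" "0 < n"
  shows "SC_dist G p q \<le> ennreal (2 powr - real n)"
proof -
  have "rooted_iso G (root_ball (real n) (class_rep p)) (root_ball (real n) (class_rep q))"
    using assms(3) rooted_iso_root_ball_iff[OF class_rep_SC(1)[OF assms(1)] class_rep_SC(1)[OF assms(2)], where r = "real n"]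
    by (simp add: class_sim_def)
  then show ?thesis
    unfolding SC_dist_def using assms(4) class_rep_mem[OF assms(1)] class_rep_mem[OF assms(2)]
    by (intro INF_lower) auto
qed

text \<open>Some radius r > n occurs in the infimum. An isomorphism of r-balls is one of balls of
  radius floor r \<ge> n, and it restricts to the n-balls.\<close>

lemma SC_dist_less_imp:
  assumes "p \<in> SC G D 1" "q \<in> SC G D 1" "SC_dist G p q < ennreal (2 powr - real n)"
  shows "class_sim G n p q"
proof -
  obtain r X Y where r: "0 < r" "ennreal (2 powr - r) < ennreal (2 powr - real n)"
    and XY: "X \<in> p" "Y \<in> q" "rooted_iso G (root_ball r X) (root_ball r Y)"
    using assms(3) unfolding SC_dist_def INF_less_iff by blast
  have "2 powr - r < 2 powr - real n" using r(2) by (simp add: ennreal_less_iff)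
  then have "real n < r" by simp
  then have n: "n \<le> nat \<lfloor>r\<rfloor>" by (simp add: le_nat_floor)
  note X = SC_member(1)[OF assms(1) XY(1)] and Y = SC_member(1)[OF assms(2) XY(2)]
  have "ball_sim G (nat \<lfloor>r\<rfloor>) X Y"
    using XY(3) rooted_iso_root_ball_iff[OF X Y, where r = r] r(1) by simp
  then have "ball_sim G n X Y" using ball_sim_mono[OF X Y _ n] by blast
  then show ?thesis using class_sim_iff[OF assms(1,2) XY(1,2)] by simp
qed

text \<open>For 0 < n the n-cell of a point lies between the open and the closed metric ball of
  radius 2^-n, so cells and metric balls generate the same topology.\<close>

lemma SC_open_iff:
  "SC_open G D 1 U \<longleftrightarrow> U \<subseteq> SC G D 1 \<and> (\<forall>p\<in>U. \<exists>n. \<forall>q\<in>SC G D 1. class_sim G n p q \<longrightarrow> q \<in> U)"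
    (is "_ \<longleftrightarrow> _ \<and> ?r")
proof -
  have "(\<exists>e>0. \<forall>q\<in>SC G D 1. SC_dist G p q < e \<longrightarrow> q \<in> U) \<longleftrightarrow>
      (\<exists>n. \<forall>q\<in>SC G D 1. class_sim G n p q \<longrightarrow> q \<in> U)" if p: "p \<in> SC G D 1" for p
  proof
    assume "\<exists>e>0. \<forall>q\<in>SC G D 1. SC_dist G p q < e \<longrightarrow> q \<in> U"
    then obtain e where e: "0 < e" "\<And>q. q \<in> SC G D 1 \<Longrightarrow> SC_dist G p q < e \<Longrightarrow> q \<in> U" by blast
    have "(\<lambda>n. 2 powr - real n) \<longlonglongrightarrow> (0::real)"
      using LIMSEQ_realpow_zero[of "1 / 2 :: real"]
      by (simp add: powr_minus powr_realpow power_one_over inverse_eq_divide)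
    then have "(\<lambda>n. ennreal (2 powr - real n)) \<longlonglongrightarrow> ennreal 0"
      by (rule tendsto_ennrealI)
    then have "\<forall>\<^sub>F n in sequentially. ennreal (2 powr - real n) < e"
      using e(1) by (intro order_tendstoD(2)) auto
    then have "\<forall>\<^sub>F n in sequentially. ennreal (2 powr - real n) < e \<and> 0 < n"
      using eventually_gt_at_top by (rule eventually_conj)
    then obtain n where n: "ennreal (2 powr - real n) < e" "0 < n"
      by (auto simp: eventually_sequentially)
    then show "\<exists>n. \<forall>q\<in>SC G D 1. class_sim G n p q \<longrightarrow> q \<in> U"
      using e(2) SC_dist_le[OF p] by (meson le_less_trans)
  next
    assume "\<exists>n. \<forall>q\<in>SC G D 1. class_sim G n p q \<longrightarrow> q \<in> U"
    then obtain n where "\<And>q. q \<in> SC G D 1 \<Longrightarrow> class_sim G n p q \<Longrightarrow> q \<in> U" by blast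
    then show "\<exists>e>0. \<forall>q\<in>SC G D 1. SC_dist G p q < e \<longrightarrow> q \<in> U"
      using SC_dist_less_imp[OF p] by (intro exI[of _ "ennreal (2 powr - real n)"]) auto
  qed
  then show ?thesis unfolding SC_open_def by blast
qed


section \<open>Balls with equal data, and countability of the cells\<close>

lemma ball_sim_id:
  assumes sub: "{\<sigma>\<in>K. \<sigma> \<subseteq> nbhd K R n} = {\<sigma>\<in>L. \<sigma> \<subseteq> nbhd K R n}"
    and W: "nbhd L R n = nbhd K R n"
    and act: "\<And>g x. g \<in> carrier G \<Longrightarrow> x \<in> nbhd K R n \<Longrightarrow> \<phi> g x = \<psi> g x"
  shows "ball_sim G n (K, \<phi>, [R]) (L, \<psi>, [R])"
proof -
  have "\<sigma> \<in> L \<longleftrightarrow> \<sigma> \<in> K" if "\<sigma> \<subseteq> nbhd K R n" for \<sigma>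
    using that sub by blast
  then have "local_iso G (nbhd K R n) K \<phi> (nbhd L R n) L \<psi> id"
    unfolding W using act by (intro local_isoI) auto
  then show ?thesis unfolding ball_sim_simp by (intro exI[of _ id]) simp
qed

text \<open>Balls are finite, because the root orbit is finite and degrees are bounded. A ball of a
  representative on \<open>nat\<close> is thus described by finite data, of which there are
  countably many, and equal data give equal cells.\<close>

lemma countable_cells:
  fixes G :: "('g, 'b) monoid_scheme"
  assumes "finite (carrier G)"
  shows "countable ((\<lambda>p. {q \<in> SC G D 1. class_sim G n p q}) ` SC G D 1)"
proof -
  \<comment> \<open>The action is recorded by the graphs of its restrictions to the ball, for
    \<open>g\<close> in \<open>carrier G\<close> only: finite sets indexed by a finite set. Whole
    functions on \<open>nat\<close> would come from an uncountable set.\<close>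
  define code :: "('g, nat) rcomplex set \<Rightarrow>
      nat set set \<times> ('g \<Rightarrow> (nat \<times> nat) set) \<times> nat set \<times> nat set" where
    "code p = (case class_rep p of (K, \<phi>, os) \<Rightarrow>
      let R = \<Union>(set os); W = nbhd K R n in
        ({\<sigma>\<in>K. \<sigma> \<subseteq> W}, (\<lambda>g\<in>carrier G. (\<lambda>x. (x, \<phi> g x)) ` W), R, W))" for p
  have code: "code p = ({\<sigma>\<in>K. \<sigma> \<subseteq> nbhd K R n},
      (\<lambda>g\<in>carrier G. (\<lambda>x. (x, \<phi> g x)) ` nbhd K R n), R, nbhd K R n)"
    if "class_rep p = (K, \<phi>, [R])" for p K \<phi> R
    using that by (simp add: code_def Let_def)
  have "code ` SC G D 1 \<subseteq> Fpow (Collect finite) \<times> (\<Pi>\<^sub>E g\<in>carrier G. Collect finite) \<times> Collect finite \<times> Collect finite"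
  proof
    fix c assume "c \<in> code ` SC G D 1"
    then obtain p where p: "p \<in> SC G D 1" "c = code p" by blast
    obtain K \<phi> R where X: "class_rep p = (K, \<phi>, [R])" "gcomplex G K \<phi>" "R \<in> orbits G (verts K) \<phi>"
      using class_rep_SC(1)[OF p(1)] by (rule orbit_rootedE)
    have "ereal_of_enat (vertex_degree K) \<le> ereal D"
      using class_rep_SC(4)[OF p(1)] X(1) by simp
    moreover have R: "finite R" using gcomplex.finite_orbits[OF X(2) assms X(3)] .
    ultimately have W: "finite (nbhd K R n)"
      using finite_nbhd gcomplex.complex[OF X(2)] by blast
    moreover from W have "finite {\<sigma>\<in>K. \<sigma> \<subseteq> nbhd K R n}"
      by (intro finite_subset[OF _ finite_Pow_iff[THEN iffD2]]) auto
    moreover have "{\<sigma>\<in>K. \<sigma> \<subseteq> nbhd K R n} \<subseteq> Collect finite"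
      using W finite_subset by blast
    ultimately show "c \<in> Fpow (Collect finite) \<times> (\<Pi>\<^sub>E g\<in>carrier G. Collect finite) \<times> Collect finite \<times> Collect finite"
      unfolding p(2) code[OF X(1)] using R by (auto simp: Fpow_def)
  qed
  moreover have "countable (Fpow (Collect finite) \<times> (\<Pi>\<^sub>E g\<in>carrier G. Collect finite) \<times> Collect finite \<times> Collect finite
      :: (nat set set \<times> ('g \<Rightarrow> (nat \<times> nat) set) \<times> nat set \<times> nat set) set)"
    using assms
    by (intro countable_SIGMA countable_Fpow countable_Collect_finite countable_PiE) auto
  ultimately have count: "countable (code ` SC G D 1)" by (rule countable_subset)
  define cell where "cell p = {q \<in> SC G D 1. class_sim G n p q}" for p
  have "cell p = cell q" if p: "p \<in> SC G D 1" and q: "q \<in> SC G D 1" and eq: "code p = code q" for p q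
  proof -
    obtain K \<phi> R where X: "class_rep p = (K, \<phi>, [R])" using class_rep_SC(1)[OF p] by (rule orbit_rootedE)
    obtain L \<psi> S where Y: "class_rep q = (L, \<psi>, [S])" using class_rep_SC(1)[OF q] by (rule orbit_rootedE)
    have eqs: "R = S" "nbhd K R n = nbhd L S n" "{\<sigma>\<in>K. \<sigma> \<subseteq> nbhd K R n} = {\<sigma>\<in>L. \<sigma> \<subseteq> nbhd L S n}"
      and act: "(\<lambda>g\<in>carrier G. (\<lambda>x. (x, \<phi> g x)) ` nbhd K R n) = (\<lambda>g\<in>carrier G. (\<lambda>x. (x, \<psi> g x)) ` nbhd L S n)"
      using eq unfolding code[OF X] code[OF Y] by blast+
    have "\<phi> g x = \<psi> g x" if g: "g \<in> carrier G" and "x \<in> nbhd K R n" for g x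
    proof -
      have "(x, \<phi> g x) \<in> (\<lambda>x. (x, \<phi> g x)) ` nbhd K R n" using that by blast
      also have "\<dots> = (\<lambda>x. (x, \<psi> g x)) ` nbhd L S n" using fun_cong[OF act, of g] g by simp
      finally show ?thesis by blast
    qed
    then have "ball_sim G n (K, \<phi>, [R]) (L, \<psi>, [R])"
      using eqs by (intro ball_sim_id) auto
    then have "class_sim G n p q" unfolding class_sim_def X Y eqs(1) .
    then show "cell p = cell q"
      using class_sim_trans[OF p q] class_sim_trans[OF q p] class_sim_sym[OF p q] unfolding cell_def by blast
  qed
  note cell_code = this
  \<comment> \<open>A cell depends only on the code, so \<open>cell\<close> factors through a choice
    of one point for each code.\<close>
  have "cell ` SC G D 1 \<subseteq> (\<lambda>c. cell (SOME p. p \<in> SC G D 1 \<and> code p = c)) ` (code ` SC G D 1)"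
  proof
    fix A assume "A \<in> cell ` SC G D 1"
    then obtain p where p: "p \<in> SC G D 1" "A = cell p" by blast
    define q where "q = (SOME q. q \<in> SC G D 1 \<and> code q = code p)"
    have "q \<in> SC G D 1 \<and> code q = code p"
      unfolding q_def by (rule someI[of _ p]) (use p in simp)
    then have "cell p = cell q" using cell_code[OF p(1), of q] by simp
    then show "A \<in> (\<lambda>c. cell (SOME p. p \<in> SC G D 1 \<and> code p = c)) ` (code ` SC G D 1)"
      unfolding p(2) q_def using p(1) by (intro image_eqI[of _ _ "code p"]) auto
  qed
  then have "countable (cell ` SC G D 1)"
    using count by (rule countable_subset[OF _ countable_image])
  then show ?thesis by (simp add: cell_def)
qed


section \<open>The components of an orbit\<close>

lemma root_components_eq:
  assumes "R \<subseteq> verts K"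
  shows "root_components (K, \<phi>, [R]) = full_sub (\<Union>n. nbhd K R n) (K, \<phi>, [R])"
proof -
  have "\<Union>{C \<in> complex_components K. C \<inter> R \<noteq> {}} = (\<Union>n. nbhd K R n)"
  proof (intro equalityI subsetI)
    fix x assume "x \<in> \<Union>{C \<in> complex_components K. C \<inter> R \<noteq> {}}"
    then obtain C where C: "C \<in> complex_components K" "C \<inter> R \<noteq> {}" "x \<in> C"
      unfolding Union_iff by blast
    then obtain y v where "C = (edge_rel K)\<^sup>* `` {y}" "v \<in> C" "v \<in> R"
      unfolding complex_components_def quotient_def by blast
    then have v: "v \<in> R" "(y, v) \<in> (edge_rel K)\<^sup>*" "(y, x) \<in> (edge_rel K)\<^sup>*"
      using C(3) by simp_all
    then have "(v, x) \<in> (edge_rel K)\<^sup>*" using rtrancl_trans[OF edge_rtrancl_sym[OF v(2)] v(3)] by simp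
    then show "x \<in> (\<Union>n. nbhd K R n)"
      using v(1) unfolding mem_UN_nbhd_iff by blast
  next
    fix x assume "x \<in> (\<Union>n. nbhd K R n)"
    then obtain v where v: "v \<in> R" "(v, x) \<in> (edge_rel K)\<^sup>*"
      unfolding mem_UN_nbhd_iff by blast
    then have "v \<in> verts K" using assms by blast
    then have "(edge_rel K)\<^sup>* `` {v} \<in> complex_components K"
      unfolding complex_components_def by (rule quotientI)
    moreover have "v \<in> (edge_rel K)\<^sup>* `` {v} \<inter> R" using v(1) by simp
    ultimately show "x \<in> \<Union>{C \<in> complex_components K. C \<inter> R \<noteq> {}}"
      using v(2) unfolding Union_iff by blast
  qed
  then show ?thesis by (simp del: UN_simps)
qed

text \<open>Every ball about \<open>R\<close> lies in the components met by \<open>R\<close>.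
  Discarding the others therefore changes no ball, with the identity as isomorphism, and makes the
  roots meet all components, as points of \<open>SC\<close> require.\<close>

lemma root_components:
  assumes "gcomplex G K \<phi>" and R: "R \<in> orbits G (verts K) \<phi>"
  shows "rooted_G_complex G (root_components (K, \<phi>, [R]))"
    and "ball_sim G n (K, \<phi>, [R]) (root_components (K, \<phi>, [R]))"
    and "ereal_of_enat (vertex_degree K) \<le> ereal D \<Longrightarrow> countable (verts K) \<Longrightarrow>
      iso_class G (root_components (K, \<phi>, [R])) \<in> SC G D 1"
proof -
  interpret gcomplex G K \<phi> by fact
  define W where "W = (\<Union>n. nbhd K R n)"
  define L where "L = {\<sigma>\<in>K. \<sigma> \<subseteq> W}"
  define \<psi> where "\<psi> = (\<lambda>g. restrict (\<phi> g) W)"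
  have RV: "R \<subseteq> verts K" using R by (rule orbits_subset)
  have rc: "root_components (K, \<phi>, [R]) = (L, \<psi>, [R])"
    unfolding root_components_eq[OF RV] by (simp add: L_def \<psi>_def W_def)
  have NW: "nbhd K R n \<subseteq> W" for n unfolding W_def by blast
  have RW: "R \<subseteq> W" using NW[of 0] by simp
  have W: "W \<subseteq> verts K" unfolding W_def by (intro UN_least nbhd_subset_verts RV)
  have W_ne: "W \<noteq> {}" using RW orbits_nonempty[OF R] by blast
  have inv: "\<phi> g x \<in> W" if g: "g \<in> carrier G" and "x \<in> W" for g x
  proof -
    obtain n where "x \<in> nbhd K R n" using \<open>x \<in> W\<close> unfolding W_def by blast
    then have "\<phi> g x \<in> nbhd K R n" using orbits_inv[OF R g] by (rule nbhd_inv[OF g RV, rotated])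
    then show ?thesis using NW by blast
  qed
  have L: "L = (`) id ` {\<sigma>\<in>K. \<sigma> \<subseteq> W}" by (simp add: L_def)
  have I: "verts L = id ` W" "gcomplex G L \<psi>" "local_iso G W K \<phi> (verts L) L \<psi> id"
    by (rule image_gcomplex[where f = id and \<psi> = \<psi>, OF assms(1) W W_ne _ inj_on_id L];
      (erule (1) inv)?; simp add: \<psi>_def)+
  have VL: "verts L = W" using I(1) by simp
  have NL: "nbhd L R n = nbhd K R n" for n
    using local_iso_nbhd[OF I(3) NW, of n] nbhd_subset_verts[of "id ` R" L n] RW VL by simp
  have R': "R \<in> orbits G (verts L) \<psi>"
    using local_iso_orbits[OF assms(1) I(2,3) R RW] by simp
  show rooted: "rooted_G_complex G (root_components (K, \<phi>, [R]))"
    unfolding rc rooted_G_complex_iff NL VL using I(2) R' unfolding VL W_def by simp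
  show "ball_sim G n (K, \<phi>, [R]) (root_components (K, \<phi>, [R]))"
    unfolding rc
  proof (rule ball_sim_id)
    show "{\<sigma>\<in>K. \<sigma> \<subseteq> nbhd K R n} = {\<sigma>\<in>L. \<sigma> \<subseteq> nbhd K R n}"
      unfolding L_def using NW[of n] by blast
    show "nbhd L R n = nbhd K R n" by (rule NL)
    show "\<phi> g x = \<psi> g x" if "x \<in> nbhd K R n" for g x
      using that NW[of n] unfolding \<psi>_def by (simp add: subset_iff)
  qed
  assume "ereal_of_enat (vertex_degree K) \<le> ereal D" "countable (verts K)"
  then show "iso_class G (root_components (K, \<phi>, [R])) \<in> SC G D 1"
    using rooted local_iso_degree[OF complex gcomplex.complex[OF I(2)] _ I(3) W]
    unfolding rc by (intro iso_class_in_SC) (auto simp: VL intro: countable_subset[OF W])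
qed


section \<open>Induced complexes\<close>

lemma nbhd_UN_index: "nbhd K (\<Union>i\<in>I. S i) n = (\<Union>i\<in>I. nbhd K (S i) n)"
  unfolding set_eq_iff UN_iff mem_nbhd_iff by blast

lemma (in gcomplex) nbhd_saturated:
  assumes "S \<subseteq> verts K"
  shows "nbhd K (\<Union>g\<in>carrier G. \<phi> g ` S) n = (\<Union>g\<in>carrier G. \<phi> g ` nbhd K S n)"
  unfolding nbhd_UN_index using nbhd_act[OF _ assms] by simp

text \<open>Only \<open>H\<close> has to act on \<open>K\<close>. So the locale serves
  representatives of points of the space for \<open>H\<close> as well as complexes whose
  \<open>G\<close>-action is restricted to \<open>H\<close>.\<close>

locale induced = G: group G for G (structure) +
  fixes H and K :: "'v set set" and \<phi>
  assumes sub: "subgroup H G" and HK: "gcomplex (G\<lparr>carrier := H\<rparr>) K \<phi>"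
begin

sublocale X: gcomplex "G\<lparr>carrier := H\<rparr>" K \<phi> by (rule HK)

abbreviation "pt \<equiv> ind_point G H \<phi> (verts K)"
abbreviation "IK \<equiv> ind_complex G H K \<phi>"
abbreviation "\<alpha> \<equiv> ind_action G H \<phi> (verts K)"

lemma H_carrier: "h \<in> H \<Longrightarrow> h \<in> carrier G"
  using subgroup.subset[OF sub] by blast

lemma H_closed: "h \<in> H \<Longrightarrow> h' \<in> H \<Longrightarrow> h \<otimes> h' \<in> H" "h \<in> H \<Longrightarrow> inv h \<in> H" "\<one> \<in> H"
  using subgroup.m_closed[OF sub] subgroup.m_inv_closed[OF sub] subgroup.one_closed[OF sub] by auto

lemma H_closed_act: "h \<in> H \<Longrightarrow> y \<in> verts K \<Longrightarrow> \<phi> h y \<in> verts K"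
  using X.act_closed by simp

lemma H_act_mult: "h \<in> H \<Longrightarrow> h' \<in> H \<Longrightarrow> y \<in> verts K \<Longrightarrow> \<phi> (h \<otimes> h') y = \<phi> h (\<phi> h' y)"
  using X.act_mult by simp

lemma H_act_one: "y \<in> verts K \<Longrightarrow> \<phi> \<one> y = y"
  using X.act_one by simp

lemma H_act_inv: "h \<in> H \<Longrightarrow> y \<in> verts K \<Longrightarrow> \<phi> (inv h) (\<phi> h y) = y"
  "h \<in> H \<Longrightarrow> y \<in> verts K \<Longrightarrow> \<phi> h (\<phi> (inv h) y) = y"
  using H_act_mult[of "inv h" h y] H_act_mult[of h "inv h" y] H_act_one H_closed(2) H_carrier by auto

lemma pt_eq: "g \<in> carrier G \<Longrightarrow> y \<in> verts K \<Longrightarrow> pt g y = (\<lambda>h. (g \<otimes> h, \<phi> (inv h) y)) ` H"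
  by (auto simp: ind_point_def ind_rel_def)

text \<open>The defining identification of the balanced product, obtained by reindexing the class
  along \<open>k \<mapsto> h \<otimes> k\<close>, a permutation of \<open>H\<close>.\<close>

lemma pt_shift:
  assumes "g \<in> carrier G" "h \<in> H" "y \<in> verts K"
  shows "pt (g \<otimes> h) y = pt g (\<phi> h y)"
proof -
  have "(\<lambda>k. (g \<otimes> k, \<phi> (inv k) (\<phi> h y))) ` H = (\<lambda>k. (g \<otimes> k, \<phi> (inv k) (\<phi> h y))) ` ((\<lambda>k. h \<otimes> k) ` H)"
  proof -
    have "(\<lambda>k. h \<otimes> k) ` H = H"
    proof (intro equalityI subsetI)
      fix k assume "k \<in> H"
      then show "k \<in> (\<lambda>k. h \<otimes> k) ` H"
        using assms(2) H_closed H_carrier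
        by (intro image_eqI[of _ _ "inv h \<otimes> k"]) (simp_all add: G.m_assoc[symmetric])
    qed (use assms(2) H_closed in auto)
    then show ?thesis by simp
  qed
  also have "\<dots> = (\<lambda>k. (g \<otimes> h \<otimes> k, \<phi> (inv k) y)) ` H"
    unfolding image_image
  proof (rule image_cong[OF refl])
    fix k assume k: "k \<in> H"
    have "\<phi> (inv (h \<otimes> k)) (\<phi> h y) = \<phi> (inv k \<otimes> inv h) (\<phi> h y)"
      using assms k H_carrier by (simp add: G.inv_mult_group)
    also have "\<dots> = \<phi> (inv k) y"
      using assms k H_closed by (simp add: H_act_mult H_closed_act H_act_inv)
    finally show "(g \<otimes> (h \<otimes> k), \<phi> (inv (h \<otimes> k)) (\<phi> h y)) = (g \<otimes> h \<otimes> k, \<phi> (inv k) y)"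
      using assms k H_carrier by (simp add: G.m_assoc)
  qed
  finally show ?thesis
    using assms H_carrier by (simp add: pt_eq H_closed_act)
qed

text \<open>The converse of \<open>pt_shift\<close>: the class of \<open>(g', y')\<close> contains
  that pair itself, at index \<open>\<one>\<close>, and its membership in the class of
  \<open>(g, y)\<close> yields \<open>h\<close>.\<close>

lemma pt_eqD:
  assumes "pt g y = pt g' y'" "g \<in> carrier G" "g' \<in> carrier G" "y \<in> verts K" "y' \<in> verts K"
  obtains h where "h \<in> H" "g' = g \<otimes> h" "y = \<phi> h y'"
proof -
  have "(g', y') = (g' \<otimes> \<one>, \<phi> (inv \<one>) y')" using assms H_act_one by simp
  then have "(g', y') \<in> pt g' y'" unfolding pt_eq[OF assms(3,5)] using H_closed(3) by (rule image_eqI)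
  then have "(g', y') \<in> pt g y" using assms(1) by simp
  then obtain h where h: "h \<in> H" "g' = g \<otimes> h" "y' = \<phi> (inv h) y"
    unfolding pt_eq[OF assms(2,4)] by blast
  then have "y = \<phi> h y'" using assms(4) by (simp add: H_act_inv)
  then show thesis using that h by blast
qed

lemma pt_inj:
  assumes "g \<in> carrier G" "y \<in> verts K" "y' \<in> verts K"
  shows "pt g y = pt g y' \<longleftrightarrow> y = y'"
proof
  assume "pt g y = pt g y'"
  then obtain h where h: "h \<in> H" "g = g \<otimes> h" "y = \<phi> h y'"
    using assms(1,1,2,3) by (rule pt_eqD)
  then have "h = \<one>" using assms(1) H_carrier by simp
  then show "y = y'" using h(3) assms H_act_one by simp
qed simp

lemma pt_inj_on: "g \<in> carrier G \<Longrightarrow> inj_on (pt g) (verts K)"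
  using pt_inj by (auto simp: inj_on_def)

lemma verts_IK: "verts IK = (\<Union>g\<in>carrier G. pt g ` verts K)"
proof (intro equalityI subsetI)
  fix c assume "c \<in> verts IK"
  then obtain g \<sigma> where "g \<in> carrier G" "\<sigma> \<in> K" "c \<in> pt g ` \<sigma>"
    unfolding ind_complex_def Union_iff by blast
  then show "c \<in> (\<Union>g\<in>carrier G. pt g ` verts K)" by (blast intro: UnionI)
next
  fix c assume "c \<in> (\<Union>g\<in>carrier G. pt g ` verts K)"
  then obtain g y where gy: "g \<in> carrier G" "y \<in> verts K" "c = pt g y" by blast
  then obtain \<sigma> where "\<sigma> \<in> K" "y \<in> \<sigma>" unfolding Union_iff by blast
  then show "c \<in> verts IK"
    unfolding ind_complex_def Union_iff using gy by blast
qed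

lemma ind_set_eq: "ind_set G H \<phi> (verts K) = verts IK"
proof -
  have "ind_set G H \<phi> (verts K) = (\<lambda>q. ind_rel G H \<phi> (verts K) `` {q}) ` (carrier G \<times> verts K)"
    unfolding ind_set_def quotient_def UNION_singleton_eq_range ..
  also have "\<dots> = (\<Union>g\<in>carrier G. (\<lambda>y. ind_rel G H \<phi> (verts K) `` {(g, y)}) ` verts K)"
    by (intro equalityI subsetI) (blast, blast)
  finally show ?thesis unfolding verts_IK ind_point_def .
qed

lemma act_pt: "g \<in> carrier G \<Longrightarrow> k \<in> carrier G \<Longrightarrow> y \<in> verts K \<Longrightarrow> \<alpha> k (pt g y) = pt (k \<otimes> g) y"
  by (rule ind_action_ind_point[OF G.is_group sub])

lemma act_pt_image:
  assumes "g \<in> carrier G" "k \<in> carrier G" "A \<subseteq> verts K"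
  shows "\<alpha> k ` pt g ` A = pt (k \<otimes> g) ` A"
  unfolding image_image
  by (rule image_cong[OF refl], rule act_pt[OF assms(1,2)], rule subsetD[OF assms(3)])

lemma simplex_pt: "g \<in> carrier G \<Longrightarrow> \<sigma> \<in> K \<Longrightarrow> pt g ` \<sigma> \<in> IK"
  unfolding ind_complex_def mem_Collect_eq by (intro exI[of _ g] exI[of _ \<sigma>]) simp

lemma IK_E:
  assumes "\<tau> \<in> IK"
  obtains g \<sigma> where "g \<in> carrier G" "\<sigma> \<in> K" "\<sigma> \<subseteq> verts K" "\<tau> = pt g ` \<sigma>"
proof -
  obtain g \<sigma> where g: "g \<in> carrier G" "\<sigma> \<in> K" "\<tau> = pt g ` \<sigma>"
    using assms unfolding ind_complex_def by blast
  have "\<sigma> \<subseteq> verts K" using g(2) by (rule Union_upper)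
  then show thesis using that g by blast
qed

text \<open>A simplex lies in a single translate kK, so the group coordinates of its points all
  belong to the coset kH. Hence no edge joins the parts of the induced complex over different
  cosets.\<close>

lemma same_coset:
  assumes "\<tau> \<in> IK" "pt g y \<in> \<tau>" "pt g' y' \<in> \<tau>"
    and g: "g \<in> carrier G" "g' \<in> carrier G" "y \<in> verts K" "y' \<in> verts K"
  shows "\<exists>h\<in>H. g' = g \<otimes> h"
proof -
  obtain k \<sigma> where k: "k \<in> carrier G" "\<sigma> \<subseteq> verts K" "\<tau> = pt k ` \<sigma>"
    using assms(1) by (rule IK_E)
  obtain z where "z \<in> \<sigma>" "pt k z = pt g y" using assms(2) unfolding k(3) by (rule imageE) simp
  moreover obtain z' where "z' \<in> \<sigma>" "pt k z' = pt g' y'" using assms(3) unfolding k(3) by (rule imageE) simp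
  ultimately have z: "z \<in> verts K" "z' \<in> verts K" "pt k z = pt g y" "pt k z' = pt g' y'"
    using k(2) by blast+
  obtain h where h: "h \<in> H" "g = k \<otimes> h" using z(3) k(1) g(1) z(1) g(3) by (rule pt_eqD)
  obtain h' where h': "h' \<in> H" "g' = k \<otimes> h'" using z(4) k(1) g(2) z(2) g(4) by (rule pt_eqD)
  have "h' = h \<otimes> (inv h \<otimes> h')"
    using h(1) h'(1) H_carrier by (simp add: G.m_assoc[symmetric])
  then have "g' = g \<otimes> (inv h \<otimes> h')"
    unfolding h(2) h'(2) using k(1) h(1) h'(1) H_carrier by (simp add: G.m_assoc)
  then show ?thesis using h(1) h'(1) H_closed by blast
qed

text \<open>Two descriptions of one simplex share a point, so their group elements differ by some
  \<open>h\<close> in \<open>H\<close>. Absorbing \<open>h\<close> into the second simplex gives an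
  equation under the injective map \<open>pt g\<close>, and \<open>H\<close> preserves
  \<open>K\<close>.\<close>

lemma simplex_pt_iff:
  assumes "g \<in> carrier G" "\<sigma> \<subseteq> verts K"
  shows "pt g ` \<sigma> \<in> IK \<longleftrightarrow> \<sigma> \<in> K"
proof
  assume "pt g ` \<sigma> \<in> IK"
  then obtain g' \<sigma>' where g': "g' \<in> carrier G" "\<sigma>' \<in> K" "\<sigma>' \<subseteq> verts K" "pt g ` \<sigma> = pt g' ` \<sigma>'"
    by (rule IK_E)
  obtain z where z: "z \<in> \<sigma>'" using simplicial_complexD(2)[OF X.complex g'(2)] by blast
  then have "pt g' z \<in> pt g ` \<sigma>" unfolding g'(4) by (rule imageI)
  then obtain y where y: "y \<in> \<sigma>" "pt g y = pt g' z" by (rule imageE) simp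
  obtain h where h: "h \<in> H" "g' = g \<otimes> h"
    using y(2) assms(1) g'(1) subsetD[OF assms(2) y(1)] subsetD[OF g'(3) z] by (rule pt_eqD)
  have "pt g' ` \<sigma>' = pt g ` \<phi> h ` \<sigma>'"
    unfolding image_image h(2)
    by (rule image_cong[OF refl], rule pt_shift[OF assms(1) h(1)], rule subsetD[OF g'(3)])
  then have "pt g ` \<sigma> = pt g ` \<phi> h ` \<sigma>'" using g'(4) by simp
  moreover have "\<phi> h ` \<sigma>' \<subseteq> verts K" using g'(3) H_closed_act[OF h(1)] by blast
  ultimately have "\<sigma> = \<phi> h ` \<sigma>'"
    by (simp only: inj_on_image_eq_iff[OF pt_inj_on[OF assms(1)] assms(2)])
  then show "\<sigma> \<in> K" using X.simplex_image[of h] h(1) g'(2) by simp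
qed (rule simplex_pt[OF assms(1)])

lemma IK_gcomplex: "gcomplex G IK \<alpha>"
proof -
  have "simplicial_complex IK"
    unfolding simplicial_complex_def
  proof (intro conjI ballI allI impI)
    obtain \<sigma> where "\<sigma> \<in> K" using X.complex unfolding simplicial_complex_def by blast
    then show "IK \<noteq> {}" using simplex_pt[OF G.one_closed] by blast
  next
    fix \<tau> assume "\<tau> \<in> IK"
    then obtain g \<sigma> where g: "g \<in> carrier G" "\<sigma> \<in> K" "\<sigma> \<subseteq> verts K" "\<tau> = pt g ` \<sigma>" by (rule IK_E)
    then show "finite \<tau>" "\<tau> \<noteq> {}" using simplicial_complexD(1,2)[OF X.complex g(2)] by auto
    fix \<rho> assume "\<rho> \<noteq> {} \<and> \<rho> \<subseteq> \<tau>"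
    then obtain \<sigma>' where "\<sigma>' \<subseteq> \<sigma>" "\<rho> = pt g ` \<sigma>'" "\<sigma>' \<noteq> {}"
      using g(4) by (auto simp: subset_image_iff)
    then show "\<rho> \<in> IK"
      using simplicial_complexD(3)[OF X.complex g(2)] simplex_pt[OF g(1)] by blast
  qed
  moreover have "group_action G (verts IK) \<alpha>"
  proof (rule group_actionI)
    show "group G" by (rule G.is_group)
    show "\<alpha> g \<in> extensional (verts IK)" for g
      by (simp add: ind_action_def ind_set_eq)
  next
    fix k c assume k: "k \<in> carrier G" and "c \<in> verts IK"
    then obtain g y where "g \<in> carrier G" "y \<in> verts K" "c = pt g y" unfolding verts_IK by blast
    then show "\<alpha> k c \<in> verts IK"
      unfolding verts_IK using k by (intro UN_I[of "k \<otimes> g"]) (simp_all add: act_pt)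
  next
    fix g h c assume "g \<in> carrier G" "h \<in> carrier G" "c \<in> verts IK"
    then show "\<alpha> (g \<otimes> h) c = \<alpha> g (\<alpha> h c)"
      unfolding verts_IK by (auto simp: act_pt G.m_assoc)
  next
    fix c assume "c \<in> verts IK"
    then show "\<alpha> \<one> c = c"
      unfolding verts_IK by (auto simp: act_pt)
  qed
  moreover have "\<alpha> k ` \<tau> \<in> IK" if k: "k \<in> carrier G" and \<tau>: "\<tau> \<in> IK" for k \<tau>
  proof -
    obtain g \<sigma> where g: "g \<in> carrier G" "\<sigma> \<in> K" "\<sigma> \<subseteq> verts K" "\<tau> = pt g ` \<sigma>"
      using \<tau> by (rule IK_E)
    then show ?thesis using k by (simp add: act_pt_image simplex_pt)
  qed
  ultimately show ?thesis by unfold_locales (simp add: simplicial_G_complex_def)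
qed

sublocale I: gcomplex G IK \<alpha> by (rule IK_gcomplex)

section \<open>Balls in the induced complex\<close>

text \<open>The canonical embedding of \<open>K\<close> is equivariant for \<open>H\<close>: for h
  in H, \<lfloor>h, y\<rfloor> = \<lfloor>1, hy\<rfloor>.\<close>

lemma local_iso_pt_one:
  assumes "A \<subseteq> verts K"
  shows "local_iso (G\<lparr>carrier := H\<rparr>) A K \<phi> (pt \<one> ` A) IK \<alpha> (pt \<one>)"
proof (rule local_isoI)
  show "bij_betw (pt \<one>) A (pt \<one> ` A)"
    using inj_on_subset[OF pt_inj_on[OF G.one_closed] assms] by (simp add: bij_betw_def)
  show "pt \<one> ` \<sigma> \<in> IK \<longleftrightarrow> \<sigma> \<in> K" if "\<sigma> \<subseteq> A" for \<sigma>
    using that assms by (intro simplex_pt_iff) auto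
  show "pt \<one> (\<phi> h y) = \<alpha> h (pt \<one> y)" if "h \<in> carrier (G\<lparr>carrier := H\<rparr>)" "y \<in> A" for h y
    using that assms pt_shift[of \<one> h y] act_pt[of \<one> h y] H_carrier by (auto simp: subset_iff)
qed

text \<open>The ends of an edge lie over the same coset, so the second end can be rewritten over the
  same \<open>g\<close>. Neighbours stay in the sheet of \<open>g\<close> and come from neighbours
  in \<open>K\<close>.\<close>

lemma edge_pt:
  assumes "(pt g y, c) \<in> edge_rel IK" "g \<in> carrier G" "y \<in> verts K"
  shows "c \<in> pt g ` (edge_rel K `` {y})"
proof -
  have "c \<in> verts IK" using edge_relD[OF assms(1)] by simp
  then obtain g' y' where g': "g' \<in> carrier G" "y' \<in> verts K" "c = pt g' y'"
    unfolding verts_IK by blast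
  have e: "pt g y \<noteq> c" "{pt g y, c} \<in> IK" using assms(1) by (auto simp: edge_rel_def)
  then obtain h where h: "h \<in> H" "g' = g \<otimes> h"
    using same_coset[OF e(2), of g y g' y'] assms g' by auto
  then have c: "c = pt g (\<phi> h y')" using g' pt_shift assms(2) by simp
  have V: "\<phi> h y' \<in> verts K" using h g' H_closed_act by blast
  have "{pt g y, c} = pt g ` {y, \<phi> h y'}" using c by simp
  then have "{y, \<phi> h y'} \<in> K" using e(2) simplex_pt_iff[OF assms(2), of "{y, \<phi> h y'}"] assms(3) V by simp
  moreover have "y \<noteq> \<phi> h y'" using e(1) c by auto
  ultimately have "\<phi> h y' \<in> edge_rel K `` {y}" by (simp add: edge_rel_def)
  then show ?thesis unfolding c by (rule imageI)
qed

lemma nbhd_pt_one: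
  assumes "S \<subseteq> verts K"
  shows "nbhd IK (pt \<one> ` S) n = pt \<one> ` nbhd K S n"
proof -
  \<comment> \<open>Edges do not leave the sheet of \<open>\<one>\<close>. This gives the inclusion
    on the target side that \<open>local_iso_nbhd\<close> asks for.\<close>
  have "nbhd IK (pt \<one> ` S) n \<subseteq> pt \<one> ` verts K"
  proof (induction n)
    case (Suc n)
    have "c \<in> pt \<one> ` verts K" if bc: "(b, c) \<in> edge_rel IK" "b \<in> nbhd IK (pt \<one> ` S) n" for b c
    proof -
      obtain y where y: "y \<in> verts K" "b = pt \<one> y" using Suc bc(2) by blast
      then have "c \<in> pt \<one> ` (edge_rel K `` {y})" using edge_pt bc(1) by blast
      moreover have "edge_rel K `` {y} \<subseteq> verts K" using edge_relD by fast
      ultimately show ?thesis by blast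
    qed
    then show ?case using Suc by auto
  qed (use assms in auto)
  then show ?thesis
    using local_iso_nbhd[OF local_iso_pt_one[OF subset_refl], of S n] nbhd_subset_verts[OF assms] by simp
qed

definition "ind_root R = (\<Union>x\<in>R. orbit G \<alpha> (pt \<one> x))"

lemma ind_rooted_eq: "ind_rooted G H (K, \<phi>, [R]) = (IK, \<alpha>, [ind_root R])"
  by (simp add: ind_root_def)

lemma ind_root_eq: "ind_root R = (\<Union>g\<in>carrier G. \<alpha> g ` pt \<one> ` R)"
  unfolding ind_root_def orbit_def by blast

lemma pt_one_verts: "y \<in> verts K \<Longrightarrow> pt \<one> y \<in> verts IK"
  unfolding verts_IK using G.one_closed by blast

lemma ind_root_orbits:
  assumes "R \<in> orbits (G\<lparr>carrier := H\<rparr>) (verts K) \<phi>"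
  shows "ind_root R \<in> orbits G (verts IK) \<alpha>"
proof -
  obtain x where x: "x \<in> verts K" "R = orbit (G\<lparr>carrier := H\<rparr>) \<phi> x"
    using X.orbitsD[OF assms] by blast
  have "orbit G \<alpha> (pt \<one> y) = orbit G \<alpha> (pt \<one> x)" if y: "y \<in> R" for y
  proof -
    obtain h where h: "h \<in> H" "y = \<phi> h x" using y x(2) by (auto simp: orbit_def)
    then have "pt \<one> y = \<alpha> h (pt \<one> x)"
      using pt_shift[of \<one> h x] act_pt[of \<one> h x] x(1) H_carrier by simp
    then have "pt \<one> y \<in> orbit G \<alpha> (pt \<one> x)" using h(1) H_carrier unfolding orbit_def by blast
    moreover have "orbit G \<alpha> (pt \<one> x) \<in> orbits G (verts IK) \<alpha>"
      using pt_one_verts[OF x(1)] unfolding orbits_def by blast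
    ultimately show ?thesis using I.orbits_eq_orbit by blast
  qed
  moreover have "x \<in> R" using X.orbit_self x by simp
  ultimately have "ind_root R = orbit G \<alpha> (pt \<one> x)"
    unfolding ind_root_def by blast
  then show ?thesis using pt_one_verts[OF x(1)] unfolding orbits_def by blast
qed

text \<open>Balls commute with unions and translates, and in the sheet of \<open>\<one>\<close> they
  are balls of \<open>K\<close>. The two forms match the target and the domain of the map in
  \<open>ind_ball_sim\<close>.\<close>

lemma nbhd_ind_root:
  assumes "R \<subseteq> verts K"
  shows "nbhd IK (ind_root R) n = (\<Union>g\<in>carrier G. \<alpha> g ` pt \<one> ` nbhd K R n)"
    and "nbhd IK (ind_root R) n = (\<Union>g\<in>carrier G. pt g ` nbhd K R n)"
proof -
  have "pt \<one> ` R \<subseteq> verts IK" using assms pt_one_verts by blast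
  then show *: "nbhd IK (ind_root R) n = (\<Union>g\<in>carrier G. \<alpha> g ` pt \<one> ` nbhd K R n)"
    unfolding ind_root_eq by (simp only: I.nbhd_saturated nbhd_pt_one[OF assms])
  also have "\<dots> = (\<Union>g\<in>carrier G. pt g ` nbhd K R n)"
    using act_pt_image[OF G.one_closed _ nbhd_subset_verts[OF assms]] by simp
  finally show "nbhd IK (ind_root R) n = (\<Union>g\<in>carrier G. pt g ` nbhd K R n)" .
qed

lemma ind_rooted_G_complex:
  assumes "rooted_G_complex (G\<lparr>carrier := H\<rparr>) (K, \<phi>, [R])"
  shows "rooted_G_complex G (ind_rooted G H (K, \<phi>, [R]))"
proof -
  have R: "R \<in> orbits (G\<lparr>carrier := H\<rparr>) (verts K) \<phi>" "verts K \<subseteq> (\<Union>n. nbhd K R n)"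
    using iffD1[OF rooted_G_complex_iff assms] by simp_all
  have "verts IK \<subseteq> (\<Union>n. nbhd IK (ind_root R) n)"
    unfolding nbhd_ind_root(2)[OF X.orbits_subset[OF R(1)]] verts_IK using R(2) by blast
  then show ?thesis
    unfolding ind_rooted_eq rooted_G_complex_iff using IK_gcomplex ind_root_orbits[OF R(1)] by blast
qed

lemma ind_degree:
  assumes "ereal_of_enat (vertex_degree K) \<le> ereal D"
  shows "ereal_of_enat (vertex_degree IK) \<le> ereal D"
proof (rule degree_transfer[OF X.complex I.complex assms])
  fix c assume "c \<in> verts IK"
  then obtain g y where c: "g \<in> carrier G" "y \<in> verts K" "c = pt g y" unfolding verts_IK by blast
  then have "edge_rel IK `` {c} \<subseteq> pt g ` (edge_rel K `` {y})" using edge_pt by blast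
  then show "\<exists>x\<in>verts K. \<exists>f. edge_rel IK `` {c} \<subseteq> f ` (edge_rel K `` {x})" using c(2) by blast
qed

text \<open>The universal property of induction, localised: an \<open>H\<close>-map \<open>f\<close> extends to a \<open>G\<close>-map
  \<open>\<lfloor>g, y\<rfloor> \<mapsto> g f(y)\<close>, and this remains an isomorphism onto its image as long as the translates of
  the image of \<open>f\<close> by different cosets of \<open>H\<close> neither meet nor are joined by an edge.\<close>

lemma ind_local_iso:
  assumes "gcomplex G L \<psi>" and A: "A \<subseteq> verts K" and B: "B \<subseteq> verts L"
    and A_inv: "\<And>h y. h \<in> H \<Longrightarrow> y \<in> A \<Longrightarrow> \<phi> h y \<in> A"
    and f: "local_iso (G\<lparr>carrier := H\<rparr>) A K \<phi> B L \<psi> f"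
    and sep: "\<And>g z z'. g \<in> carrier G \<Longrightarrow> g \<notin> H \<Longrightarrow> z \<in> B \<Longrightarrow> z' \<in> B \<Longrightarrow>
      z \<noteq> \<psi> g z' \<and> (z, \<psi> g z') \<notin> edge_rel L"
  obtains F where "local_iso G (\<Union>g\<in>carrier G. pt g ` A) IK \<alpha> (\<Union>g\<in>carrier G. \<psi> g ` B) L \<psi> F"
    and "\<And>g y. g \<in> carrier G \<Longrightarrow> y \<in> A \<Longrightarrow> F (pt g y) = \<psi> g (f y)"
proof -
  interpret L: gcomplex G L \<psi> by fact
  note fD = local_isoD[OF f]
  have fB: "f y \<in> B" if "y \<in> A" for y using fD(3) that by blast
  have fL: "f y \<in> verts L" if "y \<in> A" for y using fB[OF that] B by (rule rev_subsetD)
  have AV: "y \<in> verts K" if "y \<in> A" for y using that A by (rule rev_subsetD)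
  have f_eqv: "f (\<phi> h y) = \<psi> h (f y)" if "h \<in> H" "y \<in> A" for h y using fD(5)[of h y] that by simp
  \<comment> \<open>\<open>F\<close> reads off an arbitrary pair in the class. For \<open>y\<close>
    in \<open>A\<close> the choice is immaterial: \<open>\<psi> (g \<otimes> h)\<close> applied to
    \<open>f (\<phi> (inv h) y)\<close> is \<open>\<psi> g (f y)\<close>, because \<open>f\<close>
    is \<open>H\<close>-equivariant.\<close>
  define F where "F c = (case SOME q. q \<in> c of (g, y) \<Rightarrow> \<psi> g (f y))" for c
  have F: "F (pt g y) = \<psi> g (f y)" if g: "g \<in> carrier G" and y: "y \<in> A" for g y
  proof -
    have "(SOME q. q \<in> pt g y) \<in> pt g y"
      unfolding pt_eq[OF g AV[OF y]] some_in_eq using H_closed(3) by blast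
    then obtain h where h: "h \<in> H" "(SOME q. q \<in> pt g y) = (g \<otimes> h, \<phi> (inv h) y)"
      unfolding pt_eq[OF g AV[OF y]] by blast
    then have "F (pt g y) = \<psi> (g \<otimes> h) (\<psi> (inv h) (f y))"
      unfolding F_def using f_eqv[OF _ y] H_closed by simp
    also have "\<dots> = \<psi> g (f y)"
      using g h(1) fL[OF y] H_carrier by (simp add: L.act_mult L.act_closed L.act_inv)
    finally show ?thesis .
  qed
  have coset: "pt g' y' = pt g (\<phi> (inv g \<otimes> g') y')"
    if "g \<in> carrier G" "g' \<in> carrier G" "inv g \<otimes> g' \<in> H" "y' \<in> verts K" for g g' y'
    using pt_shift[of g "inv g \<otimes> g'" y'] that by (simp add: G.m_assoc[symmetric])
  \<comment> \<open>Translating by \<open>inv g\<close> reduces this to \<open>f y\<close> and a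
    translate of \<open>f y'\<close> by \<open>inv g \<otimes> g'\<close>, where \<open>sep\<close>
    excludes both coincidence and adjacency.\<close>
  have H_of: "inv g \<otimes> g' \<in> H"
    if g: "g \<in> carrier G" "g' \<in> carrier G" "y \<in> A" "y' \<in> A"
      and *: "\<psi> g (f y) = \<psi> g' (f y') \<or> {\<psi> g (f y), \<psi> g' (f y')} \<in> L" for g g' y y'
  proof (rule ccontr)
    assume n: "inv g \<otimes> g' \<notin> H"
    define k where "k = inv g \<otimes> g'"
    have k: "k \<in> carrier G" "\<psi> g' (f y') = \<psi> g (\<psi> k (f y'))"
      unfolding k_def using g fL by (simp_all add: L.act_mult[symmetric] L.act_closed G.m_assoc[symmetric])
    have s: "f y \<noteq> \<psi> k (f y')" "(f y, \<psi> k (f y')) \<notin> edge_rel L"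
      using sep[OF k(1) n[folded k_def] fB[OF g(3)] fB[OF g(4)]] by auto
    have V: "f y \<in> verts L" "\<psi> k (f y') \<in> verts L"
      using g fL k(1) L.act_closed by simp_all
    have "\<psi> g ` {f y, \<psi> k (f y')} \<in> L \<longleftrightarrow> {f y, \<psi> k (f y')} \<in> L"
      using V by (intro L.simplex_image_iff g(1)) simp
    then show False
      using * s V g(1) unfolding k(2) by (simp add: L.act_inj edge_rel_def)
  qed
  have "local_iso G (\<Union>g\<in>carrier G. pt g ` A) IK \<alpha> (\<Union>g\<in>carrier G. \<psi> g ` B) L \<psi> F"
  proof (rule local_isoI)
    show "bij_betw F (\<Union>g\<in>carrier G. pt g ` A) (\<Union>g\<in>carrier G. \<psi> g ` B)"
      unfolding bij_betw_def
    proof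
      show "inj_on F (\<Union>g\<in>carrier G. pt g ` A)"
      proof (rule inj_onI)
        fix c c' assume "c \<in> (\<Union>g\<in>carrier G. pt g ` A)" "c' \<in> (\<Union>g\<in>carrier G. pt g ` A)"
        then obtain g y g' y' where g: "g \<in> carrier G" "g' \<in> carrier G" "y \<in> A" "y' \<in> A"
          and c: "c = pt g y" "c' = pt g' y'" by blast
        assume "F c = F c'"
        then have eq: "\<psi> g (f y) = \<psi> g' (f y')" using F g c by simp
        define h where "h = inv g \<otimes> g'"
        have h: "h \<in> H" unfolding h_def using H_of[OF g] eq by blast
        have "\<psi> g' (f y') = \<psi> g (\<psi> h (f y'))"
          unfolding h_def using g fL by (simp add: L.act_mult[symmetric] G.m_assoc[symmetric])
        then have "f y = \<psi> h (f y')"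
          using eq g(1) L.act_inj[OF g(1) fL[OF g(3)] L.act_closed[OF H_carrier[OF h] fL[OF g(4)]]] by simp
        then have "f y = f (\<phi> h y')" using f_eqv[OF h g(4)] by simp
        then have "y = \<phi> h y'" using fD(2) g(3) A_inv[OF h g(4)] by (simp add: inj_on_eq_iff)
        then show "c = c'" unfolding c using coset[OF g(1,2) h[unfolded h_def] AV[OF g(4)]] by (simp add: h_def)
      qed
      have "F ` pt g ` A = \<psi> g ` B" if "g \<in> carrier G" for g
      proof -
        have "F ` pt g ` A = \<psi> g ` f ` A"
          unfolding image_image using F[OF that] by (rule image_cong[OF refl])
        then show ?thesis using fD(3) by simp
      qed
      then show "F ` (\<Union>g\<in>carrier G. pt g ` A) = (\<Union>g\<in>carrier G. \<psi> g ` B)"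
        by (simp add: image_UN)
    qed
  next
    fix \<tau> assume \<tau>: "\<tau> \<subseteq> (\<Union>g\<in>carrier G. pt g ` A)"
    have key: "F ` \<tau> \<in> L \<longleftrightarrow> \<tau> \<in> IK" if g: "g \<in> carrier G" and \<sigma>: "\<sigma> \<subseteq> A" "\<tau> = pt g ` \<sigma>" for g \<sigma>
    proof -
      have "F ` \<tau> = \<psi> g ` f ` \<sigma>"
        unfolding \<sigma>(2) image_image using F[OF g] \<sigma>(1) by (intro image_cong) auto
      moreover have "f ` \<sigma> \<subseteq> verts L" using \<sigma>(1) fL by blast
      ultimately have "F ` \<tau> \<in> L \<longleftrightarrow> f ` \<sigma> \<in> L" using L.simplex_image_iff[OF g] by simp
      also have "\<dots> \<longleftrightarrow> \<sigma> \<in> K" using \<sigma>(1) by (rule fD(4))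
      also have "\<dots> \<longleftrightarrow> \<tau> \<in> IK" unfolding \<sigma>(2) using simplex_pt_iff[OF g] \<sigma>(1) A by simp
      finally show ?thesis .
    qed
    show "F ` \<tau> \<in> L \<longleftrightarrow> \<tau> \<in> IK"
    \<comment> \<open>Inside one translate the claim is that for \<open>f\<close>. A set contained
      in no single translate is a simplex on neither side: simplices of \<open>IK\<close> lie in one
      sheet, and any two points of a simplex of \<open>L\<close> are equal or adjacent, so
      \<open>H_of\<close> puts them over one coset.\<close>
    proof (cases "\<exists>g\<in>carrier G. \<forall>c\<in>\<tau>. c \<in> pt g ` A")
      case True
      then obtain g where g: "g \<in> carrier G" "\<tau> \<subseteq> pt g ` A" by blast
      then obtain \<sigma> where "\<sigma> \<subseteq> A" "\<tau> = pt g ` \<sigma>" by (auto simp: subset_image_iff)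
      then show ?thesis using key g(1) by blast
    next
      case False
      have "\<tau> \<notin> IK"
      proof
        assume "\<tau> \<in> IK"
        then obtain g \<sigma> where g: "g \<in> carrier G" "\<sigma> \<subseteq> verts K" "\<tau> = pt g ` \<sigma>" by (rule IK_E)
        have "pt g y \<in> pt g ` A" if y: "y \<in> \<sigma>" for y
        proof -
          have "pt g y \<in> (\<Union>g\<in>carrier G. pt g ` A)" using \<tau> g(3) y by blast
          then obtain g' a where g': "g' \<in> carrier G" "a \<in> A" "pt g y = pt g' a" by blast
          obtain h where "h \<in> H" "y = \<phi> h a"
            using g'(3) g(1) g'(1) subsetD[OF g(2) y] AV[OF g'(2)] by (rule pt_eqD)
          then show ?thesis using A_inv g'(2) by blast
        qed
        then show False using False g(1,3) by blast
      qed
      moreover have "F ` \<tau> \<notin> L"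
      proof
        assume FL: "F ` \<tau> \<in> L"
        have "\<tau> \<noteq> {}" using simplicial_complexD(2)[OF L.complex FL] by simp
        then obtain g y where g: "g \<in> carrier G" "y \<in> A" "pt g y \<in> \<tau>" using \<tau> by blast
        have "c \<in> pt g ` A" if c: "c \<in> \<tau>" for c
        proof -
          obtain g' y' where g': "g' \<in> carrier G" "y' \<in> A" "c = pt g' y'" using \<tau> c by blast
          have "{F (pt g y), F c} \<subseteq> F ` \<tau>" using c g(3) by blast
          then have "{F (pt g y), F c} \<in> L" using simplicial_complexD(3)[OF L.complex FL, of "{F (pt g y), F c}"] by simp
          then have h: "inv g \<otimes> g' \<in> H"
            using H_of[OF g(1) g'(1) g(2) g'(2)] F g g' by simp
          then have "c = pt g (\<phi> (inv g \<otimes> g') y')" using coset g g' AV by simp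
          then show ?thesis using A_inv[OF h g'(2)] by blast
        qed
        then show False using False g(1) by blast
      qed
      ultimately show ?thesis by simp
    qed
  next
    fix k c assume k: "k \<in> carrier G" and "c \<in> (\<Union>g\<in>carrier G. pt g ` A)"
    then obtain g y where g: "g \<in> carrier G" "y \<in> A" "c = pt g y" by blast
    then show "F (\<alpha> k c) = \<psi> k (F c)"
      using k AV fL by (simp add: act_pt F L.act_mult)
  qed
  then show thesis using F by (rule that)
qed

end


section \<open>Induction and isomorphism of balls\<close>

lemma inducedI:
  assumes "group G" "subgroup H G" "gcomplex (G\<lparr>carrier := H\<rparr>) K \<phi>"
  shows "induced G H K \<phi>"
  using assms by (simp add: induced_def induced_axioms_def)

lemma ind_rooted_orbit_rooted:
  assumes "group G" "subgroup H G" "orbit_rooted (G\<lparr>carrier := H\<rparr>) X"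
  shows "orbit_rooted G (ind_rooted G H X)"
proof -
  obtain K \<phi> R where X: "X = (K, \<phi>, [R])" "gcomplex (G\<lparr>carrier := H\<rparr>) K \<phi>"
    "R \<in> orbits (G\<lparr>carrier := H\<rparr>) (verts K) \<phi>"
    using assms(3) by (rule orbit_rootedE)
  interpret induced G H K \<phi> using inducedI[OF assms(1,2) X(2)] .
  show ?thesis
    unfolding X(1) ind_rooted_eq orbit_rooted_simp using IK_gcomplex ind_root_orbits[OF X(3)] by blast
qed

text \<open>\<open>ind_local_iso\<close> is applied to \<open>f\<close> followed by the embedding of
  the second complex into its own induced complex, where \<open>same_coset\<close> keeps the
  translates by different cosets apart.\<close>

lemma ind_ball_sim:
  assumes "group G" "subgroup H G"
    and XY: "orbit_rooted (G\<lparr>carrier := H\<rparr>) X" "orbit_rooted (G\<lparr>carrier := H\<rparr>) Y"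
    and sim: "ball_sim (G\<lparr>carrier := H\<rparr>) n X Y"
  shows "ball_sim G n (ind_rooted G H X) (ind_rooted G H Y)"
proof -
  obtain K \<phi> R where X: "X = (K, \<phi>, [R])" "gcomplex (G\<lparr>carrier := H\<rparr>) K \<phi>"
    "R \<in> orbits (G\<lparr>carrier := H\<rparr>) (verts K) \<phi>" "R \<subseteq> verts K"
    using XY(1) by (rule orbit_rootedE)
  obtain L \<psi> S where Y: "Y = (L, \<psi>, [S])" "gcomplex (G\<lparr>carrier := H\<rparr>) L \<psi>" "S \<subseteq> verts L"
    using XY(2) by (rule orbit_rootedE)
  interpret X: induced G H K \<phi> using inducedI[OF assms(1,2) X(2)] .
  interpret Y: induced G H L \<psi> using inducedI[OF assms(1,2) Y(2)] .
  obtain f where f: "local_iso (G\<lparr>carrier := H\<rparr>) (nbhd K R n) K \<phi> (nbhd L S n) L \<psi> f" "f ` R = S"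
    using sim unfolding X(1) Y(1) ball_sim_simp by blast
  define B where "B = Y.pt \<one>\<^bsub>G\<^esub> ` nbhd L S n"
  have LV: "nbhd L S n \<subseteq> verts L" using Y(3) by (rule nbhd_subset_verts)
  have KV: "nbhd K R n \<subseteq> verts K" using X(4) by (rule nbhd_subset_verts)
  have B: "B \<subseteq> verts Y.IK" unfolding B_def using LV Y.pt_one_verts by blast
  have inv: "\<phi> h y \<in> nbhd K R n" if "h \<in> H" "y \<in> nbhd K R n" for h y
    using X.X.nbhd_inv[of h R y n] X.X.orbits_inv[OF X(3), of h] X(4) that by simp
  have iso: "local_iso (G\<lparr>carrier := H\<rparr>) (nbhd K R n) K \<phi> B Y.IK Y.\<alpha> (Y.pt \<one>\<^bsub>G\<^esub> \<circ> f)"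
    unfolding B_def by (rule local_iso_trans[OF f(1) Y.local_iso_pt_one[OF LV]])
  have sep: "z \<noteq> Y.\<alpha> g z' \<and> (z, Y.\<alpha> g z') \<notin> edge_rel Y.IK"
    if g: "g \<in> carrier G" "g \<notin> H" and z: "z \<in> B" "z' \<in> B" for g z z'
  proof -
    obtain y y' where y: "y \<in> verts L" "y' \<in> verts L" "z = Y.pt \<one>\<^bsub>G\<^esub> y" "z' = Y.pt \<one>\<^bsub>G\<^esub> y'"
      using z LV unfolding B_def by blast
    have z': "Y.\<alpha> g z' = Y.pt g y'" using g y Y.act_pt[of "\<one>\<^bsub>G\<^esub>" g y'] by simp
    have z'V: "Y.\<alpha> g z' \<in> verts Y.IK" using g(1) z(2) B Y.I.act_closed by blast
    have "False" if "\<tau> \<in> Y.IK" "z \<in> \<tau>" "Y.\<alpha> g z' \<in> \<tau>" for \<tau>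
      using Y.same_coset[OF that(1), of "\<one>\<^bsub>G\<^esub>" y g y'] that(2,3) g y z' Y.H_carrier by auto
    note no_simplex = this
    show ?thesis
    proof
      show "z \<noteq> Y.\<alpha> g z'"
      proof
        assume "z = Y.\<alpha> g z'"
        then show False using no_simplex[OF singleton_simplex[OF Y.I.complex z'V]] by simp
      qed
      show "(z, Y.\<alpha> g z') \<notin> edge_rel Y.IK"
        using no_simplex[of "{z, Y.\<alpha> g z'}"] by (auto simp: edge_rel_def)
    qed
  qed
  obtain F where F: "local_iso G (\<Union>g\<in>carrier G. X.pt g ` nbhd K R n) X.IK X.\<alpha>
      (\<Union>g\<in>carrier G. Y.\<alpha> g ` B) Y.IK Y.\<alpha> F"
    and F_pt: "\<And>g y. g \<in> carrier G \<Longrightarrow> y \<in> nbhd K R n \<Longrightarrow> F (X.pt g y) = Y.\<alpha> g ((Y.pt \<one>\<^bsub>G\<^esub> \<circ> f) y)"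
    using X.ind_local_iso[OF Y.IK_gcomplex KV B inv iso sep] by blast
  have "F ` X.pt g ` R = Y.\<alpha> g ` Y.pt \<one>\<^bsub>G\<^esub> ` S" if "g \<in> carrier G" for g
  proof -
    have "F ` X.pt g ` R = (\<lambda>y. Y.\<alpha> g ((Y.pt \<one>\<^bsub>G\<^esub> \<circ> f) y)) ` R"
      unfolding image_image using nbhd_superset[of R K n] F_pt[OF that] by (intro image_cong) auto
    then show ?thesis unfolding f(2)[symmetric] image_image by simp
  qed
  moreover have "X.ind_root R = (\<Union>g\<in>carrier G. X.pt g ` R)"
    using X.nbhd_ind_root(2)[OF X(4), of 0] by simp
  ultimately have "F ` X.ind_root R = Y.ind_root S"
    unfolding Y.ind_root_eq by (simp add: image_UN)
  then show ?thesis
    unfolding X(1) Y(1) X.ind_rooted_eq Y.ind_rooted_eq ball_sim_simp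
      X.nbhd_ind_root(2)[OF X(4)] Y.nbhd_ind_root(1)[OF Y(3)]
    using F unfolding B_def by blast
qed

text \<open>If the translates of the \<open>n\<close>-ball around \<open>Hx\<close> by two cosets of \<open>H\<close> met or were joined by an edge,
  there would be a path of length at most \<open>n + 1 + n\<close> from \<open>x\<close> to some \<open>g x\<close> with \<open>g \<notin> H\<close>.\<close>

lemma ind_ball_sim_restrict:
  assumes "gcomplex G K \<phi>" "subgroup H G" and x: "x \<in> verts K"
    and far: "\<And>g. g \<in> carrier G - H \<Longrightarrow> \<phi> g x \<notin> nbhd K {x} (2 * n + 1)"
  shows "ball_sim G n (ind_rooted G H (K, \<phi>, [orbit (G\<lparr>carrier := H\<rparr>) \<phi> x])) (K, \<phi>, [orbit G \<phi> x])"
proof -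
  interpret G: gcomplex G K \<phi> by fact
  have HK: "gcomplex (G\<lparr>carrier := H\<rparr>) K \<phi>" using assms(2) by (rule G.subgroup_gcomplex)
  interpret induced G H K \<phi> using inducedI[OF G.is_group assms(2) HK] .
  define R where "R = orbit (G\<lparr>carrier := H\<rparr>) \<phi> x"
  have R_orb: "R \<in> orbits (G\<lparr>carrier := H\<rparr>) (verts K) \<phi>" unfolding R_def orbits_def using x by blast
  have R: "R \<subseteq> verts K" using R_orb by (rule X.orbits_subset)
  have KV: "nbhd K R n \<subseteq> verts K" using R by (rule nbhd_subset_verts)
  have R_eq: "R = (\<lambda>h. \<phi> h x) ` H" by (auto simp: R_def orbit_def)
  have inv: "\<phi> h y \<in> nbhd K R n" if "h \<in> H" "y \<in> nbhd K R n" for h y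
    using X.nbhd_inv[of h R y n] X.orbits_inv[OF R_orb, of h] R that by simp
  \<comment> \<open>The map to be extended is the identity on the n-ball about Hx; its extension is
    \<lfloor>g, y\<rfloor> \<mapsto> gy.\<close>
  have iso: "local_iso (G\<lparr>carrier := H\<rparr>) (nbhd K R n) K \<phi> (nbhd K R n) K \<phi> id"
    by (simp add: local_iso_def)
  have sep: "z \<noteq> \<phi> g z' \<and> (z, \<phi> g z') \<notin> edge_rel K"
    if g: "g \<in> carrier G" "g \<notin> H" and z: "z \<in> nbhd K R n" "z' \<in> nbhd K R n" for g z z'
  proof (rule ccontr)
    assume "\<not> ?thesis"
    then have e: "\<phi> g z' \<in> nbhd K {z} 1" by auto
    obtain h where h: "h \<in> H" "z \<in> nbhd K {\<phi> h x} n"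
      using z(1) unfolding nbhd_UN[of K R n] unfolding R_eq by blast
    obtain h' where h': "h' \<in> H" "z' \<in> nbhd K {\<phi> h' x} n"
      using z(2) unfolding nbhd_UN[of K R n] unfolding R_eq by blast
    note hc = H_carrier[OF h(1)] H_carrier[OF h'(1)]
    have V: "z' \<in> verts K" "\<phi> h' x \<in> verts K" "\<phi> h x \<in> verts K"
      using z(2) KV hc x G.act_closed by auto
    have "\<phi> g z' \<in> nbhd K {\<phi> g (\<phi> h' x)} n"
      using h'(2) G.nbhd_act_iff[OF g(1) V(2,1)] by simp
    then have 1: "\<phi> g (\<phi> h' x) \<in> nbhd K {\<phi> g z'} n" by (rule nbhd_sym)
    have "\<phi> g z' \<in> nbhd K {\<phi> h x} (n + 1)" using h(2) e by (rule nbhd_trans)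
    then have "\<phi> g (\<phi> h' x) \<in> nbhd K {\<phi> h x} (n + 1 + n)" using 1 by (rule nbhd_trans)
    then have "\<phi> g (\<phi> h' x) \<in> nbhd K {\<phi> h x} (2 * n + 1)" by (simp add: mult_2)
    \<comment> \<open>Moving back from \<open>\<phi> h x\<close> to \<open>x\<close> turns
      \<open>g\<close> into \<open>inv h \<otimes> (g \<otimes> h')\<close>. This still lies outside
      \<open>H\<close>, so \<open>far\<close> applies to it.\<close>
    moreover have "\<phi> g (\<phi> h' x) = \<phi> h (\<phi> (inv\<^bsub>G\<^esub> h \<otimes>\<^bsub>G\<^esub> (g \<otimes>\<^bsub>G\<^esub> h')) x)"
      using g(1) hc x by (simp add: G.act_mult[symmetric] G.m_assoc[symmetric])
    ultimately have "\<phi> (inv\<^bsub>G\<^esub> h \<otimes>\<^bsub>G\<^esub> (g \<otimes>\<^bsub>G\<^esub> h')) x \<in> nbhd K {x} (2 * n + 1)"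
      using G.nbhd_act_iff[OF hc(1) x, of "\<phi> (inv\<^bsub>G\<^esub> h \<otimes>\<^bsub>G\<^esub> (g \<otimes>\<^bsub>G\<^esub> h')) x"] g(1) hc x G.act_closed by (simp del: nbhd.simps)
    moreover have "inv\<^bsub>G\<^esub> h \<otimes>\<^bsub>G\<^esub> (g \<otimes>\<^bsub>G\<^esub> h') \<notin> H"
    proof
      assume "inv\<^bsub>G\<^esub> h \<otimes>\<^bsub>G\<^esub> (g \<otimes>\<^bsub>G\<^esub> h') \<in> H"
      then have "h \<otimes>\<^bsub>G\<^esub> (inv\<^bsub>G\<^esub> h \<otimes>\<^bsub>G\<^esub> (g \<otimes>\<^bsub>G\<^esub> h')) \<otimes>\<^bsub>G\<^esub> inv\<^bsub>G\<^esub> h' \<in> H"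
        using h(1) h'(1) H_closed by simp
      moreover have "h \<otimes>\<^bsub>G\<^esub> (inv\<^bsub>G\<^esub> h \<otimes>\<^bsub>G\<^esub> (g \<otimes>\<^bsub>G\<^esub> h')) \<otimes>\<^bsub>G\<^esub> inv\<^bsub>G\<^esub> h' = g"
        using g(1) hc by (simp add: G.m_assoc[symmetric]) (simp add: G.m_assoc)
      ultimately show False using g(2) by simp
    qed
    ultimately show False using far g(1) hc by simp
  qed
  obtain F where F: "local_iso G (\<Union>g\<in>carrier G. pt g ` nbhd K R n) IK \<alpha>
      (\<Union>g\<in>carrier G. \<phi> g ` nbhd K R n) K \<phi> F"
    and F_pt: "\<And>g y. g \<in> carrier G \<Longrightarrow> y \<in> nbhd K R n \<Longrightarrow> F (pt g y) = \<phi> g (id y)"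
    using ind_local_iso[OF assms(1) KV KV inv iso sep] by blast
  have GR: "(\<Union>g\<in>carrier G. \<phi> g ` R) = orbit G \<phi> x"
  proof -
    have o: "orbit G \<phi> x \<in> orbits G (verts K) \<phi>" unfolding orbits_def using x by blast
    have "R \<subseteq> orbit G \<phi> x" unfolding R_eq orbit_def using H_carrier by blast
    then have "\<phi> g y \<in> orbit G \<phi> x" if "g \<in> carrier G" "y \<in> R" for g y
      using G.orbits_inv[OF o that(1)] that(2) by blast
    moreover have "x \<in> R" unfolding R_def using x X.orbit_self by blast
    ultimately show ?thesis unfolding orbit_def by blast
  qed
  have "F ` ind_root R = orbit G \<phi> x"
  proof -
    have "F ` pt g ` R = \<phi> g ` R" if "g \<in> carrier G" for g
      unfolding image_image using nbhd_superset[of R K n] F_pt[OF that] by (intro image_cong) auto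
    moreover have "ind_root R = (\<Union>g\<in>carrier G. pt g ` R)"
      using nbhd_ind_root(2)[OF R, of 0] by simp
    ultimately have "F ` ind_root R = (\<Union>g\<in>carrier G. \<phi> g ` R)" by (simp add: image_UN)
    then show ?thesis unfolding GR .
  qed
  then show ?thesis
    unfolding R_def[symmetric] ind_rooted_eq ball_sim_simp nbhd_ind_root(2)[OF R]
      GR[symmetric] G.nbhd_saturated[OF R] using F by blast
qed


section \<open>Counting short returns to the root orbit\<close>

text \<open>The base vertex is an arbitrary root; by \<open>return_count_eq\<close> each root gives
  the same number, so this is an invariant of the rooted complex.\<close>

fun return_count :: "('g, 'b) monoid_scheme \<Rightarrow> nat \<Rightarrow> ('g, 'v) rcomplex \<Rightarrow> nat" where
  "return_count G m (K, \<phi>, os) =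
     (let x = SOME x. x \<in> \<Union>(set os) in card {g\<in>carrier G. \<phi> g x \<in> nbhd K {x} m})"

text \<open>Conjugation by \<open>k\<close> is the bijection:
  \<open>k \<otimes> g \<otimes> inv k\<close> displaces \<open>\<phi> k x\<close> exactly as far as
  \<open>g\<close> displaces \<open>x\<close>.\<close>

lemma (in gcomplex) card_return_orbit:
  assumes k: "k \<in> carrier G" and x: "x \<in> verts K"
  shows "card {g\<in>carrier G. \<phi> g (\<phi> k x) \<in> nbhd K {\<phi> k x} m} = card {g\<in>carrier G. \<phi> g x \<in> nbhd K {x} m}"
proof -
  have "\<phi> (k \<otimes> g \<otimes> inv k) (\<phi> k x) = \<phi> k (\<phi> g x)" if "g \<in> carrier G" for g
    using that k x by (simp add: act_mult act_closed act_inv)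
  then have conj: "\<phi> (k \<otimes> g \<otimes> inv k) (\<phi> k x) \<in> nbhd K {\<phi> k x} m \<longleftrightarrow> \<phi> g x \<in> nbhd K {x} m"
    if "g \<in> carrier G" for g
    using that nbhd_act_iff[OF k x act_closed[OF that x]] by simp
  have "bij_betw (\<lambda>g. k \<otimes> g \<otimes> inv k) {g\<in>carrier G. \<phi> g x \<in> nbhd K {x} m}
      {g\<in>carrier G. \<phi> g (\<phi> k x) \<in> nbhd K {\<phi> k x} m}"
  proof (intro bij_betwI[where g = "\<lambda>g. inv k \<otimes> g \<otimes> k"])
    show "(\<lambda>g. k \<otimes> g \<otimes> inv k) \<in> {g\<in>carrier G. \<phi> g x \<in> nbhd K {x} m} \<rightarrow>
        {g\<in>carrier G. \<phi> g (\<phi> k x) \<in> nbhd K {\<phi> k x} m}"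
      using k conj by simp
    show "(\<lambda>g. inv k \<otimes> g \<otimes> k) \<in> {g\<in>carrier G. \<phi> g (\<phi> k x) \<in> nbhd K {\<phi> k x} m} \<rightarrow>
        {g\<in>carrier G. \<phi> g x \<in> nbhd K {x} m}"
    proof
      fix g assume g: "g \<in> {g\<in>carrier G. \<phi> g (\<phi> k x) \<in> nbhd K {\<phi> k x} m}"
      then have "k \<otimes> (inv k \<otimes> g \<otimes> k) \<otimes> inv k = g"
        using k by (simp add: m_assoc[symmetric]) (simp add: m_assoc)
      then show "inv k \<otimes> g \<otimes> k \<in> {g\<in>carrier G. \<phi> g x \<in> nbhd K {x} m}"
        using g k conj[of "inv k \<otimes> g \<otimes> k"]
        by simp
    qed
    show "inv k \<otimes> (k \<otimes> g \<otimes> inv k) \<otimes> k = g" if "g \<in> {g\<in>carrier G. \<phi> g x \<in> nbhd K {x} m}" for g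
      using that k by (simp add: m_assoc[symmetric]) (simp add: m_assoc)
    show "k \<otimes> (inv k \<otimes> g \<otimes> k) \<otimes> inv k = g" if "g \<in> {g\<in>carrier G. \<phi> g (\<phi> k x) \<in> nbhd K {\<phi> k x} m}" for g
      using that k by (simp add: m_assoc[symmetric]) (simp add: m_assoc)
  qed
  then show ?thesis by (simp add: bij_betw_same_card)
qed

lemma (in gcomplex) return_count_eq:
  assumes R: "R \<in> orbits G (verts K) \<phi>" "x \<in> R"
  shows "return_count G m (K, \<phi>, [R]) = card {g\<in>carrier G. \<phi> g x \<in> nbhd K {x} m}"
proof -
  define y where "y = (SOME y. y \<in> R)"
  have "y \<in> R" unfolding y_def using R(2) by (rule someI)
  then obtain k where "k \<in> carrier G" "y = \<phi> k x" using orbits_transitive[OF R] by blast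
  moreover have "x \<in> verts K" using orbits_subset[OF R(1)] R(2) by blast
  ultimately have "card {g\<in>carrier G. \<phi> g y \<in> nbhd K {y} m} = card {g\<in>carrier G. \<phi> g x \<in> nbhd K {x} m}"
    using card_return_orbit by simp
  then show ?thesis by (simp add: y_def Let_def)
qed

text \<open>The points \<open>\<phi> g x\<close> and all paths of length at most \<open>m\<close>
  from \<open>x\<close> lie in the \<open>m\<close>-ball about the root orbit, so the count is
  decided there.\<close>

lemma return_count_ball_sim:
  assumes "orbit_rooted G X" "orbit_rooted G Y" "ball_sim G m X Y"
  shows "return_count G m X = return_count G m Y"
proof -
  obtain K \<phi> R where X: "X = (K, \<phi>, [R])" "gcomplex G K \<phi>" "R \<in> orbits G (verts K) \<phi>"
    using assms(1) by (rule orbit_rootedE)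
  obtain L \<psi> S where Y: "Y = (L, \<psi>, [S])" "gcomplex G L \<psi>" "S \<in> orbits G (verts L) \<psi>"
    using assms(2) by (rule orbit_rootedE)
  obtain f where f: "local_iso G (nbhd K R m) K \<phi> (nbhd L S m) L \<psi> f" "f ` R = S"
    using assms(3) unfolding X(1) Y(1) ball_sim_simp by blast
  obtain x where x: "x \<in> R" using gcomplex.orbits_nonempty[OF X(2,3)] by blast
  have fx: "f x \<in> S" using x f(2) by blast
  have sub: "nbhd K {x} m \<subseteq> nbhd K R m" "nbhd L (f ` {x}) m \<subseteq> nbhd L S m"
    using x fx by (simp_all add: nbhd_mono_set)
  have im: "f ` nbhd K {x} m = nbhd L {f x} m"
    using local_iso_nbhd[OF f(1) sub] by simp
  have RA: "R \<subseteq> nbhd K R m" by (rule nbhd_superset)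
  have "\<psi> g (f x) \<in> nbhd L {f x} m \<longleftrightarrow> \<phi> g x \<in> nbhd K {x} m" if g: "g \<in> carrier G" for g
  proof -
    have gx: "\<phi> g x \<in> nbhd K R m" using gcomplex.orbits_inv[OF X(2,3) g x] RA by blast
    have "\<psi> g (f x) = f (\<phi> g x)" using local_isoD(5)[OF f(1) g] x RA by (simp add: subset_iff)
    then show ?thesis
      using inj_on_image_mem_iff[OF local_isoD(2)[OF f(1)] gx sub(1)] im by simp
  qed
  then have "{g\<in>carrier G. \<psi> g (f x) \<in> nbhd L {f x} m} = {g\<in>carrier G. \<phi> g x \<in> nbhd K {x} m}" by blast
  then show ?thesis
    unfolding X(1) Y(1) gcomplex.return_count_eq[OF X(2,3) x] gcomplex.return_count_eq[OF Y(2,3) fx] by simp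
qed

text \<open>In \<open>G \<times>\<^sub>H K\<close> only elements of \<open>H\<close> return \<open>\<lfloor>1, x\<rfloor>\<close> to its own component.\<close>

lemma return_count_ind:
  assumes "group G" "subgroup H G" "orbit_rooted (G\<lparr>carrier := H\<rparr>) X"
  shows "return_count G m (ind_rooted G H X) = return_count (G\<lparr>carrier := H\<rparr>) m X"
proof -
  obtain K \<phi> R where X: "X = (K, \<phi>, [R])" "gcomplex (G\<lparr>carrier := H\<rparr>) K \<phi>"
    "R \<in> orbits (G\<lparr>carrier := H\<rparr>) (verts K) \<phi>" "R \<subseteq> verts K"
    using assms(3) by (rule orbit_rootedE)
  interpret induced G H K \<phi> using inducedI[OF assms(1,2) X(2)] .
  obtain x where x: "x \<in> R" using X.orbits_nonempty[OF X(3)] by blast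
  have xV: "x \<in> verts K" using x X(4) by blast
  have root: "pt \<one>\<^bsub>G\<^esub> x \<in> ind_root R"
    unfolding ind_root_def using x I.orbit_self[OF pt_one_verts[OF xV]] by blast
  have NV: "nbhd K {x} m \<subseteq> verts K" using xV by (intro nbhd_subset_verts) simp
  have nb: "nbhd IK {pt \<one>\<^bsub>G\<^esub> x} m = pt \<one>\<^bsub>G\<^esub> ` nbhd K {x} m"
    using nbhd_pt_one[of "{x}" m] xV by simp
  have "\<alpha> g (pt \<one>\<^bsub>G\<^esub> x) \<in> nbhd IK {pt \<one>\<^bsub>G\<^esub> x} m \<longleftrightarrow> g \<in> H \<and> \<phi> g x \<in> nbhd K {x} m"
    if g: "g \<in> carrier G" for g
  proof -
    have gx: "\<alpha> g (pt \<one>\<^bsub>G\<^esub> x) = pt g x" using act_pt[of "\<one>\<^bsub>G\<^esub>" g x] g xV by simp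
    show ?thesis
      unfolding gx nb
    proof
      assume "pt g x \<in> pt \<one>\<^bsub>G\<^esub> ` nbhd K {x} m"
      then obtain z where z: "z \<in> nbhd K {x} m" "pt \<one>\<^bsub>G\<^esub> z = pt g x" by (rule imageE) simp
      have "z \<in> verts K" using z(1) NV by blast
      then obtain h where "h \<in> H" "g = \<one>\<^bsub>G\<^esub> \<otimes>\<^bsub>G\<^esub> h" "z = \<phi> h x"
        using pt_eqD[OF z(2) G.one_closed g _ xV] by blast
      then show "g \<in> H \<and> \<phi> g x \<in> nbhd K {x} m" using z(1) g H_carrier by simp
    next
      assume a: "g \<in> H \<and> \<phi> g x \<in> nbhd K {x} m"
      then have "pt g x = pt \<one>\<^bsub>G\<^esub> (\<phi> g x)" using pt_shift[of "\<one>\<^bsub>G\<^esub>" g x] g xV by simp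
      then show "pt g x \<in> pt \<one>\<^bsub>G\<^esub> ` nbhd K {x} m" using a by blast
    qed
  qed
  then have "{g\<in>carrier G. \<alpha> g (pt \<one>\<^bsub>G\<^esub> x) \<in> nbhd IK {pt \<one>\<^bsub>G\<^esub> x} m} = {g\<in>carrier (G\<lparr>carrier := H\<rparr>). \<phi> g x \<in> nbhd K {x} m}"
    using H_carrier by auto
  then show ?thesis
    unfolding X(1) ind_rooted_eq I.return_count_eq[OF ind_root_orbits[OF X(3)] root] X.return_count_eq[OF X(3) x]
    by simp
qed


section \<open>Measures on the space of isomorphism classes\<close>

lemma space_SC_borel: "space (SC_borel G D k) = SC G D k"
  and sets_SC_borel_open: "openin (SC_top G D k) U \<Longrightarrow> U \<in> sets (SC_borel G D k)"
proof -
  have Pow: "{U. openin (SC_top G D k) U} \<subseteq> Pow (SC G D k)"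
    using openin_subset[of "SC_top G D k"] by (auto simp: topspace_SC_top)
  show "space (SC_borel G D k) = SC G D k"
    unfolding SC_borel_def using Pow by (simp add: space_measure_of)
  show "openin (SC_top G D k) U \<Longrightarrow> U \<in> sets (SC_borel G D k)"
    unfolding SC_borel_def using Pow by simp
qed

lemma openin_SC_iff:
  "openin (SC_top G D 1) U \<longleftrightarrow>
     U \<subseteq> SC G D 1 \<and> (\<forall>p\<in>U. \<exists>n. \<forall>q\<in>SC G D 1. class_sim G n p q \<longrightarrow> q \<in> U)"
  unfolding openin_SC_top by (rule SC_open_iff)

lemma continuous_SC_locally_constant:
  fixes f :: "('g, nat) rcomplex set \<Rightarrow> real"
  assumes const: "\<And>p q. p \<in> SC G D 1 \<Longrightarrow> q \<in> SC G D 1 \<Longrightarrow> class_sim G n p q \<Longrightarrow> f p = f q"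
  shows "continuous_map (SC_top G D 1) euclideanreal f"
proof -
  have "openin (SC_top G D 1) {p \<in> SC G D 1. f p \<in> U}" for U
    unfolding openin_SC_iff
  proof (intro conjI ballI)
    fix p assume p: "p \<in> {p \<in> SC G D 1. f p \<in> U}"
    show "\<exists>n. \<forall>q\<in>SC G D 1. class_sim G n p q \<longrightarrow> q \<in> {p \<in> SC G D 1. f p \<in> U}"
    proof (intro exI[of _ n] ballI impI)
      fix q assume "q \<in> SC G D 1" "class_sim G n p q"
      then show "q \<in> {p \<in> SC G D 1. f p \<in> U}" using const[of p q] p by simp
    qed
  qed blast
  then show ?thesis by (simp add: continuous_map_def topspace_SC_top Pi_def)
qed

lemma SC_continuous_measurable:
  fixes f :: "('g, nat) rcomplex set \<Rightarrow> real"
  assumes "continuous_map (SC_top G D k) euclideanreal f"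
  shows "f \<in> borel_measurable (SC_borel G D k)"
  using continuous_map_borel_measurable[OF assms] by (simp add: SC_borel_def topspace_SC_top)

lemma SC_weakly_convergesI:
  assumes "finite (carrier G)"
    and M: "\<And>k. prob_space (M k)" "\<And>k. sets (M k) = sets (SC_borel G D 1)"
    and N: "prob_space N" "sets N = sets (SC_borel G D 1)"
    and conv: "\<And>n p. p \<in> SC G D 1 \<Longrightarrow>
      (\<lambda>k. measure (M k) {q \<in> SC G D 1. class_sim G n p q})
        \<longlonglongrightarrow> measure N {q \<in> SC G D 1. class_sim G n p q}"
  shows "weakly_converges (SC_top G D 1) M N"
proof (rule weakly_converges_of_cells[where T = "SC_top G D 1" and E = "class_sim G" and M = M and N = N,
    unfolded topspace_SC_top])
  show "openin (SC_top G D 1) U \<longleftrightarrow>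
      U \<subseteq> SC G D 1 \<and> (\<forall>p\<in>U. \<exists>n. {q \<in> SC G D 1. class_sim G n p q} \<subseteq> U)" for U
    unfolding openin_SC_iff subset_iff mem_Collect_eq Ball_def by blast
  show "countable ((\<lambda>p. {q \<in> SC G D 1. class_sim G n p q}) ` SC G D 1)" for n
    by (rule countable_cells[OF assms(1)])
qed (fact class_sim_refl class_sim_sym class_sim_trans class_sim_mono M N conv
    M(2)[unfolded SC_borel_def] N(2)[unfolded SC_borel_def])+

section \<open>Laws of random vertices, and induction on classes\<close>

text \<open>As a function of a uniformly random \<open>x\<close>, this is the variable whose law is
  \<open>vertex_law\<close>.\<close>

definition vertex_class ::
  "('g, 'b) monoid_scheme \<Rightarrow> 'v set set \<Rightarrow> ('g \<Rightarrow> 'v \<Rightarrow> 'v) \<Rightarrow> 'v \<Rightarrow> ('g, nat) rcomplex set" where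
  "vertex_class G K \<phi> x = iso_class G (root_components (K, \<phi>, [orbit G \<phi> x]))"

text \<open>The chosen representative arises by passing to the components of the orbit and then to a
  copy on \<open>nat\<close>; both steps keep every ball up to isomorphism.\<close>

lemma (in gcomplex) vertex_class:
  assumes "finite K" "ereal_of_enat (vertex_degree K) \<le> ereal D" "x \<in> verts K"
  shows "vertex_class G K \<phi> x \<in> SC G D 1"
    and "ball_sim G n (K, \<phi>, [orbit G \<phi> x]) (class_rep (vertex_class G K \<phi> x))"
    and "orbit_rooted G (K, \<phi>, [orbit G \<phi> x])"
proof -
  have o: "orbit G \<phi> x \<in> orbits G (verts K) \<phi>" unfolding orbits_def using assms(3) by blast
  have "finite (verts K)" using complex assms(1) by (rule finite_verts)
  then show *: "vertex_class G K \<phi> x \<in> SC G D 1"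
    unfolding vertex_class_def
    using root_components(3)[OF gcomplex_axioms o assms(2)] by (simp add: countable_finite)
  show r: "orbit_rooted G (K, \<phi>, [orbit G \<phi> x])"
    unfolding orbit_rooted_simp using gcomplex_axioms o by blast
  obtain L \<psi> S where rc: "root_components (K, \<phi>, [orbit G \<phi> x]) = (L, \<psi>, [S])" by simp
  have r': "orbit_rooted G (root_components (K, \<phi>, [orbit G \<phi> x]))"
    using root_components(1)[OF gcomplex_axioms o] unfolding rc by (rule rooted_imp_orbit_rooted)
  show "ball_sim G n (K, \<phi>, [orbit G \<phi> x]) (class_rep (vertex_class G K \<phi> x))"
    using ball_sim_trans[OF r r' class_rep_SC(1)[OF *] root_components(2)[OF gcomplex_axioms o]]
      ball_sim_class_rep[OF r' *[unfolded vertex_class_def]]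
    unfolding vertex_class_def by blast
qed

lemma (in gcomplex) return_count_vertex_class:
  assumes "finite K" "ereal_of_enat (vertex_degree K) \<le> ereal D" "x \<in> verts K"
  shows "return_count G m (class_rep (vertex_class G K \<phi> x)) = card {g\<in>carrier G. \<phi> g x \<in> nbhd K {x} m}"
proof -
  have o: "orbit G \<phi> x \<in> orbits G (verts K) \<phi>" unfolding orbits_def using assms(3) by blast
  show ?thesis
    using return_count_ball_sim[OF vertex_class(3)[OF assms] class_rep_SC(1)[OF vertex_class(1)[OF assms]]
        vertex_class(2)[OF assms]]
      return_count_eq[OF o orbit_self[OF assms(3)]] by metis
qed

lemma (in gcomplex) vertex_law:
  assumes K: "finite K" "ereal_of_enat (vertex_degree K) \<le> ereal D"
  shows "prob_space (vertex_law G D K \<phi>)"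
    and "\<And>f :: ('a, nat) rcomplex set \<Rightarrow> real. f \<in> borel_measurable (SC_borel G D 1) \<Longrightarrow>
      integral\<^sup>L (vertex_law G D K \<phi>) f = (\<Sum>x\<in>verts K. f (vertex_class G K \<phi> x)) / card (verts K)"
proof -
  have fin: "finite (verts K)" using complex K(1) by (rule finite_verts)
  have ne: "verts K \<noteq> {}" using complex by (rule verts_nonempty)
  have meas: "vertex_class G K \<phi> \<in> uniform_count_measure (verts K) \<rightarrow>\<^sub>M SC_borel G D 1"
    using vertex_class(1)[OF K]
    by (simp add: measurable_cong_sets[OF sets_uniform_count_measure_count_space refl] space_SC_borel Pi_def)
  have law: "vertex_law G D K \<phi> = distr (uniform_count_measure (verts K)) (SC_borel G D 1) (vertex_class G K \<phi>)"
    unfolding vertex_law_def vertex_class_def ..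
  show "prob_space (vertex_law G D K \<phi>)"
    unfolding law using prob_space_uniform_count_measure[OF fin ne] meas by (rule prob_space.prob_space_distr)
  show "integral\<^sup>L (vertex_law G D K \<phi>) f = (\<Sum>x\<in>verts K. f (vertex_class G K \<phi> x)) / card (verts K)"
    if "f \<in> borel_measurable (SC_borel G D 1)" for f :: "('a, nat) rcomplex set \<Rightarrow> real"
    unfolding law integral_distr[OF meas that] by (rule integral_uniform_count_measure[OF fin])
qed

lemma ind_class:
  assumes "group G" "finite (carrier G)" "subgroup H G" and p: "p \<in> SC (G\<lparr>carrier := H\<rparr>) D 1"
  shows "ind_class G H p \<in> SC G D 1"
    and "ball_sim G n (ind_rooted G H (class_rep p)) (class_rep (ind_class G H p))"
proof -
  note rep = class_rep_SC[OF p]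
  obtain K \<phi> R where X: "class_rep p = (K, \<phi>, [R])" "gcomplex (G\<lparr>carrier := H\<rparr>) K \<phi>"
    using rep(1) by (rule orbit_rootedE)
  interpret induced G H K \<phi> using inducedI[OF assms(1,3) X(2)] .
  have "countable (verts IK)"
    unfolding verts_IK using assms(2) by (intro countable_UN countable_finite[of "carrier G"]) auto
  moreover have "rooted_G_complex G (IK, \<alpha>, [ind_root R])"
    using ind_rooted_G_complex[of R] rep(2) unfolding X(1) ind_rooted_eq by blast
  moreover have "ereal_of_enat (vertex_degree IK) \<le> ereal D"
    using ind_degree rep(4) unfolding X(1) by simp
  ultimately have "iso_class G (IK, \<alpha>, [ind_root R]) \<in> SC G D 1"
    by (intro iso_class_in_SC)
  then show *: "ind_class G H p \<in> SC G D 1" unfolding ind_class_def X(1) ind_rooted_eq .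
  show "ball_sim G n (ind_rooted G H (class_rep p)) (class_rep (ind_class G H p))"
    using ball_sim_class_rep[OF ind_rooted_orbit_rooted[OF assms(1,3) rep(1)] *[unfolded ind_class_def]]
    unfolding ind_class_def .
qed

text \<open>This is the continuity of induction in terms of cells, with no loss of level; it is
  \<open>ind_ball_sim\<close> carried over to representatives.\<close>

lemma class_sim_ind:
  assumes G: "group G" "finite (carrier G)" "subgroup H G"
    and pq: "p \<in> SC (G\<lparr>carrier := H\<rparr>) D 1" "q \<in> SC (G\<lparr>carrier := H\<rparr>) D 1"
    and "class_sim (G\<lparr>carrier := H\<rparr>) n p q"
  shows "class_sim G n (ind_class G H p) (ind_class G H q)"
proof -
  let ?X = "ind_rooted G H (class_rep p)" and ?Y = "ind_rooted G H (class_rep q)"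
  note o = ind_rooted_orbit_rooted[OF G(1,3) class_rep_SC(1)[OF pq(1)]]
    ind_rooted_orbit_rooted[OF G(1,3) class_rep_SC(1)[OF pq(2)]]
  note o' = class_rep_SC(1)[OF ind_class(1)[OF G pq(1)]] class_rep_SC(1)[OF ind_class(1)[OF G pq(2)]]
  have "ball_sim G n ?X ?Y"
    using ind_ball_sim[OF G(1,3) class_rep_SC(1)[OF pq(1)] class_rep_SC(1)[OF pq(2)]] assms(6)
    unfolding class_sim_def .
  then have "ball_sim G n ?X (class_rep (ind_class G H q))"
    using ind_class(2)[OF G pq(2)] by (rule ball_sim_trans[OF o o'(2)])
  then show ?thesis
    unfolding class_sim_def
    by (rule ball_sim_trans[OF o'(1) o(1) o'(2) ball_sim_sym[OF o(1) o'(1) ind_class(2)[OF G pq(1)]]])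
qed

lemma ind_class_measurable:
  assumes G: "group G" "finite (carrier G)" "subgroup H G"
  shows "ind_class G H \<in> SC_borel (G\<lparr>carrier := H\<rparr>) D 1 \<rightarrow>\<^sub>M SC_borel G D 1"
proof -
  let ?H = "G\<lparr>carrier := H\<rparr>"
  have Pow: "{U. openin (SC_top G D 1) U} \<subseteq> Pow (SC G D 1)"
    using openin_subset[of "SC_top G D 1"] by (auto simp: topspace_SC_top)
  have pre: "openin (SC_top ?H D 1) (ind_class G H -` U \<inter> SC ?H D 1)" if U: "openin (SC_top G D 1) U" for U
    unfolding openin_SC_iff
  proof (intro conjI ballI)
    fix p assume p: "p \<in> ind_class G H -` U \<inter> SC ?H D 1"
    then obtain n where n: "\<And>q. q \<in> SC G D 1 \<Longrightarrow> class_sim G n (ind_class G H p) q \<Longrightarrow> q \<in> U"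
      using U unfolding openin_SC_iff by blast
    have "q \<in> ind_class G H -` U \<inter> SC ?H D 1" if "q \<in> SC ?H D 1" "class_sim ?H n p q" for q
      using n[OF ind_class(1)[OF G that(1)] class_sim_ind[OF G _ that]] p that(1) by simp
    then show "\<exists>n. \<forall>q\<in>SC ?H D 1. class_sim ?H n p q \<longrightarrow> q \<in> ind_class G H -` U \<inter> SC ?H D 1"
      by blast
  qed blast
  have "ind_class G H \<in> SC_borel ?H D 1 \<rightarrow>\<^sub>M sigma (SC G D 1) {U. openin (SC_top G D 1) U}"
  proof (rule measurable_measure_of[OF Pow])
    show "ind_class G H \<in> space (SC_borel ?H D 1) \<rightarrow> SC G D 1"
      unfolding space_SC_borel using ind_class(1)[OF G] by blast
    show "ind_class G H -` U \<inter> space (SC_borel ?H D 1) \<in> sets (SC_borel ?H D 1)"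
      if "U \<in> {U. openin (SC_top G D 1) U}" for U
      unfolding space_SC_borel using pre that by (intro sets_SC_borel_open) simp
  qed
  then show ?thesis unfolding SC_borel_def[of G] .
qed

lemma return_count_ind_class:
  assumes G: "group G" "finite (carrier G)" "subgroup H G" and p: "p \<in> SC (G\<lparr>carrier := H\<rparr>) D 1"
  shows "return_count G m (class_rep (ind_class G H p)) = return_count (G\<lparr>carrier := H\<rparr>) m (class_rep p)"
  using return_count_ball_sim[OF ind_rooted_orbit_rooted[OF G(1,3) class_rep_SC(1)[OF p]]
      class_rep_SC(1)[OF ind_class(1)[OF G p]] ind_class(2)[OF G p]]
    return_count_ind[OF G(1,3) class_rep_SC(1)[OF p]] by metis

lemma return_count_le:
  assumes "finite (carrier G)" "orbit_rooted G X"
  shows "return_count G m X \<le> card (carrier G)"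
  using assms(2) by (rule orbit_rootedE) (auto simp: Let_def intro!: card_mono assms(1))

text \<open>The count at radius \<open>m\<close> is constant on cells of level \<open>m\<close> and
  never exceeds the order of the group, so it is an admissible test function for weak
  convergence.\<close>

lemma continuous_return_count:
  assumes "finite (carrier G)"
  shows "continuous_map (SC_top G D 1) euclideanreal (\<lambda>p. real (return_count G m (class_rep p)))"
    and "bounded ((\<lambda>p. real (return_count G m (class_rep p))) ` topspace (SC_top G D 1))"
proof -
  show "continuous_map (SC_top G D 1) euclideanreal (\<lambda>p. real (return_count G m (class_rep p)))"
  proof (rule continuous_SC_locally_constant)
    fix p q assume "p \<in> SC G D 1" "q \<in> SC G D 1" "class_sim G m p q"
    then show "real (return_count G m (class_rep p)) = real (return_count G m (class_rep q))"
      unfolding class_sim_def using return_count_ball_sim class_rep_SC(1) by (metis of_nat_eq_iff)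
  qed
  show "bounded ((\<lambda>p. real (return_count G m (class_rep p))) ` topspace (SC_top G D 1))"
    unfolding bounded_iff topspace_SC_top
    using return_count_le[OF assms class_rep_SC(1)]
    by (intro exI[of _ "real (card (carrier G))"]) simp
qed

lemma displaced_eq:
  "0 \<le> C \<Longrightarrow> displaced K \<phi> g C = {x\<in>verts K. \<phi> g x \<in> nbhd K {x} (nat \<lfloor>C\<rfloor>)}"
  by (simp add: displaced_def path_dist_le_iff)

text \<open>Four comparisons of n-balls link the representative of the induced class, the complex
  induced from a representative, the complex induced from (K, Hx), the complex (K, Gx), and its
  representative. The third uses that no element outside \<open>H\<close> returns \<open>x\<close>
  within distance 2n + 1.\<close>

lemma class_sim_ind_vertex_class:
  assumes "gcomplex G K \<phi>" "finite (carrier G)" "subgroup H G"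
    and K: "finite K" "ereal_of_enat (vertex_degree K) \<le> ereal D" and x: "x \<in> verts K"
    and far: "\<And>g. g \<in> carrier G - H \<Longrightarrow> \<phi> g x \<notin> nbhd K {x} (2 * n + 1)"
  shows "class_sim G n (ind_class G H (vertex_class (G\<lparr>carrier := H\<rparr>) K \<phi> x)) (vertex_class G K \<phi> x)"
proof -
  interpret gcomplex G K \<phi> by fact
  interpret H: gcomplex "G\<lparr>carrier := H\<rparr>" K \<phi> using assms(3) by (rule subgroup_gcomplex)
  note G = is_group assms(2,3)
  let ?X = "(K, \<phi>, [orbit (G\<lparr>carrier := H\<rparr>) \<phi> x])" and ?p = "vertex_class (G\<lparr>carrier := H\<rparr>) K \<phi> x"
  let ?q = "vertex_class G K \<phi> x"
  note p = H.vertex_class[OF K x] and q = vertex_class[OF K x]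
  note o = class_rep_SC(1)[OF ind_class(1)[OF G p(1)]]
    ind_rooted_orbit_rooted[OF G(1,3) class_rep_SC(1)[OF p(1)]]
    ind_rooted_orbit_rooted[OF G(1,3) p(3)] q(3) class_rep_SC(1)[OF q(1)]
  have 1: "ball_sim G n (class_rep (ind_class G H ?p)) (ind_rooted G H (class_rep ?p))"
    by (rule ball_sim_sym[OF o(2,1) ind_class(2)[OF G p(1)]])
  have 2: "ball_sim G n (ind_rooted G H (class_rep ?p)) (ind_rooted G H ?X)"
    by (rule ind_ball_sim[OF G(1,3) class_rep_SC(1)[OF p(1)] p(3)
          ball_sim_sym[OF p(3) class_rep_SC(1)[OF p(1)] p(2)]])
  have 3: "ball_sim G n (ind_rooted G H ?X) (K, \<phi>, [orbit G \<phi> x])"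
    by (rule ind_ball_sim_restrict[OF gcomplex_axioms assms(3) x far])
  show ?thesis
    unfolding class_sim_def
    by (rule ball_sim_trans[OF o(1,4,5) ball_sim_trans[OF o(1,3,4) ball_sim_trans[OF o(1,2,3) 1 2] 3] q(2)])
qed

section \<open>Convergence to the induced measure and sparsity of short displacements\<close>

theorem proposition3p3:
  fixes G :: "('g, 'b) monoid_scheme" and H :: "'g set" and D :: real
    and K :: "nat \<Rightarrow> 'v set set" and \<phi> :: "nat \<Rightarrow> 'g \<Rightarrow> 'v \<Rightarrow> 'v"
    and \<mu> :: "('g, nat) rcomplex set measure"
  assumes "group G" and "finite (carrier G)" and "D > 0"
    and "\<And>n. simplicial_G_complex G (K n) (\<phi> n)"
    and "\<And>n. finite (K n)"
    and "\<And>n. ereal_of_enat (vertex_degree (K n)) \<le> ereal D"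
    and "subgroup H G"
    and "random_rooted_complex (G\<lparr>carrier := H\<rparr>) D \<mu>"
    and "weakly_converges (SC_top (G\<lparr>carrier := H\<rparr>) D 1)
           (\<lambda>n. vertex_law (G\<lparr>carrier := H\<rparr>) D (K n) (\<phi> n)) \<mu>"
  shows "weakly_converges (SC_top G D 1) (\<lambda>n. vertex_law G D (K n) (\<phi> n)) (ind_measure G H D \<mu>)
     \<longleftrightarrow> (\<forall>C>0. \<forall>g\<in>carrier G - H.
            (\<lambda>n. real (card (displaced (K n) (\<phi> n) g C)) / real (card (verts (K n))))
              \<longlonglongrightarrow> 0)"
proof -
  let ?H = "G\<lparr>carrier := H\<rparr>"
  note G = assms(1,2,7)
  have gc: "gcomplex G (K n) (\<phi> n)" for n using assms(4) by unfold_locales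
  have hc: "gcomplex ?H (K n) (\<phi> n)" for n using gcomplex.subgroup_gcomplex[OF gc assms(7)] .
  note K = assms(5,6)
  have H: "H \<subseteq> carrier G" using subgroup.subset[OF assms(7)] .
  have finH: "finite (carrier ?H)" using finite_subset[OF H assms(2)] by simp
  have V: "finite (verts (K n))" for n
    using gcomplex.complex[OF gc] K(1) by (rule finite_verts)
  have \<mu>: "prob_space \<mu>" "sets \<mu> = sets (SC_borel ?H D 1)"
    using assms(8) by (auto simp: random_rooted_complex_def)
  have space_\<mu>: "space \<mu> = SC ?H D 1"
    using sets_eq_imp_space_eq[OF \<mu>(2)] by (simp add: space_SC_borel)
  have meas: "ind_class G H \<in> \<mu> \<rightarrow>\<^sub>M SC_borel G D 1"
    unfolding measurable_cong_sets[OF \<mu>(2) refl] by (rule ind_class_measurable[OF G])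
  note lawG = gcomplex.vertex_law[OF gc K] and lawH = gcomplex.vertex_law[OF hc K]
  \<comment> \<open>The weak limit over \<open>H\<close> as convergence of averages over the
    vertices, the form in which it meets the averages over \<open>G\<close>.\<close>
  have convH: "(\<lambda>n. (\<Sum>x\<in>verts (K n). f (vertex_class ?H (K n) (\<phi> n) x)) / card (verts (K n)))
      \<longlonglongrightarrow> integral\<^sup>L \<mu> f"
    if "continuous_map (SC_top ?H D 1) euclideanreal f" "bounded (f ` topspace (SC_top ?H D 1))" for f
  proof -
    have "(\<lambda>n. integral\<^sup>L (vertex_law ?H D (K n) (\<phi> n)) f) \<longlonglongrightarrow> integral\<^sup>L \<mu> f"
      using assms(9) that unfolding weakly_converges_def by blast
    then show ?thesis unfolding lawH(2)[OF SC_continuous_measurable[OF that(1)]] .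
  qed
  show ?thesis
  proof
    assume weak: "weakly_converges (SC_top G D 1) (\<lambda>n. vertex_law G D (K n) (\<phi> n)) (ind_measure G H D \<mu>)"
    show "\<forall>C>0. \<forall>g\<in>carrier G - H.
      (\<lambda>n. real (card (displaced (K n) (\<phi> n) g C)) / real (card (verts (K n)))) \<longlonglongrightarrow> 0"
    proof (intro allI impI ballI)
      fix C :: real and g assume C: "0 < C" and g: "g \<in> carrier G - H"
      define m where "m = nat \<lfloor>C\<rfloor>"
      define fG where "fG p = real (return_count G m (class_rep p))" for p
      define fH where "fH p = real (return_count ?H m (class_rep p))" for p
      note cG = continuous_return_count[where D = D and m = m, OF assms(2), folded fG_def]
      note cH = continuous_return_count[where D = D and m = m, OF finH, folded fH_def]
      \<comment> \<open>On an induced complex the count over \<open>G\<close> equals the count over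
        \<open>H\<close>, so pulling the integral back to \<open>\<mu>\<close> turns one test
        function into the other.\<close>
      have "integral\<^sup>L (ind_measure G H D \<mu>) fG = (\<integral>p. fG (ind_class G H p) \<partial>\<mu>)"
        unfolding ind_measure_def by (rule integral_distr[OF meas SC_continuous_measurable[OF cG(1)]])
      also have "\<dots> = integral\<^sup>L \<mu> fH"
        unfolding space_\<mu> fG_def fH_def
        by (rule Bochner_Integration.integral_cong[OF refl]) (simp add: space_\<mu> return_count_ind_class[OF G])
      finally have int: "integral\<^sup>L (ind_measure G H D \<mu>) fG = integral\<^sup>L \<mu> fH" .
      have "(\<lambda>n. integral\<^sup>L (vertex_law G D (K n) (\<phi> n)) fG) \<longlonglongrightarrow> integral\<^sup>L (ind_measure G H D \<mu>) fG"
        using weak cG unfolding weakly_converges_def by blast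
      then have "(\<lambda>n. (\<Sum>x\<in>verts (K n). fG (vertex_class G (K n) (\<phi> n) x)) / card (verts (K n)))
          \<longlonglongrightarrow> integral\<^sup>L \<mu> fH"
        unfolding int lawG(2)[OF SC_continuous_measurable[OF cG(1)]] .
      from tendsto_diff[OF this convH[OF cH]]
      have lim: "(\<lambda>n. ((\<Sum>x\<in>verts (K n). fG (vertex_class G (K n) (\<phi> n) x)) -
          (\<Sum>x\<in>verts (K n). fH (vertex_class ?H (K n) (\<phi> n) x))) / card (verts (K n))) \<longlonglongrightarrow> 0"
        by (simp add: diff_divide_distrib)
      \<comment> \<open>At a vertex the two counts differ by the number of elements outside
        \<open>H\<close> with a short return; \<open>g\<close> is one of them whenever it displaces
        the vertex by at most \<open>C\<close>.\<close>
      have le: "real (card (displaced (K n) (\<phi> n) g C)) \<le>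
          (\<Sum>x\<in>verts (K n). fG (vertex_class G (K n) (\<phi> n) x)) -
          (\<Sum>x\<in>verts (K n). fH (vertex_class ?H (K n) (\<phi> n) x))" for n
      proof -
        define N where "N x = nbhd (K n) {x} m" for x
        have "real (card (displaced (K n) (\<phi> n) g C)) = (\<Sum>x\<in>verts (K n). if \<phi> n g x \<in> N x then 1 else 0)"
          using V C by (simp add: displaced_eq m_def[symmetric] N_def sum.If_cases Int_def)
        also have "\<dots> \<le> (\<Sum>x\<in>verts (K n). fG (vertex_class G (K n) (\<phi> n) x) - fH (vertex_class ?H (K n) (\<phi> n) x))"
        proof (rule sum_mono)
          fix x assume x: "x \<in> verts (K n)"
          have split: "{k\<in>carrier G. \<phi> n k x \<in> N x} = {k\<in>H. \<phi> n k x \<in> N x} \<union> {k\<in>carrier G - H. \<phi> n k x \<in> N x}"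
            using H by blast
          have "card {k\<in>carrier G. \<phi> n k x \<in> N x} =
              card {k\<in>H. \<phi> n k x \<in> N x} + card {k\<in>carrier G - H. \<phi> n k x \<in> N x}"
            unfolding split using assms(2) finite_subset[OF H assms(2)] by (intro card_Un_disjoint) auto
          moreover have "(if \<phi> n g x \<in> N x then 1 else 0) \<le> card {k\<in>carrier G - H. \<phi> n k x \<in> N x}"
          proof (cases "\<phi> n g x \<in> N x")
            case True
            then have "{g} \<subseteq> {k\<in>carrier G - H. \<phi> n k x \<in> N x}" using g by blast
            then have "card {g} \<le> card {k\<in>carrier G - H. \<phi> n k x \<in> N x}"
              using assms(2) by (intro card_mono) auto
            then show ?thesis by simp
          qed simp
          ultimately show "(if \<phi> n g x \<in> N x then 1 else 0) \<le>
              fG (vertex_class G (K n) (\<phi> n) x) - fH (vertex_class ?H (K n) (\<phi> n) x)"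
            unfolding fG_def fH_def gcomplex.return_count_vertex_class[OF gc K x]
              gcomplex.return_count_vertex_class[OF hc K x] N_def[symmetric]
            by (simp split: if_splits)
        qed
        finally show ?thesis by (simp add: sum_subtractf)
      qed
      show "(\<lambda>n. real (card (displaced (K n) (\<phi> n) g C)) / real (card (verts (K n)))) \<longlonglongrightarrow> 0"
        by (rule tendsto_sandwich[OF _ _ tendsto_const lim]) (auto intro!: always_eventually divide_right_mono le)
    qed
  next
    assume sparse: "\<forall>C>0. \<forall>g\<in>carrier G - H.
      (\<lambda>n. real (card (displaced (K n) (\<phi> n) g C)) / real (card (verts (K n)))) \<longlonglongrightarrow> 0"
    have cells: "(\<lambda>k. measure (vertex_law G D (K k) (\<phi> k)) {q \<in> SC G D 1. class_sim G n p q})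
        \<longlonglongrightarrow> measure (ind_measure G H D \<mu>) {q \<in> SC G D 1. class_sim G n p q}"
      if p: "p \<in> SC G D 1" for n p
    proof -
      define A where "A = {q \<in> SC G D 1. class_sim G n p q}"
      \<comment> \<open>The cell is one class of the equivalence relation at level \<open>n\<close>.
        So its indicator is locally constant, and so is the composite \<open>fH\<close> with
        induction.\<close>
      define fG where "fG = (indicator A :: _ \<Rightarrow> real)"
      define fH where "fH q = fG (ind_class G H q)" for q
      have fG_eq: "fG q = fG r" if "q \<in> SC G D 1" "r \<in> SC G D 1" "class_sim G n q r" for q r
        using class_sim_trans[OF p that(1,2) _ that(3)]
          class_sim_trans[OF p that(2,1) _ class_sim_sym[OF that]] that(1,2)
        unfolding fG_def A_def indicator_def by auto
      have cG: "continuous_map (SC_top G D 1) euclideanreal fG"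
        using fG_eq by (rule continuous_SC_locally_constant)
      have fH_eq: "fH q = fH r" if "q \<in> SC ?H D 1" "r \<in> SC ?H D 1" "class_sim ?H n q r" for q r
        unfolding fH_def
        using ind_class(1)[OF G that(1)] ind_class(1)[OF G that(2)] class_sim_ind[OF G that] by (rule fG_eq)
      have cH: "continuous_map (SC_top ?H D 1) euclideanreal fH"
        using fH_eq by (rule continuous_SC_locally_constant)
      have bH: "bounded (fH ` topspace (SC_top ?H D 1))"
        unfolding bounded_iff fH_def fG_def by (intro exI[of _ 1]) (auto simp: indicator_def)
      have mG: "measure M A = integral\<^sup>L M fG" if "sets M = sets (SC_borel G D 1)" for M
      proof -
        have "space M = SC G D 1" using sets_eq_imp_space_eq[OF that] by (simp add: space_SC_borel)
        then have "A \<inter> space M = A" unfolding A_def by blast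
        then show ?thesis unfolding fG_def by simp
      qed
      have "integral\<^sup>L (ind_measure G H D \<mu>) fG = integral\<^sup>L \<mu> fH"
        unfolding ind_measure_def fH_def by (rule integral_distr[OF meas SC_continuous_measurable[OF cG]])
      then have mN: "measure (ind_measure G H D \<mu>) A = integral\<^sup>L \<mu> fH"
        using mG[of "ind_measure G H D \<mu>"] by (simp add: ind_measure_def)
      have mM: "measure (vertex_law G D (K k) (\<phi> k)) A =
          (\<Sum>x\<in>verts (K k). fG (vertex_class G (K k) (\<phi> k) x)) / card (verts (K k))" for k
        using mG[of "vertex_law G D (K k) (\<phi> k)"] lawG(2)[OF SC_continuous_measurable[OF cG]]
        by (simp add: vertex_law_def)
      define a where "a k = (\<Sum>x\<in>verts (K k). fH (vertex_class ?H (K k) (\<phi> k) x)) / card (verts (K k))" for k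
      \<comment> \<open>The radius 2n + 1 is the one at which
        \<open>class_sim_ind_vertex_class\<close> compares n-balls; finitely many elements outside
        \<open>H\<close> contribute, so the sum still tends to 0.\<close>
      define b where "b k = (\<Sum>g\<in>carrier G - H.
        real (card (displaced (K k) (\<phi> k) g (real (2 * n + 1)))) / real (card (verts (K k))))" for k
      have "b \<longlonglongrightarrow> (\<Sum>g\<in>carrier G - H. 0)"
        unfolding b_def using sparse by (intro tendsto_sum) simp
      then have b: "b \<longlonglongrightarrow> 0" by simp
      have close: "\<bar>measure (vertex_law G D (K k) (\<phi> k)) A - a k\<bar> \<le> b k" for k
      proof -
        let ?d = "\<lambda>x. fG (vertex_class G (K k) (\<phi> k) x) - fH (vertex_class ?H (K k) (\<phi> k) x)"
        let ?E = "\<lambda>g. displaced (K k) (\<phi> k) g (real (2 * n + 1))"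
        have E: "?E g = {x\<in>verts (K k). \<phi> k g x \<in> nbhd (K k) {x} (2 * n + 1)}" for g
        proof -
          have "nat \<lfloor>real (2 * n + 1)\<rfloor> = 2 * n + 1" by (simp only: floor_of_nat nat_int)
          then show ?thesis using displaced_eq[of "real (2 * n + 1)" "K k" "\<phi> k" g] by simp
        qed
        \<comment> \<open>Two indicator values differ by at most 1, and they agree unless some
          element outside \<open>H\<close> displaces \<open>x\<close> by at most 2n + 1: a union
          bound.\<close>
        have d: "\<bar>?d x\<bar> \<le> (\<Sum>g\<in>carrier G - H. indicator (?E g) x)" if x: "x \<in> verts (K k)" for x
        proof (cases "\<exists>g\<in>carrier G - H. x \<in> ?E g")
          case True
          then obtain g where g: "g \<in> carrier G - H" "x \<in> ?E g" by blast
          have "\<bar>?d x\<bar> \<le> 1" unfolding fH_def fG_def by (auto simp: indicator_def)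
          also have "\<dots> = indicator (?E g) x" using g(2) by simp
          also have "\<dots> \<le> (\<Sum>g\<in>carrier G - H. indicator (?E g) x)"
            using g(1) assms(2) by (intro member_le_sum) auto
          finally show ?thesis .
        next
          case False
          then have far: "\<phi> k g x \<notin> nbhd (K k) {x} (2 * n + 1)" if "g \<in> carrier G - H" for g
            using that x unfolding E by blast
          have "fG (ind_class G H (vertex_class ?H (K k) (\<phi> k) x)) = fG (vertex_class G (K k) (\<phi> k) x)"
            by (rule fG_eq[OF ind_class(1)[OF G gcomplex.vertex_class(1)[OF hc K x]]
                  gcomplex.vertex_class(1)[OF gc K x]
                  class_sim_ind_vertex_class[OF gc assms(2,7) K x far]])
          then have "?d x = 0" unfolding fH_def by simp
          then show ?thesis by (simp add: sum_nonneg)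
        qed
        have "\<bar>\<Sum>x\<in>verts (K k). ?d x\<bar> \<le> (\<Sum>x\<in>verts (K k). \<bar>?d x\<bar>)" by (rule sum_abs)
        also have "\<dots> \<le> (\<Sum>x\<in>verts (K k). \<Sum>g\<in>carrier G - H. indicator (?E g) x)"
          using d by (rule sum_mono)
        also have "\<dots> = (\<Sum>g\<in>carrier G - H. \<Sum>x\<in>verts (K k). indicator (?E g) x)"
          by (rule sum.swap)
        also have "\<dots> = (\<Sum>g\<in>carrier G - H. real (card (?E g)))"
        proof (rule sum.cong[OF refl])
          fix g
          have "verts (K k) \<inter> ?E g = ?E g" unfolding E by blast
          then show "(\<Sum>x\<in>verts (K k). indicator (?E g) x) = real (card (?E g))"
            unfolding indicator_def using V[of k] by (simp only: sum_of_bool_eq Collect_mem_eq)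
        qed
        finally have "\<bar>\<Sum>x\<in>verts (K k). ?d x\<bar> / card (verts (K k)) \<le>
            (\<Sum>g\<in>carrier G - H. real (card (?E g))) / card (verts (K k))"
          by (rule divide_right_mono) simp
        moreover have "measure (vertex_law G D (K k) (\<phi> k)) A - a k = (\<Sum>x\<in>verts (K k). ?d x) / card (verts (K k))"
          unfolding mM a_def by (simp add: sum_subtractf diff_divide_distrib)
        ultimately show ?thesis
          unfolding b_def by (simp add: sum_divide_distrib[symmetric] abs_divide)
      qed
      have "(\<lambda>k. measure (vertex_law G D (K k) (\<phi> k)) A - a k) \<longlonglongrightarrow> 0"
        by (rule Lim_null_comparison[OF _ b]) (use close in simp)
      moreover have "a \<longlonglongrightarrow> integral\<^sup>L \<mu> fH"
        unfolding a_def by (rule convH[OF cH bH])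
      ultimately have "(\<lambda>k. (measure (vertex_law G D (K k) (\<phi> k)) A - a k) + a k) \<longlonglongrightarrow> 0 + integral\<^sup>L \<mu> fH"
        by (rule tendsto_add)
      then have "(\<lambda>k. measure (vertex_law G D (K k) (\<phi> k)) A) \<longlonglongrightarrow> measure (ind_measure G H D \<mu>) A"
        unfolding mN diff_add_cancel add_0 .
      then show ?thesis unfolding A_def .
    qed
    have "sets (vertex_law G D (K k) (\<phi> k)) = sets (SC_borel G D 1)" for k
      by (simp add: vertex_law_def)
    moreover have "prob_space (ind_measure G H D \<mu>)"
      unfolding ind_measure_def by (rule prob_space.prob_space_distr[OF \<mu>(1) meas])
    moreover have "sets (ind_measure G H D \<mu>) = sets (SC_borel G D 1)"
      by (simp add: ind_measure_def)
    ultimately show "weakly_converges (SC_top G D 1) (\<lambda>n. vertex_law G D (K n) (\<phi> n)) (ind_measure G H D \<mu>)"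
      using cells by (rule SC_weakly_convergesI[OF assms(2) lawG(1)])
  qed
qed

end
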